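(* The stopping time $$\tau^*(\phi_0,\phi_1)\triangleq\inf\{t\ge0:\ V(\tilde\Phi_t)=0,\ \tilde\Phi_0=(\phi_0,\phi_1)\}$$ is the smallest optimal stopping time for the problem defining $V$: for every $(\phi_0,\phi_1)\in\mathbb{R}_+^2$, $\tau^*$ attains the infimum in the definition of $V(\phi_0,\phi_1)$, and every $\tau\in\mathcal{S}$ attaining this infimum satisfies $\tau\ge\tau^*$ almost surely.
   Context: Parameters: $\lambda>0$, $\mu>0$, $c>0$, $m\in(1,2)$. On a probability space with measure $\mathbb{P}_0$, $N=(N_t)_{t\ge0}$ is a Poisson process with rate $\mu$ and jump times $\sigma_1<\sigma_2<\dots$ ($\sigma_0=0$), and $Y_1,Y_2,\dots$ are i.i.d. strictly positive random variables with common distribution $\beta_0$ on $\mathbb{R}^d$, independent of $N$. $X_t=X_0+\sum_{k=1}^{N_t}Y_k$, $\mathbb{F}$ is the natural filtration of $X$, and $\mathcal{S}$ is the set of $\mathbb{F}$-stopping times (the value $+\infty$ is allowed; $\inf\emptyset=\infty$). $\beta_1$ is a probability measure on $\mathbb{R}^d$ with $\beta_0,\beta_1$ mutually absolutely continuous and $r=d\beta_1/d\beta_0$. Define $x(t,x_0)=-\frac{\lambda(2-m)}{\lambda-1}+e^{(\lambda-1)t}\left[x_0+\frac{\lambda(2-m)}{\lambda-1}\right]$ if $\lambda\ne1$ and $x(t,x_0)=x_0+(2-m)t$ if $\lambda=1$; $y(t,y_0)=-\frac{\lambda(m-1)}{\lambda-2}+e^{(\lambda-2)t}\left[y_0+\frac{\lambda(m-1)}{\lambda-2}\right]$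 if $\lambda\ne2$ and $y(t,y_0)=y_0+2(m-1)t$ if $\lambda=2$. The piecewise deterministic Markov process $\tilde\Phi=(\tilde\Phi^{(0)},\tilde\Phi^{(1)})$ in $\mathbb{R}_+^2$ (with $\mathbb{R}_+=[0,\infty)$), started at $\tilde\Phi_0=(\phi_0,\phi_1)$, is given by $\tilde\Phi^{(0)}_t=x(t-\sigma_n,\tilde\Phi^{(0)}_{\sigma_n})$, $\tilde\Phi^{(1)}_t=y(t-\sigma_n,\tilde\Phi^{(1)}_{\sigma_n})$ for $\sigma_n\le t<\sigma_{n+1}$, $n\ge0$, and $\tilde\Phi^{(0)}_{\sigma_n}=(1+\frac1\mu)r(Y_n)\tilde\Phi^{(0)}_{\sigma_n-}$, $\tilde\Phi^{(1)}_{\sigma_n}=(1+\frac2\mu)r(Y_n)\tilde\Phi^{(1)}_{\sigma_n-}$ for $n\ge1$. $\mathbb{E}_0^{\phi_0,\phi_1}$ is the $\mathbb{P}_0$-expectation given $\tilde\Phi_0=(\phi_0,\phi_1)$. The running cost is $g(\phi_0,\phi_1)=\phi_0+\phi_1-\frac{\lambda}{c}$ and the value function is $V(\phi_0,\phi_1)=\inf_{\tau\in\mathcal{S}}\mathbb{E}_0^{\phi_0,\phi_1}\left[\int_0^{\tau}e^{-\lambda t}g(\tilde\Phi_t)\,dt\right]$. *)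

theory Defs
  imports "HOL-Probability.Probability"
begin

text \<open>
  Integral of a function with values in the extended reals, as the difference of the integrals of
  its positive and negative parts.  Below, the integrand \<open>g\<close> is bounded from below by a constant and
  is discounted, so the negative parts always have finite integral, while the positive part may
  well have an infinite one (for instance for the stopping time that is constantly infinite).
  The Bochner integral would return 0 there and is therefore not usable.
\<close>

definition ext_integral :: "'b measure \<Rightarrow> ('b \<Rightarrow> ereal) \<Rightarrow> ereal" where
  "ext_integral M f =
     enn2ereal (\<integral>\<^sup>+ x. e2ennreal (f x) \<partial>M) - enn2ereal (\<integral>\<^sup>+ x. e2ennreal (- f x) \<partial>M)"

text \<open>
  A Poisson process with the given rate, together with its jump times: a counting process with
  independent Poisson increments.  The paths are counting paths for every outcome, with
  \<open>0 = \<sigma> 0 < \<sigma> 1 < \<dots>\<close> tending to infinity; hence \<open>N\<close> is nondecreasing in time and the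
  truncated subtraction on \<^typ>\<open>nat\<close> gives the increments.
\<close>

definition (in prob_space) poisson_process ::
    "real \<Rightarrow> (real \<Rightarrow> 'a \<Rightarrow> nat) \<Rightarrow> (nat \<Rightarrow> 'a \<Rightarrow> real) \<Rightarrow> bool" where
  "poisson_process rate N \<sigma> \<longleftrightarrow>
     (\<forall>t\<ge>0. N t \<in> measurable M (count_space UNIV)) \<and>
     (\<forall>\<omega>\<in>space M. \<sigma> 0 \<omega> = 0 \<and> strict_mono (\<lambda>n. \<sigma> n \<omega>) \<and>
        (\<forall>t\<ge>0. finite {n. 1 \<le> n \<and> \<sigma> n \<omega> \<le> t} \<and> N t \<omega> = card {n. 1 \<le> n \<and> \<sigma> n \<omega> \<le> t})) \<and>
     (\<forall>t :: nat \<Rightarrow> real. 0 \<le> t 0 \<and> mono t \<longrightarrow>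
        indep_vars (\<lambda>_. count_space UNIV) (\<lambda>i \<omega>. N (t (Suc i)) \<omega> - N (t i) \<omega>) UNIV) \<and>
     (\<forall>s t. 0 \<le> s \<and> s < t \<longrightarrow>
        distr M (count_space UNIV) (\<lambda>\<omega>. N t \<omega> - N s \<omega>) = measure_pmf (poisson_pmf (rate * (t - s))))"

definition flow0 :: "real \<Rightarrow> real \<Rightarrow> real \<Rightarrow> real \<Rightarrow> real" where
  "flow0 lam m t x0 =
     (if lam = 1 then x0 + (2 - m) * t
      else - (lam * (2 - m) / (lam - 1)) + exp ((lam - 1) * t) * (x0 + lam * (2 - m) / (lam - 1)))"

definition flow1 :: "real \<Rightarrow> real \<Rightarrow> real \<Rightarrow> real \<Rightarrow> real" where
  "flow1 lam m t y0 =
     (if lam = 2 then y0 + 2 * (m - 1) * t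
      else - (lam * (m - 1) / (lam - 2)) + exp ((lam - 2) * t) * (y0 + lam * (m - 1) / (lam - 2)))"

text \<open>
  The marks are \<open>Y 1, Y 2, \<dots>\<close>; the vector \<open>Y 0\<close> is never used.  The initial value \<open>X0\<close> may be
  random, but has to be independent of \<open>N\<close> and the marks (automatic if it is constant).
  Independence is stated for the generated sigma-algebras because \<^const>\<open>prob_space.indep_var\<close>
  needs both variables to have the same value type.
  The function \<open>r\<close> is an arbitrary finite version of the density of \<open>\<beta>1\<close> with respect to \<open>\<beta>0\<close>.
\<close>

locale poisson_disorder = prob_space M
  for M :: "'a measure" +
  fixes lam mu c m :: real
    and N :: "real \<Rightarrow> 'a \<Rightarrow> nat" and \<sigma> :: "nat \<Rightarrow> 'a \<Rightarrow> real"
    and Y :: "nat \<Rightarrow> 'a \<Rightarrow> real ^ 'd" and X0 :: "'a \<Rightarrow> real ^ 'd"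
    and \<beta>0 \<beta>1 :: "(real ^ 'd) measure" and r :: "real ^ 'd \<Rightarrow> real"
  assumes lam_pos: "0 < lam" and mu_pos: "0 < mu" and c_pos: "0 < c"
    and m_gt: "1 < m" and m_less: "m < 2"
    and poisson: "poisson_process mu N \<sigma>"
    and Y_indep: "indep_vars (\<lambda>_. borel) Y {1..}"
    and Y_distr: "\<And>k. 1 \<le> k \<Longrightarrow> distr M borel (Y k) = \<beta>0"
    and Y_pos: "\<And>k \<omega> i. 1 \<le> k \<Longrightarrow> \<omega> \<in> space M \<Longrightarrow> 0 < Y k \<omega> $ i"
    and N_indep_Y:
      "indep_set
         (sets (vimage_algebra (space M) (\<lambda>\<omega>. \<lambda>t\<in>{0..}. N t \<omega>) (PiM {0..} (\<lambda>_. count_space UNIV))))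
         (sets (vimage_algebra (space M) (\<lambda>\<omega>. \<lambda>k\<in>{1..}. Y k \<omega>) (PiM {1..} (\<lambda>_. borel))))"
    and X0_indep:
      "indep_set
         (sets (vimage_algebra (space M) X0 borel))
         (sets (vimage_algebra (space M) (\<lambda>\<omega>. (\<lambda>t\<in>{0..}. N t \<omega>, \<lambda>k\<in>{1..}. Y k \<omega>))
            (PiM {0..} (\<lambda>_. count_space UNIV) \<Otimes>\<^sub>M PiM {1..} (\<lambda>_. borel))))"
    and \<beta>1_prob: "prob_space \<beta>1" and \<beta>1_sets: "sets \<beta>1 = sets borel"
    and ac_01: "absolutely_continuous \<beta>0 \<beta>1" and ac_10: "absolutely_continuous \<beta>1 \<beta>0"
    and r_measurable: "r \<in> borel_measurable borel" and r_nonneg: "\<And>y. 0 \<le> r y"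
    and r_density: "\<beta>1 = density \<beta>0 (\<lambda>y. ennreal (r y))"
begin

definition X :: "real \<Rightarrow> 'a \<Rightarrow> real ^ 'd" where
  "X t \<omega> = X0 \<omega> + (\<Sum>k=1..N t \<omega>. Y k \<omega>)"

text \<open>
  The time index set is extended by infinity, so that stopping times may be infinite; the extra
  condition at time infinity in \<^const>\<open>stopping_time\<close> is trivially true.
\<close>

definition F :: "ennreal \<Rightarrow> 'a measure" where
  "F t = sigma (space M) {X s -` B \<inter> space M | s B. 0 \<le> s \<and> ennreal s \<le> t \<and> B \<in> sets borel}"

text \<open>
  \<open>jump0 \<phi>0 n \<omega>\<close> and \<open>jump1 \<phi>1 n \<omega>\<close> are the components of the process at time \<open>\<sigma> n\<close>.  By
  continuity of the flows, the left limit at \<open>\<sigma> (n + 1)\<close> is the flow run for the time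
  \<open>\<sigma> (n + 1) - \<sigma> n\<close> from the value at \<open>\<sigma> n\<close>.
\<close>

primrec jump0 :: "real \<Rightarrow> nat \<Rightarrow> 'a \<Rightarrow> real" where
  "jump0 \<phi>0 0 \<omega> = \<phi>0"
| "jump0 \<phi>0 (Suc n) \<omega> =
     (1 + 1 / mu) * r (Y (Suc n) \<omega>) * flow0 lam m (\<sigma> (Suc n) \<omega> - \<sigma> n \<omega>) (jump0 \<phi>0 n \<omega>)"

primrec jump1 :: "real \<Rightarrow> nat \<Rightarrow> 'a \<Rightarrow> real" where
  "jump1 \<phi>1 0 \<omega> = \<phi>1"
| "jump1 \<phi>1 (Suc n) \<omega> =
     (1 + 2 / mu) * r (Y (Suc n) \<omega>) * flow1 lam m (\<sigma> (Suc n) \<omega> - \<sigma> n \<omega>) (jump1 \<phi>1 n \<omega>)"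

text \<open>Note that \<open>N t \<omega>\<close> is the unique \<open>n\<close> with \<open>\<sigma> n \<omega> \<le> t < \<sigma> (n + 1) \<omega>\<close>.\<close>

definition \<Phi>0 :: "real \<Rightarrow> real \<Rightarrow> 'a \<Rightarrow> real" where
  "\<Phi>0 \<phi>0 t \<omega> = flow0 lam m (t - \<sigma> (N t \<omega>) \<omega>) (jump0 \<phi>0 (N t \<omega>) \<omega>)"

definition \<Phi>1 :: "real \<Rightarrow> real \<Rightarrow> 'a \<Rightarrow> real" where
  "\<Phi>1 \<phi>1 t \<omega> = flow1 lam m (t - \<sigma> (N t \<omega>) \<omega>) (jump1 \<phi>1 (N t \<omega>) \<omega>)"

definition g :: "real \<Rightarrow> real \<Rightarrow> real" where
  "g \<phi>0 \<phi>1 = \<phi>0 + \<phi>1 - lam / c"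

definition expected_cost :: "('a \<Rightarrow> ennreal) \<Rightarrow> real \<Rightarrow> real \<Rightarrow> ereal" where
  "expected_cost \<tau> \<phi>0 \<phi>1 =
     ext_integral M (\<lambda>\<omega>. ext_integral lborel (\<lambda>t.
       ereal (indicator {t. 0 \<le> t \<and> ennreal t \<le> \<tau> \<omega>} t
              * (exp (- lam * t) * g (\<Phi>0 \<phi>0 t \<omega>) (\<Phi>1 \<phi>1 t \<omega>)))))"

definition V :: "real \<Rightarrow> real \<Rightarrow> ereal" where
  "V \<phi>0 \<phi>1 = (INF \<tau>\<in>{\<tau>. stopping_time F \<tau>}. expected_cost \<tau> \<phi>0 \<phi>1)"

definition tau_star :: "real \<Rightarrow> real \<Rightarrow> 'a \<Rightarrow> ennreal" where
  "tau_star \<phi>0 \<phi>1 \<omega> = Inf {ennreal t | t. 0 \<le> t \<and> V (\<Phi>0 \<phi>0 t \<omega>) (\<Phi>1 \<phi>1 t \<omega>) = 0}"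

definition optimal :: "('a \<Rightarrow> ennreal) \<Rightarrow> real \<Rightarrow> real \<Rightarrow> bool" where
  "optimal \<tau> \<phi>0 \<phi>1 \<longleftrightarrow> stopping_time F \<tau> \<and> expected_cost \<tau> \<phi>0 \<phi>1 = V \<phi>0 \<phi>1"

end

end

theory Submission
  imports Defs
begin

text \<open>
  Stopping immediately is worth 0, so the stopping region is where \<open>V\<close> reaches its upper bound.
  The running cost \<open>g\<close> changes sign; since \<open>\<integral>\<^sub>0\<^sup>\<tau> exp (- lam * t) * lam / c dt\<close> equals
  \<open>1 / c - exp (- lam * \<tau>) / c\<close>, adding the constant \<open>1 / c\<close> to the cost turns it into
  \<open>J \<tau> z = E [run z \<tau> + exp (- lam * \<tau>) / c]\<close>, where \<open>run\<close> accumulates the nonnegative load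
  \<open>\<Phi>0 + \<Phi>1\<close> with discounting (\<open>expected_cost_eq_J\<close>).  All estimates can then be made with
  nonnegative integrals, and the stopping region becomes the contact set of the shifted value with
  its upper bound \<open>1 / c\<close>.

  The candidate \<open>w\<close> for the shifted value is constructed analytically.  The operator \<open>Q h\<close> lets the
  process run for a time \<open>h\<close>; iterating \<open>min (1 / c) \<circ> Q h\<close> for \<open>h = 2 powr - k\<close> gives the values of
  problems in which stopping is allowed on a dyadic grid only, and \<open>w\<close> is the infimum over finer and
  finer grids and longer and longer horizons.  Each grid value is attained by a grid stopping time
  obtained by backward recursion (\<open>J_grid_stop\<close>), so \<open>w\<close> is at least the infimum of \<open>J\<close>.
  Conversely \<open>w \<le> Q h w\<close> for dyadic \<open>h\<close> (\<open>w_le_Q\<close>).  By the Markov property (\<open>markov_step\<close>) the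
  process \<open>run z t + exp (- lam * t) * w (\<Phi> z t)\<close> is therefore a submartingale along each dyadic
  grid, and right continuity of the paths together with continuity of \<open>w\<close> (\<open>w_continuous\<close>) extends
  the inequality to arbitrary ordered bounded stopping times (\<open>optional_stopping\<close>).  Letting the
  bound tend to infinity gives \<open>w \<le> J \<tau>\<close> for every stopping time (\<open>w_le_J\<close>), hence
  \<open>V = w - 1 / c\<close>.  Continuity of \<open>w\<close> is automatic from above, as for any infimum of continuous
  functions; from below it follows from monotonicity and the scaling inequality
  \<open>\<alpha> * w z \<le> w (\<alpha> * z)\<close>, which hold because the process is monotone in its starting point and
  satisfies the same inequality.

  Minimality: \<open>J \<tau>\<close> splits into the expectation of the stopped submartingale, which is at least \<open>w\<close>,
  and the expected \<open>gap\<close>, the discounted difference between \<open>1 / c\<close> and \<open>w\<close> at the time of stopping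
  (\<open>J_split\<close>).  An optimal stopping time has expected gap zero, so almost surely it stops only where
  \<open>w = 1 / c\<close>, that is, not before the first visit to the contact set (\<open>optimal_after_contact\<close>).

  Existence: let \<open>S\<^sub>\<epsilon>\<close> be the first time at which \<open>w\<close> comes within \<open>\<epsilon>\<close> of \<open>1 / c\<close>.  Near-optimal
  stopping times with summable gaps are almost surely, on every bounded time interval,
  eventually not earlier than \<open>S\<^sub>\<epsilon>\<close> (\<open>ae_reach_contact\<close>), and stopping them already at \<open>S\<^sub>\<epsilon>\<close> costs at
  most \<open>\<epsilon>\<close> (\<open>J_stop_at_contact\<close>); Fatou's lemma yields \<open>J S\<^sub>\<epsilon> \<le> w + \<epsilon>\<close> (\<open>J_hit_contact\<close>).  As \<open>\<epsilon>\<close>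
  decreases to 0, the times \<open>S\<^sub>\<epsilon>\<close> increase to a limit that is optimal, again by Fatou.  This limit
  is at most the first visit to the contact set, and by the minimality already shown it is almost surely
  at least that visit, so the visit is optimal as well (\<open>hit_contact_optimal\<close>).  The comparison is one
  of times, not of states, because the \<open>S\<^sub>\<epsilon>\<close> might approach a jump from the left, and the state after
  that jump could a priori lie outside the contact set.

  Stopping times refer to the natural filtration itself.  That the first visit to a closed
  set is one of them (\<open>stopping_time_hit\<close>) rests on the deterministic motion between jumps: whether
  the set has been visited by time \<open>t\<close> is a function of the jump times and marks up to time \<open>t\<close>.
\<close>

section \<open>Affine flows with multiplicative jumps\<close>

text \<open>
  The solution at time \<open>t\<close> of \<open>x' = a * x + b\<close> started at \<open>x\<close>.  Both coordinates of the process move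
  along such flows with \<open>b \<ge> 0\<close>, so their common properties are proved once.
\<close>

definition aflow :: "real \<Rightarrow> real \<Rightarrow> real \<Rightarrow> real \<Rightarrow> real" where
  "aflow a b t x = (if a = 0 then x + b * t else - (b / a) + exp (a * t) * (x + b / a))"

lemma flow0_eq_aflow: "flow0 lam m t x = aflow (lam - 1) (lam * (2 - m)) t x"
  by (auto simp: flow0_def aflow_def)

lemma flow1_eq_aflow: "flow1 lam m t x = aflow (lam - 2) (lam * (m - 1)) t x"
  by (auto simp: flow1_def aflow_def)

lemma aflow_0 [simp]: "aflow a b 0 x = x"
  by (simp add: aflow_def)

lemma aflow_add: "aflow a b (s + t) x = aflow a b t (aflow a b s x)"
  by (simp add: aflow_def algebra_simps exp_add)

lemma aflow_affine: "aflow a b t x = aflow a b t 0 + exp (a * t) * x"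
  by (simp add: aflow_def algebra_simps)

text \<open>
  The flow from 0 is \<open>b\<close> times the integral of \<open>exp (a * u)\<close> over \<open>u\<close> in \<open>[0, t]\<close>.
\<close>

lemma aflow_bounds_0:
  assumes "0 \<le> b" "0 \<le> t"
  shows "0 \<le> aflow a b t 0" and "aflow a b t 0 \<le> b * t * exp (\<bar>a\<bar> * t)"
proof -
  have "0 \<le> aflow a b t 0 \<and> aflow a b t 0 \<le> b * t * exp (\<bar>a\<bar> * t)"
  proof (cases "a = 0")
    case True
    then show ?thesis using assms by (simp add: aflow_def)
  next
    case False
    have eq: "aflow a b t 0 = b * ((exp (a * t) - 1) / a)"
      using False by (simp add: aflow_def field_simps)
    have 1: "0 \<le> (exp (a * t) - 1) / a"
    proof (cases "0 < a")
      case True then show ?thesis using assms by (intro divide_nonneg_pos) auto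
    next
      case F: False
      then have "a < 0" using False by simp
      then show ?thesis using assms
        by (intro divide_nonpos_neg) (auto simp: mult_nonpos_nonneg)
    qed
    have 2: "(exp (a * t) - 1) / a \<le> t * exp (\<bar>a\<bar> * t)"
    proof (cases "0 < a")
      case True
      have "1 + (- a * t) \<le> exp (- a * t)" by (rule exp_ge_add_one_self)
      then have "(1 - a * t) * exp (a * t) \<le> exp (- a * t) * exp (a * t)"
        by (intro mult_right_mono) auto
      then have "exp (a * t) - 1 \<le> a * t * exp (a * t)"
        by (simp add: algebra_simps flip: exp_add)
      then show ?thesis using True by (simp add: field_simps)
    next
      case F: False
      then have a: "a < 0" using False by simp
      have "1 + a * t \<le> exp (a * t)" by (rule exp_ge_add_one_self)
      then have "(exp (a * t) - 1) / a \<le> t" using a by (simp add: field_simps)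
      also have "t \<le> t * exp (\<bar>a\<bar> * t)" using assms by (simp add: mult_le_cancel_left1)
      finally show ?thesis .
    qed
    show ?thesis unfolding eq using 1 2 assms
      by (metis mult.assoc mult_left_mono mult_nonneg_nonneg)
  qed
  then show "0 \<le> aflow a b t 0" "aflow a b t 0 \<le> b * t * exp (\<bar>a\<bar> * t)" by auto
qed

lemma aflow_nonneg:
  assumes "0 \<le> b" "0 \<le> t" "0 \<le> x"
  shows "0 \<le> aflow a b t x"
  unfolding aflow_affine[of a b t x] using aflow_bounds_0(1)[OF assms(1,2)] assms by simp

lemma aflow_mono: "x \<le> y \<Longrightarrow> aflow a b t x \<le> aflow a b t y"
  unfolding aflow_affine[of a b t x] aflow_affine[of a b t y] by simp

text \<open>
  The flow is affine with nonnegative value at 0, and scaling down the starting point does not scale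
  down that constant.
\<close>

lemma aflow_scale:
  assumes "0 \<le> b" "0 \<le> t" "\<alpha> \<le> 1"
  shows "\<alpha> * aflow a b t x \<le> aflow a b t (\<alpha> * x)"
proof -
  have "\<alpha> * aflow a b t 0 \<le> 1 * aflow a b t 0"
    using aflow_bounds_0(1)[OF assms(1,2)] assms(3) by (intro mult_right_mono)
  then show ?thesis
    unfolding aflow_affine[of a b t x] aflow_affine[of a b t "\<alpha> * x"] by (simp add: algebra_simps)
qed

text \<open>
  The summand 1 makes the bound multiplicative, so that it can be chained over successive jumps.
\<close>

lemma aflow_growth:
  assumes b: "0 \<le> b" and t: "0 \<le> t" and x: "0 \<le> x"
  shows "aflow a b t x + 1 \<le> exp ((\<bar>a\<bar> + b) * t) * (x + 1)"
proof -
  have "aflow a b t x + 1 \<le> b * t * exp (\<bar>a\<bar> * t) + exp (\<bar>a\<bar> * t) * x + exp (\<bar>a\<bar> * t)"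
  proof -
    have "exp (a * t) * x \<le> exp (\<bar>a\<bar> * t) * x"
      using t x by (intro mult_right_mono) (auto intro!: mult_right_mono)
    moreover have "1 \<le> exp (\<bar>a\<bar> * t)" using t by simp
    ultimately show ?thesis
      using aflow_bounds_0(2)[OF b t, of a] unfolding aflow_affine[of a b t x] by linarith
  qed
  also have "\<dots> \<le> exp (\<bar>a\<bar> * t) * ((1 + b * t) * (x + 1))"
    using b t x by (simp add: algebra_simps)
  also have "\<dots> \<le> exp (\<bar>a\<bar> * t) * (exp (b * t) * (x + 1))"
    using x by (intro mult_left_mono mult_right_mono exp_ge_add_one_self) auto
  finally show ?thesis by (simp add: algebra_simps exp_add)
qed

lemma tendsto_aflow:
  assumes "(f \<longlongrightarrow> s) F" "(g \<longlongrightarrow> x) F"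
  shows "((\<lambda>i. aflow a b (f i) (g i)) \<longlongrightarrow> aflow a b s x) F"
  using assms unfolding aflow_def by (cases "a = 0") (auto intro!: tendsto_eq_intros)

lemma measurable_aflow [measurable (raw)]:
  assumes "f \<in> borel_measurable M" "g \<in> borel_measurable M"
  shows "(\<lambda>\<omega>. aflow a b (f \<omega>) (g \<omega>)) \<in> borel_measurable M"
  using assms unfolding aflow_def by (cases "a = 0") auto

text \<open>
  Post-jump values of a path with jump times \<open>T\<close>: at the \<open>n\<close>-th jump the value is multiplied by
  \<open>\<rho> * R n\<close>.
\<close>

primrec pjump ::
    "real \<Rightarrow> real \<Rightarrow> real \<Rightarrow> (nat \<Rightarrow> real) \<Rightarrow> (nat \<Rightarrow> real) \<Rightarrow> real \<Rightarrow> nat \<Rightarrow> real" where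
  "pjump a b \<rho> T R x 0 = x"
| "pjump a b \<rho> T R x (Suc n) =
     \<rho> * R (Suc n) * aflow a b (T (Suc n) - T n) (pjump a b \<rho> T R x n)"

text \<open>
  The number of jumps up to time \<open>t\<close>, as a total function of the jump times alone.
\<close>

definition jump_index :: "(nat \<Rightarrow> real) \<Rightarrow> real \<Rightarrow> nat" where
  "jump_index T t = (LEAST n. t < T (Suc n))"

definition pdmp ::
    "real \<Rightarrow> real \<Rightarrow> real \<Rightarrow> (nat \<Rightarrow> real) \<Rightarrow> (nat \<Rightarrow> real) \<Rightarrow> real \<Rightarrow> real \<Rightarrow> real" where
  "pdmp a b \<rho> T R x t =
     aflow a b (t - T (jump_index T t)) (pjump a b \<rho> T R x (jump_index T t))"

lemma jump_index_eqI:
  assumes "mono T" "T n \<le> t" "t < T (Suc n)"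
  shows "jump_index T t = n"
  unfolding jump_index_def
proof (rule Least_equality)
  show "t < T (Suc n)" by (rule assms(3))
next
  fix k assume "t < T (Suc k)"
  with assms(2) have "T n < T (Suc k)" by simp
  then show "n \<le> k" using assms(1) by (metis leD linorder_not_less monoD not_less_eq_eq)
qed

lemma jump_index_works:
  assumes "mono T" "T 0 \<le> t" "\<exists>n. t < T (Suc n)"
  shows "T (jump_index T t) \<le> t" "t < T (Suc (jump_index T t))"
proof -
  show 1: "t < T (Suc (jump_index T t))"
    unfolding jump_index_def using assms(3) by (rule LeastI_ex)
  show "T (jump_index T t) \<le> t"
  proof (cases "jump_index T t")
    case 0 then show ?thesis using assms by simp
  next
    case (Suc k)
    then have "\<not> t < T (Suc k)" unfolding jump_index_def by (metis lessI not_less_Least)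
    then show ?thesis using Suc by simp
  qed
qed

context
  fixes a b \<rho> :: real and T R :: "nat \<Rightarrow> real"
  assumes b: "0 \<le> b" and \<rho>: "0 \<le> \<rho>" and R: "\<And>n. 0 \<le> R n" and T: "mono T"
begin

lemma pjump_nonneg: "0 \<le> x \<Longrightarrow> 0 \<le> pjump a b \<rho> T R x n"
  using T by (induction n) (auto intro!: mult_nonneg_nonneg aflow_nonneg b \<rho> R simp: mono_iff_le_Suc)

lemma pjump_mono: "x \<le> y \<Longrightarrow> pjump a b \<rho> T R x n \<le> pjump a b \<rho> T R y n"
  by (induction n) (auto intro!: mult_left_mono aflow_mono mult_nonneg_nonneg \<rho> R)

lemma pjump_scale:
  assumes "0 \<le> \<alpha>" "\<alpha> \<le> 1"
  shows "\<alpha> * pjump a b \<rho> T R x n \<le> pjump a b \<rho> T R (\<alpha> * x) n"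
proof (induction n)
  case (Suc n)
  have d: "0 \<le> T (Suc n) - T n" using T by (simp add: mono_iff_le_Suc)
  have "\<alpha> * pjump a b \<rho> T R x (Suc n) =
      \<rho> * R (Suc n) * (\<alpha> * aflow a b (T (Suc n) - T n) (pjump a b \<rho> T R x n))"
    by (simp add: algebra_simps)
  also have "\<dots> \<le> \<rho> * R (Suc n) * aflow a b (T (Suc n) - T n) (pjump a b \<rho> T R (\<alpha> * x) n)"
    by (intro mult_left_mono order_trans[OF aflow_scale[OF b d assms(2)]] aflow_mono Suc
        mult_nonneg_nonneg \<rho> R)
  finally show ?case by simp
qed simp

lemma tendsto_pjump:
  "(f \<longlongrightarrow> x) F \<Longrightarrow> ((\<lambda>i. pjump a b \<rho> T R (f i) n) \<longlongrightarrow> pjump a b \<rho> T R x n) F"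
  by (induction n) (auto intro!: tendsto_eq_intros tendsto_aflow)

text \<open>
  With \<open>y \<ge> 0\<close>, a jump turns \<open>y + 1\<close> into \<open>\<rho> * R k * y + 1 \<le> (1 + \<rho> * R k) * (y + 1)\<close>; the
  exponential factors from the flows telescope.
\<close>

lemma pjump_growth:
  assumes x: "0 \<le> x"
  shows "pjump a b \<rho> T R x n + 1 \<le>
    exp ((\<bar>a\<bar> + b) * (T n - T 0)) * (x + 1) * (\<Prod>k=1..n. 1 + \<rho> * R k)"
proof (induction n)
  case (Suc n)
  let ?j = "pjump a b \<rho> T R x n" and ?P = "\<Prod>k=1..n. 1 + \<rho> * R k"
  have d: "0 \<le> T (Suc n) - T n" using T by (simp add: mono_iff_le_Suc)
  have j: "0 \<le> ?j" by (rule pjump_nonneg[OF x])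
  have fl: "0 \<le> aflow a b (T (Suc n) - T n) ?j" by (rule aflow_nonneg[OF b d j])
  have rr: "0 \<le> \<rho> * R (Suc n)" using \<rho> R by simp
  have "pjump a b \<rho> T R x (Suc n) + 1 \<le> (1 + \<rho> * R (Suc n)) * (aflow a b (T (Suc n) - T n) ?j + 1)"
    using rr fl by (simp add: algebra_simps)
  also have "\<dots> \<le> (1 + \<rho> * R (Suc n)) * (exp ((\<bar>a\<bar> + b) * (T (Suc n) - T n)) * (?j + 1))"
    using rr by (intro mult_left_mono aflow_growth b d j) auto
  also have "\<dots> \<le> (1 + \<rho> * R (Suc n)) * (exp ((\<bar>a\<bar> + b) * (T (Suc n) - T n)) *
      (exp ((\<bar>a\<bar> + b) * (T n - T 0)) * (x + 1) * ?P))"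
    using rr by (intro mult_left_mono Suc) auto
  also have "\<dots> = exp ((\<bar>a\<bar> + b) * (T (Suc n) - T n)) * exp ((\<bar>a\<bar> + b) * (T n - T 0)) *
      (x + 1) * (?P * (1 + \<rho> * R (Suc n)))"
    by (simp only: mult_ac)
  also have "exp ((\<bar>a\<bar> + b) * (T (Suc n) - T n)) * exp ((\<bar>a\<bar> + b) * (T n - T 0)) =
      exp ((\<bar>a\<bar> + b) * (T (Suc n) - T 0))"
    by (simp flip: exp_add add: algebra_simps)
  finally show ?case by simp
qed simp

lemma pdmp_mono: "x \<le> y \<Longrightarrow> pdmp a b \<rho> T R x t \<le> pdmp a b \<rho> T R y t"
  unfolding pdmp_def by (intro aflow_mono pjump_mono)

lemma tendsto_pdmp:
  "(f \<longlongrightarrow> x) F \<Longrightarrow> ((\<lambda>i. pdmp a b \<rho> T R (f i) t) \<longlongrightarrow> pdmp a b \<rho> T R x t) F"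
  unfolding pdmp_def by (intro tendsto_aflow tendsto_pjump tendsto_const)

context
  fixes t :: real
  assumes t: "T 0 \<le> t" "\<exists>n. t < T (Suc n)"
begin

lemma pdmp_nonneg: "0 \<le> x \<Longrightarrow> 0 \<le> pdmp a b \<rho> T R x t"
  unfolding pdmp_def using jump_index_works[OF T t]
  by (intro aflow_nonneg pjump_nonneg b) auto

lemma pdmp_scale:
  assumes "0 \<le> \<alpha>" "\<alpha> \<le> 1"
  shows "\<alpha> * pdmp a b \<rho> T R x t \<le> pdmp a b \<rho> T R (\<alpha> * x) t"
  unfolding pdmp_def using jump_index_works[OF T t]
  by (intro order_trans[OF aflow_scale[OF b _ assms(2)]] aflow_mono pjump_scale assms) auto

lemma pdmp_growth:
  assumes x: "0 \<le> x"
  shows "pdmp a b \<rho> T R x t + 1 \<le>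
    exp ((\<bar>a\<bar> + b) * (t - T 0)) * (x + 1) * (\<Prod>k=1..jump_index T t. 1 + \<rho> * R k)"
proof -
  let ?n = "jump_index T t" and ?j = "pjump a b \<rho> T R x (jump_index T t)"
  have n: "T ?n \<le> t" by (rule jump_index_works[OF T t])
  have "pdmp a b \<rho> T R x t + 1 \<le> exp ((\<bar>a\<bar> + b) * (t - T ?n)) * (?j + 1)"
    unfolding pdmp_def using n by (intro aflow_growth b pjump_nonneg x) auto
  also have "\<dots> \<le> exp ((\<bar>a\<bar> + b) * (t - T ?n)) * (exp ((\<bar>a\<bar> + b) * (T ?n - T 0)) * (x + 1) *
      (\<Prod>k=1..?n. 1 + \<rho> * R k))"
    by (intro mult_left_mono pjump_growth x) auto
  also have "\<dots> = (exp ((\<bar>a\<bar> + b) * (t - T ?n)) * exp ((\<bar>a\<bar> + b) * (T ?n - T 0))) * (x + 1) *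
      (\<Prod>k=1..?n. 1 + \<rho> * R k)"
    by (simp only: mult_ac)
  also have "exp ((\<bar>a\<bar> + b) * (t - T ?n)) * exp ((\<bar>a\<bar> + b) * (T ?n - T 0)) = exp ((\<bar>a\<bar> + b) * (t - T 0))"
    by (simp flip: exp_add add: algebra_simps)
  finally show ?thesis .
qed

end

text \<open>
  Times that approach \<open>t\<close> from the right eventually lie before the next jump, where the path is a
  single continuous flow.
\<close>

lemma pdmp_tendsto_right:
  assumes t: "T 0 \<le> t" "\<exists>n. t < T (Suc n)"
    and f: "(f \<longlongrightarrow> t) F" "\<forall>\<^sub>F i in F. t \<le> f i"
  shows "((\<lambda>i. pdmp a b \<rho> T R x (f i)) \<longlongrightarrow> pdmp a b \<rho> T R x t) F"
proof -
  let ?n = "jump_index T t"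
  note n = jump_index_works[OF T t]
  have "\<forall>\<^sub>F i in F. f i < T (Suc ?n)" using f(1) n(2) by (rule order_tendstoD)
  with f(2) have "\<forall>\<^sub>F i in F. pdmp a b \<rho> T R x (f i) =
      aflow a b (f i - T ?n) (pjump a b \<rho> T R x ?n)"
  proof eventually_elim
    case (elim i)
    have "jump_index T (f i) = ?n" using elim n(1) by (intro jump_index_eqI[OF T]) auto
    then show ?case by (simp add: pdmp_def)
  qed
  moreover have "((\<lambda>i. aflow a b (f i - T ?n) (pjump a b \<rho> T R x ?n)) \<longlongrightarrow> pdmp a b \<rho> T R x t) F"
    unfolding pdmp_def by (intro tendsto_aflow tendsto_intros f)
  ultimately show ?thesis by (simp add: tendsto_cong)
qed

end

section \<open>Restarting a path\<close>

text \<open>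
  Only the first interval is cut by the restart; the flow property glues its two parts, and from
  then on both recursions coincide.
\<close>

lemma pjump_restart:
  assumes T': "T' 0 = 0" "\<And>k. 1 \<le> k \<Longrightarrow> T' k = T (n + k) - s"
    and R': "\<And>k. 1 \<le> k \<Longrightarrow> R' k = R (n + k)"
    and x': "x' = aflow a b (s - T n) (pjump a b \<rho> T R x n)"
    and k: "1 \<le> k"
  shows "pjump a b \<rho> T' R' x' k = pjump a b \<rho> T R x (n + k)"
  using k
proof (induction k rule: dec_induct)
  case base
  have "aflow a b (T (Suc n) - s) x' = aflow a b (T (Suc n) - T n) (pjump a b \<rho> T R x n)"
    unfolding x' by (simp flip: aflow_add)
  then show ?case by (simp add: T' R')
next
  case (step k)
  then show ?case by (simp add: T' R')
qed

text \<open>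
  The path after time \<open>s\<close> is a path of the same kind, driven by the shifted jump times and marks.
  This is the pathwise content of the Markov property.
\<close>

lemma pdmp_restart:
  assumes T: "mono T" and n: "T n \<le> s" "s < T (Suc n)"
    and T': "T' 0 = 0" "\<And>k. 1 \<le> k \<Longrightarrow> T' k = T (n + k) - s"
    and R': "\<And>k. 1 \<le> k \<Longrightarrow> R' k = R (n + k)"
    and t: "0 \<le> t" "\<exists>k. s + t < T (Suc k)"
  shows "pdmp a b \<rho> T' R' (pdmp a b \<rho> T R x s) t = pdmp a b \<rho> T R x (s + t)"
proof -
  have js: "jump_index T s = n" by (rule jump_index_eqI[OF T n])
  let ?x' = "pdmp a b \<rho> T R x s"
  have x': "?x' = aflow a b (s - T n) (pjump a b \<rho> T R x n)" by (simp add: pdmp_def js)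
  let ?N = "jump_index T (s + t)"
  have "T 0 \<le> T n" using T by (auto dest: monoD)
  then have N: "T ?N \<le> s + t" "s + t < T (Suc ?N)"
    using jump_index_works[OF T _ t(2)] n t(1) by auto
  have "T n < T (Suc ?N)" using n t N by simp
  then have nN: "n \<le> ?N" using T by (metis leD linorder_not_less monoD not_less_eq_eq)
  have mT': "mono T'"
    unfolding mono_iff_le_Suc
  proof
    fix k show "T' k \<le> T' (Suc k)"
    proof (cases k)
      case 0 then show ?thesis using T' n by simp
    next
      case (Suc j) then show ?thesis using T' monoD[OF T, of "n + k" "n + Suc k"] by simp
    qed
  qed
  have jt: "jump_index T' t = ?N - n"
  proof (rule jump_index_eqI[OF mT'])
    show "T' (?N - n) \<le> t"
    proof (cases "?N - n")
      case 0 then show ?thesis using T' t by simp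
    next
      case (Suc j)
      then have "1 \<le> ?N - n" by simp
      then have "T' (?N - n) = T ?N - s" using T'(2)[of "?N - n"] nN
        by (metis le_add_diff_inverse)
      then show ?thesis using N by simp
    qed
    show "t < T' (Suc (?N - n))" using T'(2)[of "Suc (?N - n)"] nN N by simp
  qed
  show ?thesis
  proof (cases "?N = n")
    case True
    then have "jump_index T' t = 0" using jt by simp
    then have "pdmp a b \<rho> T' R' ?x' t = aflow a b t ?x'"
      unfolding pdmp_def[of a b \<rho> T' R' ?x' t] by (simp add: T')
    then have "pdmp a b \<rho> T' R' ?x' t = aflow a b ((s - T n) + t) (pjump a b \<rho> T R x n)"
      by (simp only: aflow_add x')
    then show ?thesis using True by (simp add: pdmp_def algebra_simps)
  next
    case False
    then have k: "1 \<le> ?N - n" using nN by simp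
    have "pjump a b \<rho> T' R' ?x' (?N - n) = pjump a b \<rho> T R x ?N"
      using pjump_restart[where T'=T' and T=T and s=s and n=n and R'=R' and R=R, OF T' R' x' k] nN
      by simp
    moreover have "t - T' (?N - n) = s + t - T ?N" using T'(2)[OF k] nN by simp
    ultimately show ?thesis
      unfolding pdmp_def[of a b \<rho> T' R' ?x' t] pdmp_def[of a b \<rho> T R x "s + t"] jt
      by (simp only:)
  qed
qed

lemma measurable_jump_index [measurable (raw)]:
  assumes "\<And>n. (\<lambda>\<omega>. T \<omega> n) \<in> borel_measurable M" "f \<in> borel_measurable M"
  shows "(\<lambda>\<omega>. jump_index (T \<omega>) (f \<omega>)) \<in> measurable M (count_space UNIV)"
  unfolding jump_index_def using assms by measurable

lemma measurable_pjump [measurable (raw)]: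
  assumes "\<And>n. (\<lambda>\<omega>. T \<omega> n) \<in> borel_measurable M"
    "\<And>n. (\<lambda>\<omega>. R \<omega> (Suc n)) \<in> borel_measurable M" "f \<in> borel_measurable M"
  shows "(\<lambda>\<omega>. pjump a b \<rho> (T \<omega>) (R \<omega>) (f \<omega>) n) \<in> borel_measurable M"
proof (induction n)
  case (Suc n)
  note [measurable] = assms Suc
  show ?case unfolding pjump.simps by measurable
qed (simp add: assms)

lemma measurable_pdmp [measurable (raw)]:
  assumes [measurable]: "\<And>n. (\<lambda>\<omega>. T \<omega> n) \<in> borel_measurable M"
    "\<And>n. (\<lambda>\<omega>. R \<omega> (Suc n)) \<in> borel_measurable M" "f \<in> borel_measurable M" "t \<in> borel_measurable M"
  shows "(\<lambda>\<omega>. pdmp a b \<rho> (T \<omega>) (R \<omega>) (f \<omega>) (t \<omega>)) \<in> borel_measurable M"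
  unfolding pdmp_def
  by (rule measurable_compose_countable[where
      f="\<lambda>n \<omega>. aflow a b (t \<omega> - T \<omega> n) (pjump a b \<rho> (T \<omega>) (R \<omega>) (f \<omega>) n)"]) measurable

lemma pjump_cong:
  assumes "\<And>k. k \<le> n \<Longrightarrow> T k = T' k" "\<And>k. 1 \<le> k \<Longrightarrow> k \<le> n \<Longrightarrow> R k = R' k"
  shows "pjump a b \<rho> T R x n = pjump a b \<rho> T' R' x n"
  using assms by (induction n) auto

section \<open>Counting paths and the process\<close>

text \<open>
  Recovers the jump times from a counting path.  Only the values at rational times are used, which
  makes the result measurable for the product sigma-algebra on paths.
\<close>

definition path_jumps :: "(real \<Rightarrow> nat) \<Rightarrow> nat \<Rightarrow> real" where
  "path_jumps f k =
     (if k = 0 then 0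
      else real_of_ereal (INF q\<in>\<rat> \<inter> {0..}. if k \<le> f q then ereal q else \<infinity>))"

context poisson_disorder
begin

lemma a_nonneg: "0 \<le> lam * (2 - m)" "0 \<le> lam * (m - 1)" "0 \<le> 1 + 1 / mu" "0 \<le> 1 + 2 / mu"
  using lam_pos mu_pos m_gt m_less by auto

lemma N_measurable [measurable]: "0 \<le> t \<Longrightarrow> N t \<in> measurable M (count_space UNIV)"
  using poisson by (auto simp: poisson_process_def)

lemma Y_measurable [measurable]: "1 \<le> k \<Longrightarrow> Y k \<in> borel_measurable M"
  using Y_indep by (auto simp: indep_vars_def)

lemma X0_measurable [measurable]: "X0 \<in> borel_measurable M"
proof (rule measurableI)
  fix B assume B: "B \<in> sets (borel :: (real^'d) measure)"
  have "sets (vimage_algebra (space M) X0 borel) \<subseteq> events"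
    using X0_indep by (auto simp: indep_set_def indep_sets_def split: bool.splits)
  then show "X0 -` B \<inter> space M \<in> events" using B by (auto intro: in_vimage_algebra)
qed auto

lemma r_measurable' [measurable]: "r \<in> borel_measurable borel" by (rule r_measurable)

context
  fixes \<omega> assumes \<omega>: "\<omega> \<in> space M"
begin

lemma jump_time_0: "\<sigma> 0 \<omega> = 0"
  and jump_time_strict_mono: "strict_mono (\<lambda>n. \<sigma> n \<omega>)"
  using poisson \<omega> by (auto simp: poisson_process_def)

lemma jump_time_mono: "mono (\<lambda>n. \<sigma> n \<omega>)"
  using jump_time_strict_mono by (rule strict_mono_mono)

lemma jump_time_less: "i < j \<Longrightarrow> \<sigma> i \<omega> < \<sigma> j \<omega>"
  using jump_time_strict_mono by (auto dest: strict_monoD)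

lemma jump_time_nonneg: "0 \<le> \<sigma> n \<omega>"
  using monoD[OF jump_time_mono, of 0 n] jump_time_0 by simp

text \<open>
  The counting process and its jump times determine each other; pathwise reasoning about \<open>N\<close>
  goes through this equivalence.
\<close>

lemma le_N_iff:
  assumes t: "0 \<le> t"
  shows "k \<le> N t \<omega> \<longleftrightarrow> \<sigma> k \<omega> \<le> t"
proof -
  let ?S = "{n. 1 \<le> n \<and> \<sigma> n \<omega> \<le> t}"
  have S: "finite ?S" "N t \<omega> = card ?S"
    using poisson \<omega> t by (auto simp: poisson_process_def)
  show ?thesis
  proof
    assume "\<sigma> k \<omega> \<le> t"
    then have "{1..k} \<subseteq> ?S"
      using jump_time_mono by (auto simp: mono_def) (meson order_trans)
    then have "card {1..k} \<le> card ?S" by (rule card_mono[OF S(1)])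
    then show "k \<le> N t \<omega>" using S(2) by simp
  next
    assume k: "k \<le> N t \<omega>"
    show "\<sigma> k \<omega> \<le> t"
    proof (rule ccontr)
      assume "\<not> \<sigma> k \<omega> \<le> t"
      then have gt: "t < \<sigma> k \<omega>" by simp
      have "?S \<subseteq> {1..<k}"
      proof
        fix n assume n: "n \<in> ?S"
        then have "\<sigma> n \<omega> < \<sigma> k \<omega>" using gt by simp
        then have "n < k" using strict_mono_less[OF jump_time_strict_mono] by simp
        then show "n \<in> {1..<k}" using n by simp
      qed
      then have "card ?S \<le> card {1..<k}" by (intro card_mono) auto
      then have "k = 0" using k S(2) by simp
      then show False using gt t jump_time_0 by simp
    qed
  qed
qed

lemma jump_time_N: "0 \<le> t \<Longrightarrow> \<sigma> (N t \<omega>) \<omega> \<le> t" "0 \<le> t \<Longrightarrow> t < \<sigma> (Suc (N t \<omega>)) \<omega>"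
  using le_N_iff[of t "N t \<omega>"] le_N_iff[of t "Suc (N t \<omega>)"] by auto

lemma N_eqI: "\<sigma> n \<omega> \<le> t \<Longrightarrow> t < \<sigma> (Suc n) \<omega> \<Longrightarrow> N t \<omega> = n"
  using le_N_iff[of t n] le_N_iff[of t "Suc n"] jump_time_nonneg[of n] by auto

lemma N_mono: "0 \<le> s \<Longrightarrow> s \<le> t \<Longrightarrow> N s \<omega> \<le> N t \<omega>"
  using le_N_iff[of t "N s \<omega>"] jump_time_N[of s] by auto

lemma N_0: "N 0 \<omega> = 0"
  using N_eqI[of 0 0] jump_time_0 jump_time_less[of 0 1] by simp

lemma jump_index_N: "0 \<le> t \<Longrightarrow> jump_index (\<lambda>n. \<sigma> n \<omega>) t = N t \<omega>"
  using jump_time_N by (intro jump_index_eqI jump_time_mono) auto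

end

text \<open>
  The state as a function of jump times, marks and starting point.  Separating this function from
  the probability space allows the same path to be driven by the restarted noise.
\<close>

definition evo :: "(nat \<Rightarrow> real) \<Rightarrow> (nat \<Rightarrow> real) \<Rightarrow> real \<times> real \<Rightarrow> real \<Rightarrow> real \<times> real" where
  "evo T R z t =
     (pdmp (lam - 1) (lam * (2 - m)) (1 + 1 / mu) T R (fst z) t,
      pdmp (lam - 2) (lam * (m - 1)) (1 + 2 / mu) T R (snd z) t)"

definition \<Phi> :: "real \<times> real \<Rightarrow> real \<Rightarrow> 'a \<Rightarrow> real \<times> real" where
  "\<Phi> z t \<omega> = (\<Phi>0 (fst z) t \<omega>, \<Phi>1 (snd z) t \<omega>)"

lemma jump0_eq: "jump0 x n \<omega> =
    pjump (lam - 1) (lam * (2 - m)) (1 + 1 / mu) (\<lambda>k. \<sigma> k \<omega>) (\<lambda>k. r (Y k \<omega>)) x n"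
  by (induction n) (simp_all add: flow0_eq_aflow)

lemma jump1_eq: "jump1 x n \<omega> =
    pjump (lam - 2) (lam * (m - 1)) (1 + 2 / mu) (\<lambda>k. \<sigma> k \<omega>) (\<lambda>k. r (Y k \<omega>)) x n"
  by (induction n) (simp_all add: flow1_eq_aflow)

lemma \<Phi>_eq_evo:
  assumes "\<omega> \<in> space M" "0 \<le> t"
  shows "\<Phi> z t \<omega> = evo (\<lambda>k. \<sigma> k \<omega>) (\<lambda>k. r (Y k \<omega>)) z t"
  using jump_index_N[OF assms]
  by (simp add: \<Phi>_def evo_def \<Phi>0_def \<Phi>1_def pdmp_def flow0_eq_aflow flow1_eq_aflow jump0_eq jump1_eq)

lemma \<Phi>_0 [simp]: "\<omega> \<in> space M \<Longrightarrow> \<Phi> z 0 \<omega> = z"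
  by (simp add: \<Phi>_def \<Phi>0_def \<Phi>1_def N_0 jump_time_0 flow0_eq_aflow flow1_eq_aflow)

lemma \<Phi>_nonneg:
  assumes "\<omega> \<in> space M" "0 \<le> t" "0 \<le> fst z" "0 \<le> snd z"
  shows "0 \<le> fst (\<Phi> z t \<omega>)" "0 \<le> snd (\<Phi> z t \<omega>)"
proof -
  have "\<exists>n. t < \<sigma> (Suc n) \<omega>" using jump_time_N[OF assms(1,2)] by blast
  then show "0 \<le> fst (\<Phi> z t \<omega>)" "0 \<le> snd (\<Phi> z t \<omega>)"
    unfolding \<Phi>_eq_evo[OF assms(1,2)] evo_def
    using assms a_nonneg jump_time_mono[OF assms(1)] jump_time_0[OF assms(1)] r_nonneg
    by (auto intro!: pdmp_nonneg)
qed

lemma \<Phi>_tendsto_right: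
  assumes \<omega>: "\<omega> \<in> space M" and t: "0 \<le> t" and f: "(f \<longlongrightarrow> t) G" "\<forall>\<^sub>F i in G. t \<le> f i"
  shows "((\<lambda>i. \<Phi> z (f i) \<omega>) \<longlongrightarrow> \<Phi> z t \<omega>) G"
proof -
  have ex: "\<exists>n. t < \<sigma> (Suc n) \<omega>" using jump_time_N[OF \<omega> t] by blast
  have "((\<lambda>i. evo (\<lambda>k. \<sigma> k \<omega>) (\<lambda>k. r (Y k \<omega>)) z (f i)) \<longlongrightarrow>
      evo (\<lambda>k. \<sigma> k \<omega>) (\<lambda>k. r (Y k \<omega>)) z t) G"
    unfolding evo_def using ex a_nonneg jump_time_mono[OF \<omega>] jump_time_0[OF \<omega>] r_nonneg t
    by (intro tendsto_Pair pdmp_tendsto_right f) auto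
  moreover have "\<forall>\<^sub>F i in G. \<Phi> z (f i) \<omega> = evo (\<lambda>k. \<sigma> k \<omega>) (\<lambda>k. r (Y k \<omega>)) z (f i)"
    using f(2) by eventually_elim (use t in \<open>auto intro!: \<Phi>_eq_evo \<omega>\<close>)
  ultimately show ?thesis by (simp add: tendsto_cong \<Phi>_eq_evo[OF \<omega> t])
qed

definition future_N :: "real \<Rightarrow> 'a \<Rightarrow> real \<Rightarrow> nat" where
  "future_N s \<omega> = (\<lambda>v\<in>{0..}. N (s + v) \<omega> - N s \<omega>)"

definition future_Y :: "nat \<Rightarrow> 'a \<Rightarrow> nat \<Rightarrow> real ^ 'd" where
  "future_Y n \<omega> = (\<lambda>k\<in>{1..}. Y (n + k) \<omega>)"

lemma path_jumps_future_N:
  assumes \<omega>: "\<omega> \<in> space M" and s: "0 \<le> s" and k: "1 \<le> k"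
  shows "path_jumps (future_N s \<omega>) k = \<sigma> (N s \<omega> + k) \<omega> - s"
proof -
  define c where "c = \<sigma> (N s \<omega> + k) \<omega> - s"
  have c0: "0 \<le> c"
    unfolding c_def using jump_time_N(2)[OF \<omega> s] monoD[OF jump_time_mono[OF \<omega>], of "Suc (N s \<omega>)" "N s \<omega> + k"] k
    by simp
  have iff: "k \<le> future_N s \<omega> q \<longleftrightarrow> c \<le> q" if "0 \<le> q" for q
  proof -
    have "k \<le> future_N s \<omega> q \<longleftrightarrow> N s \<omega> + k \<le> N (s + q) \<omega>"
      using that N_mono[OF \<omega> s, of "s + q"] k by (auto simp: future_N_def)
    also have "\<dots> \<longleftrightarrow> c \<le> q" using le_N_iff[OF \<omega>, of "s + q" "N s \<omega> + k"] s that by (auto simp: c_def)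
    finally show ?thesis .
  qed
  have "(INF q\<in>\<rat> \<inter> {0..}. if k \<le> future_N s \<omega> q then ereal q else \<infinity>) = ereal c"
  proof (rule antisym)
    show "ereal c \<le> (INF q\<in>\<rat> \<inter> {0..}. if k \<le> future_N s \<omega> q then ereal q else \<infinity>)"
      by (rule INF_greatest) (auto simp: iff)
    show "(INF q\<in>\<rat> \<inter> {0..}. if k \<le> future_N s \<omega> q then ereal q else \<infinity>) \<le> ereal c"
    proof (rule ereal_le_epsilon2)
      fix e :: real assume e: "0 < e"
      obtain q where q: "q \<in> \<rat>" "c < q" "q < c + e" using Rats_dense_in_real[of c "c + e"] e by auto
      then have "(INF q\<in>\<rat> \<inter> {0..}. if k \<le> future_N s \<omega> q then ereal q else \<infinity>) \<le> ereal q"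
        using c0 by (intro INF_lower2[of q]) (auto simp: iff)
      also have "\<dots> \<le> ereal c + ereal e" using q by simp
      finally show "(INF q\<in>\<rat> \<inter> {0..}. if k \<le> future_N s \<omega> q then ereal q else \<infinity>) \<le> ereal c + ereal e" .
    qed
  qed
  then show ?thesis using k by (simp add: path_jumps_def c_def)
qed

text \<open>
  After time \<open>s\<close> the process depends on the past only through its value at \<open>s\<close>.
\<close>

lemma \<Phi>_restart:
  assumes \<omega>: "\<omega> \<in> space M" and s: "0 \<le> s" and t: "0 \<le> t"
  shows "\<Phi> z (s + t) \<omega> =
    evo (path_jumps (future_N s \<omega>)) (\<lambda>k. r (future_Y (N s \<omega>) \<omega> k)) (\<Phi> z s \<omega>) t"
proof -
  have ex: "\<exists>k. s + t < \<sigma> (Suc k) \<omega>" using jump_time_N[OF \<omega>, of "s + t"] s t by auto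
  note * = pdmp_restart[where T="\<lambda>k. \<sigma> k \<omega>" and n="N s \<omega>" and R="\<lambda>k. r (Y k \<omega>)"
      and R'="\<lambda>k. r (future_Y (N s \<omega>) \<omega> k)" and T'="path_jumps (future_N s \<omega>)",
      OF jump_time_mono[OF \<omega>] jump_time_N(1)[OF \<omega> s] jump_time_N(2)[OF \<omega> s] _ _ _ t ex]
  show ?thesis
    unfolding \<Phi>_eq_evo[OF \<omega> s] \<Phi>_eq_evo[OF \<omega> add_nonneg_nonneg[OF s t]] evo_def fst_conv snd_conv
    by (intro arg_cong2[where f=Pair] *[symmetric])
      (simp_all add: path_jumps_future_N[OF \<omega> s], simp_all add: path_jumps_def future_Y_def)
qed

lemma evo_start:
  assumes \<omega>: "\<omega> \<in> space M" and t: "0 \<le> t"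
  shows "\<Phi> z t \<omega> = evo (path_jumps (future_N 0 \<omega>)) (\<lambda>k. r (future_Y 0 \<omega> k)) z t"
  using \<Phi>_restart[OF \<omega> order_refl t, of z] \<omega> by (simp add: N_0)

section \<open>The filtration of the observed process\<close>

lemma space_F [simp]: "space (F t) = space M"
  unfolding F_def by (rule space_measure_of) auto

lemma sets_F: "sets (F t) =
    sigma_sets (space M) {X s -` B \<inter> space M | s B. 0 \<le> s \<and> ennreal s \<le> t \<and> B \<in> sets borel}"
  unfolding F_def by (rule sets_measure_of) auto

lemma sets_F_mono: "s \<le> t \<Longrightarrow> sets (F s) \<subseteq> sets (F t)"
  unfolding sets_F by (rule sigma_sets_mono') (auto intro: order_trans)

lemma X_measurable_F: "0 \<le> s \<Longrightarrow> ennreal s \<le> t \<Longrightarrow> X s \<in> borel_measurable (F t)"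
  by (rule measurableI) (auto simp: sets_F)

lemma X_measurable [measurable]:
  assumes "0 \<le> s" shows "X s \<in> borel_measurable M"
proof -
  have "(\<lambda>\<omega>. (\<lambda>n \<omega>. X0 \<omega> + (\<Sum>k=1..n. Y k \<omega>)) (N s \<omega>) \<omega>) \<in> borel_measurable M"
    by (rule measurable_compose_countable[where f="\<lambda>n \<omega>. X0 \<omega> + (\<Sum>k=1..n. Y k \<omega>)"])
      (auto intro!: borel_measurable_add borel_measurable_sum X0_measurable Y_measurable N_measurable assms)
  then show ?thesis by (simp add: X_def[abs_def])
qed

lemma sets_F_subset: "sets (F t) \<subseteq> events"
proof -
  have "X s -` B \<inter> space M \<in> events" if "0 \<le> s" "B \<in> sets borel" for s B
    using measurable_sets[OF X_measurable[OF that(1)] that(2)] .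
  then show ?thesis unfolding sets_F by (intro sets.sigma_sets_subset) blast
qed

lemma measurable_F_imp_M: "f \<in> measurable (F t) K \<Longrightarrow> f \<in> measurable M K"
  using sets_F_subset[of t] by (auto simp: measurable_def)

definition partial_sum :: "nat \<Rightarrow> 'a \<Rightarrow> real ^ 'd" where
  "partial_sum n \<omega> = X0 \<omega> + (\<Sum>k=1..n. Y k \<omega>)"

lemma X_eq_partial_sum: "X t \<omega> = partial_sum (N t \<omega>) \<omega>"
  by (simp add: X_def partial_sum_def)

text \<open>
  The marks are strictly positive, so every jump of \<open>N\<close> strictly increases each coordinate of \<open>X\<close>:
  the observed process reveals all jumps.
\<close>

lemma X_eq_iff:
  assumes \<omega>: "\<omega> \<in> space M" and q: "0 \<le> q" "q \<le> u"
  shows "X q \<omega> = X u \<omega> \<longleftrightarrow> N q \<omega> = N u \<omega>"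
proof
  assume eq: "X q \<omega> = X u \<omega>"
  show "N q \<omega> = N u \<omega>"
  proof (rule ccontr)
    assume "N q \<omega> \<noteq> N u \<omega>"
    with N_mono[OF \<omega> q] have less: "N q \<omega> < N u \<omega>" by simp
    define i :: 'd where "i = undefined"
    have "(\<Sum>k=1..N u \<omega>. Y k \<omega> $ i) = (\<Sum>k=1..N q \<omega>. Y k \<omega> $ i)"
      using arg_cong[OF eq, of "\<lambda>v. v $ i"] by (simp add: X_def sum_component)
    moreover have "(\<Sum>k=1..N q \<omega>. Y k \<omega> $ i) < (\<Sum>k=1..N u \<omega>. Y k \<omega> $ i)"
    proof (rule sum_strict_mono2[where b="N u \<omega>"])
      show "0 < Y (N u \<omega>) \<omega> $ i" using less by (intro Y_pos \<omega>) simp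
      fix k assume "k \<in> {1..N u \<omega>}"
      then show "0 \<le> Y k \<omega> $ i" using Y_pos[OF _ \<omega>, of k i] by simp
    qed (use less in auto)
    ultimately show False by simp
  qed
qed (simp add: X_eq_partial_sum)

lemma le_N_event_F:
  assumes u: "0 \<le> u" and s: "ennreal u \<le> s"
  shows "{\<omega>\<in>space M. k \<le> N u \<omega>} \<in> sets (F s)"
proof -
  have "{\<omega>\<in>space M. k \<le> N u \<omega>} \<in> sets (F (ennreal u))"
    using u
  proof (induction k arbitrary: u)
    case 0 then show ?case using sets.top[of "F (ennreal u)"] by simp
  next
    case (Suc k)
    \<comment> \<open>A further jump has occurred by time \<open>u\<close> iff \<open>X\<close> moves after some rational time that sees at least \<open>k\<close> jumps.\<close>
    have eq: "{\<omega>\<in>space M. Suc k \<le> N u \<omega>} =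
      (\<Union>q\<in>\<rat>\<inter>{0..<u}. {\<omega>\<in>space M. k \<le> N q \<omega>} \<inter> {\<omega>\<in>space M. X q \<omega> \<noteq> X u \<omega>})"
      (is "?L = ?R")
    proof (intro equalityI subsetI)
      fix \<omega> assume "\<omega> \<in> ?L"
      then have \<omega>: "\<omega> \<in> space M" and k: "\<sigma> (Suc k) \<omega> \<le> u" "Suc k \<le> N u \<omega>" using le_N_iff Suc.prems by auto
      obtain q where q: "q \<in> \<rat>" "\<sigma> k \<omega> < q" "q < \<sigma> (Suc k) \<omega>"
        using Rats_dense_in_real jump_time_less[OF \<omega>, of k "Suc k"] by blast
      then have N: "N q \<omega> = k" by (intro N_eqI[OF \<omega>]) auto
      have "0 \<le> q" using q jump_time_nonneg[OF \<omega>, of k] by simp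
      then show "\<omega> \<in> ?R" using q k N \<omega> X_eq_iff[OF \<omega>, of q u] by auto
    next
      fix \<omega> assume "\<omega> \<in> ?R"
      then obtain q where q: "0 \<le> q" "q < u" "k \<le> N q \<omega>" "X q \<omega> \<noteq> X u \<omega>" and \<omega>: "\<omega> \<in> space M" by auto
      then have "N q \<omega> \<noteq> N u \<omega>" using X_eq_iff[OF \<omega>, of q u] by auto
      with N_mono[OF \<omega>, of q u] q show "\<omega> \<in> ?L" using \<omega> by auto
    qed
    show ?case unfolding eq
    proof (intro sets.countable_UN'' sets.Int)
      show "countable (\<rat> \<inter> {0..<u})" by (simp add: countable_rat countable_Int1)
      show "{\<omega>\<in>space M. k \<le> N q \<omega>} \<in> sets (F (ennreal u))" if "q \<in> \<rat> \<inter> {0..<u}" for q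
        using Suc.IH[of q] that sets_F_mono[of "ennreal q" "ennreal u"] by (auto simp: ennreal_leI)
      show "{\<omega>\<in>space M. X q \<omega> \<noteq> X u \<omega>} \<in> sets (F (ennreal u))" if "q \<in> \<rat> \<inter> {0..<u}" for q
      proof -
        have [measurable]: "X q \<in> borel_measurable (F (ennreal u))" "X u \<in> borel_measurable (F (ennreal u))"
          using that Suc.prems by (auto intro!: X_measurable_F ennreal_leI)
        have "{\<omega>\<in>space (F (ennreal u)). X q \<omega> \<noteq> X u \<omega>} \<in> sets (F (ennreal u))" by measurable
        then show ?thesis by simp
      qed
    qed
  qed
  then show ?thesis using sets_F_mono[OF s] by auto
qed

lemma N_measurable_F:
  assumes u: "0 \<le> u" and s: "ennreal u \<le> s"
  shows "N u \<in> measurable (F s) (count_space UNIV)"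
  unfolding measurable_count_space_eq2_countable
proof (intro conjI ballI)
  fix n
  have "N u -` {n} \<inter> space (F s) = {\<omega>\<in>space M. n \<le> N u \<omega>} - {\<omega>\<in>space M. Suc n \<le> N u \<omega>}" by auto
  then show "N u -` {n} \<inter> space (F s) \<in> sets (F s)" using le_N_event_F[OF u s] by auto
qed auto

section \<open>Adaptedness and hitting times of closed sets\<close>

text \<open>
  The post-jump values computed from the information available at time \<open>s\<close> only: later jump times are
  replaced by \<open>s\<close> and later marks by the arbitrary value 0.  For \<open>n \<le> N s \<omega>\<close> this is the true
  post-jump value, and it is measurable at time \<open>s\<close> for every \<open>n\<close>.
\<close>

definition stopped_pjump :: "real \<Rightarrow> real \<Rightarrow> real \<Rightarrow> real \<Rightarrow> real \<Rightarrow> nat \<Rightarrow> 'a \<Rightarrow> real" where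
  "stopped_pjump s a b \<rho> x n \<omega> =
     pjump a b \<rho> (\<lambda>k. min (\<sigma> k \<omega>) s) (\<lambda>k. if k \<le> N s \<omega> then r (Y k \<omega>) else 0) x n"

definition stopped_state :: "real \<Rightarrow> real \<times> real \<Rightarrow> nat \<Rightarrow> 'a \<Rightarrow> real \<times> real" where
  "stopped_state s z n \<omega> =
     (stopped_pjump s (lam - 1) (lam * (2 - m)) (1 + 1 / mu) (fst z) n \<omega>,
      stopped_pjump s (lam - 2) (lam * (m - 1)) (1 + 2 / mu) (snd z) n \<omega>)"

context
  fixes s :: real assumes s: "0 \<le> s"
begin

lemma jump_time_measurable_F: "(\<lambda>\<omega>. min (\<sigma> k \<omega>) s) \<in> borel_measurable (F (ennreal s))"
proof (rule borel_measurableI_le)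
  fix u
  show "{\<omega> \<in> space (F (ennreal s)). min (\<sigma> k \<omega>) s \<le> u} \<in> sets (F (ennreal s))"
  proof (cases "s \<le> u")
    case True
    then have "{\<omega> \<in> space (F (ennreal s)). min (\<sigma> k \<omega>) s \<le> u} = space (F (ennreal s))" by auto
    then show ?thesis by (metis sets.top)
  next
    case False
    show ?thesis
    proof (cases "0 \<le> u")
      case True
      then have "{\<omega> \<in> space (F (ennreal s)). min (\<sigma> k \<omega>) s \<le> u} = {\<omega>\<in>space M. k \<le> N u \<omega>}"
        using False le_N_iff by auto
      then show ?thesis using le_N_event_F[OF True, of "ennreal s"] False by (auto simp: ennreal_leI)
    next
      case F: False
      then have "{\<omega> \<in> space (F (ennreal s)). min (\<sigma> k \<omega>) s \<le> u} = {}"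
        using False jump_time_nonneg by (auto simp: not_le intro: less_le_trans)
      then show ?thesis by (metis sets.empty_sets)
    qed
  qed
qed

text \<open>
  The partial sums are the values of \<open>X\<close> between consecutive jumps and can be read off at
  rational times.
\<close>

lemma partial_sum_measurable_F:
  "(\<lambda>\<omega>. if k \<le> N s \<omega> then partial_sum k \<omega> else 0) \<in> borel_measurable (F (ennreal s))"
proof (rule measurableI)
  fix B assume B: "B \<in> sets (borel :: (real^'d) measure)"
  \<comment> \<open>The time \<open>s\<close> itself is included because the \<open>k\<close>-th jump may happen exactly at \<open>s\<close>.\<close>
  let ?Q = "\<rat> \<inter> {0..s} \<union> {s}"
  have N: "{\<omega>\<in>space M. N s \<omega> < k} \<in> sets (F (ennreal s))"
    using sets.compl_sets[OF le_N_event_F[OF s order_refl, of k]]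
    by (rule back_subst[where P="\<lambda>A. A \<in> sets (F (ennreal s))"]) auto
  have "{\<omega>\<in>space M. k \<le> N s \<omega> \<and> partial_sum k \<omega> \<in> B} =
      (\<Union>q\<in>?Q. {\<omega>\<in>space M. N q \<omega> = k \<and> X q \<omega> \<in> B})" (is "?L = ?R")
  proof (intro equalityI subsetI)
    fix \<omega> assume "\<omega> \<in> ?L"
    then have \<omega>: "\<omega> \<in> space M" and k: "\<sigma> k \<omega> \<le> s" and B: "partial_sum k \<omega> \<in> B"
      using le_N_iff s by auto
    have "\<exists>q\<in>?Q. \<sigma> k \<omega> \<le> q \<and> q < \<sigma> (Suc k) \<omega>"
    proof (cases "\<sigma> k \<omega> = s")
      case True then show ?thesis using jump_time_less[OF \<omega>, of k "Suc k"] by auto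
    next
      case False
      then have "\<sigma> k \<omega> < min s (\<sigma> (Suc k) \<omega>)" using k jump_time_less[OF \<omega>, of k "Suc k"] by simp
      from Rats_dense_in_real[OF this] show ?thesis
        using jump_time_nonneg[OF \<omega>, of k] by force
    qed
    then obtain q where q: "q \<in> ?Q" "N q \<omega> = k" using N_eqI[OF \<omega>] by blast
    then show "\<omega> \<in> ?R" using \<omega> B by (auto simp: X_eq_partial_sum)
  next
    fix \<omega> assume "\<omega> \<in> ?R"
    then obtain q where "\<omega> \<in> space M" "0 \<le> q" "q \<le> s" "N q \<omega> = k" "X q \<omega> \<in> B" using s by auto
    then show "\<omega> \<in> ?L" using N_mono[of \<omega> q s] by (auto simp: X_eq_partial_sum)
  qed
  also have "\<dots> \<in> sets (F (ennreal s))"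
  proof (rule sets.countable_UN'')
    show "countable ?Q" by (simp add: countable_rat countable_Int1)
    fix q assume "q \<in> ?Q"
    then have q: "0 \<le> q" "ennreal q \<le> ennreal s" using s by (auto intro: ennreal_leI)
    note [measurable] = N_measurable_F[OF q] X_measurable_F[OF q] B
    have "{\<omega>\<in>space (F (ennreal s)). N q \<omega> = k \<and> X q \<omega> \<in> B} \<in> sets (F (ennreal s))" by measurable
    then show "{\<omega>\<in>space M. N q \<omega> = k \<and> X q \<omega> \<in> B} \<in> sets (F (ennreal s))" by simp
  qed
  finally have 1: "{\<omega>\<in>space M. k \<le> N s \<omega> \<and> partial_sum k \<omega> \<in> B} \<in> sets (F (ennreal s))" .
  have "(\<lambda>\<omega>. if k \<le> N s \<omega> then partial_sum k \<omega> else 0) -` B \<inter> space (F (ennreal s)) =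
      {\<omega>\<in>space M. k \<le> N s \<omega> \<and> partial_sum k \<omega> \<in> B} \<union> (if 0 \<in> B then {\<omega>\<in>space M. N s \<omega> < k} else {})"
    by (auto split: if_splits)
  then show "(\<lambda>\<omega>. if k \<le> N s \<omega> then partial_sum k \<omega> else 0) -` B \<inter> space (F (ennreal s)) \<in> sets (F (ennreal s))"
    using 1 N by auto
qed auto

lemma mark_measurable_F:
  assumes k: "1 \<le> k"
  shows "(\<lambda>\<omega>. if k \<le> N s \<omega> then r (Y k \<omega>) else 0) \<in> borel_measurable (F (ennreal s))"
proof -
  define P where "P k \<omega> = (if k \<le> N s \<omega> then partial_sum k \<omega> else 0)" for k \<omega>
  have [measurable]: "P k \<in> borel_measurable (F (ennreal s))" for k
    unfolding P_def by (rule partial_sum_measurable_F)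
  note [measurable] = N_measurable_F[OF s order_refl]
  \<comment> \<open>A mark is the increment of \<open>X\<close> at its jump.\<close>
  have Y: "Y k \<omega> = partial_sum k \<omega> - partial_sum (k - 1) \<omega>" for \<omega>
    using k by (cases k) (auto simp: partial_sum_def)
  have "(\<lambda>\<omega>. if k \<le> N s \<omega> then r (P k \<omega> - P (k - 1) \<omega>) else 0) \<in> borel_measurable (F (ennreal s))"
    by measurable
  moreover have "(if k \<le> N s \<omega> then r (P k \<omega> - P (k - 1) \<omega>) else 0) =
      (if k \<le> N s \<omega> then r (Y k \<omega>) else 0)" for \<omega>
    unfolding Y P_def using order_trans[OF diff_le_self, of k "N s \<omega>" 1] by auto
  ultimately show ?thesis by (simp only:)
qed

lemma stopped_pjump_measurable_F: "stopped_pjump s a b \<rho> x n \<in> borel_measurable (F (ennreal s))"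
  unfolding stopped_pjump_def[abs_def]
proof (rule measurable_pjump)
  show "(\<lambda>\<omega>. min (\<sigma> n \<omega>) s) \<in> borel_measurable (F (ennreal s))" for n
    by (rule jump_time_measurable_F)
  show "(\<lambda>\<omega>. if Suc n \<le> N s \<omega> then r (Y (Suc n) \<omega>) else 0) \<in> borel_measurable (F (ennreal s))" for n
    by (rule mark_measurable_F) simp
qed (rule borel_measurable_const)

lemma stopped_pjump_eq:
  assumes \<omega>: "\<omega> \<in> space M" and n: "n \<le> N s \<omega>"
  shows "stopped_pjump s a b \<rho> x n \<omega> = pjump a b \<rho> (\<lambda>k. \<sigma> k \<omega>) (\<lambda>k. r (Y k \<omega>)) x n"
  unfolding stopped_pjump_def
proof (rule pjump_cong)
  show "min (\<sigma> k \<omega>) s = \<sigma> k \<omega>" if "k \<le> n" for k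
    using le_N_iff[OF \<omega> s, of k] that n by simp
qed (use n in simp)

end

definition flow :: "real \<Rightarrow> real \<times> real \<Rightarrow> real \<times> real" where
  "flow t z = (aflow (lam - 1) (lam * (2 - m)) t (fst z), aflow (lam - 2) (lam * (m - 1)) t (snd z))"

lemma tendsto_flow:
  assumes "(f \<longlongrightarrow> t) G" "(h \<longlongrightarrow> z) G"
  shows "((\<lambda>i. flow (f i) (h i)) \<longlongrightarrow> flow t z) G"
  unfolding flow_def by (intro tendsto_intros tendsto_aflow assms)

lemma measurable_flow [measurable (raw)]:
  assumes [measurable]: "f \<in> borel_measurable K" "h \<in> borel_measurable K"
  shows "(\<lambda>\<omega>. flow (f \<omega>) (h \<omega>)) \<in> borel_measurable K"
proof -
  have [measurable]: "h \<in> measurable K (borel \<Otimes>\<^sub>M borel)" using assms(2) by (simp only: borel_prod)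
  show ?thesis unfolding flow_def by (intro borel_measurable_Pair) measurable
qed

lemma stopped_state_measurable_F:
  "0 \<le> s \<Longrightarrow> stopped_state s z n \<in> borel_measurable (F (ennreal s))"
  unfolding stopped_state_def[abs_def]
  by (intro borel_measurable_Pair stopped_pjump_measurable_F)

lemma \<Phi>_eq_flow:
  assumes \<omega>: "\<omega> \<in> space M" and s: "0 \<le> s" "s \<le> t" and n: "N s \<omega> = n"
  shows "\<Phi> z s \<omega> = flow (s - \<sigma> n \<omega>) (stopped_state t z n \<omega>)"
proof -
  have t: "0 \<le> t" using s by simp
  have n': "n \<le> N t \<omega>" using N_mono[OF \<omega> s] n by simp
  show ?thesis
    unfolding \<Phi>_def \<Phi>0_def \<Phi>1_def n flow_def stopped_state_def stopped_pjump_eq[OF t \<omega> n']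
      flow0_eq_aflow flow1_eq_aflow jump0_eq jump1_eq fst_conv snd_conv by (rule refl)
qed

lemma \<Phi>_measurable_F:
  assumes s: "0 \<le> s"
  shows "\<Phi> z s \<in> borel_measurable (F (ennreal s))"
proof -
  have "(\<lambda>\<omega>. flow (s - min (\<sigma> (N s \<omega>) \<omega>) s) (stopped_state s z (N s \<omega>) \<omega>)) \<in> borel_measurable (F (ennreal s))"
    by (rule measurable_compose_countable[where f="\<lambda>n \<omega>. flow (s - min (\<sigma> n \<omega>) s) (stopped_state s z n \<omega>)"])
      (rule measurable_flow borel_measurable_diff borel_measurable_const jump_time_measurable_F[OF s]
        stopped_state_measurable_F[OF s] N_measurable_F[OF s order_refl])+
  then show ?thesis
  proof (rule measurable_cong[THEN iffD1, rotated])
    fix \<omega> assume "\<omega> \<in> space (F (ennreal s))"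
    then have \<omega>: "\<omega> \<in> space M" by simp
    show "flow (s - min (\<sigma> (N s \<omega>) \<omega>) s) (stopped_state s z (N s \<omega>) \<omega>) = \<Phi> z s \<omega>"
      using \<Phi>_eq_flow[OF \<omega> s order_refl refl] jump_time_N[OF \<omega> s] by simp
  qed
qed

definition hit :: "(real \<times> real) set \<Rightarrow> real \<times> real \<Rightarrow> 'a \<Rightarrow> ennreal" where
  "hit C z \<omega> = Inf {ennreal t | t. 0 \<le> t \<and> \<Phi> z t \<omega> \<in> C}"

text \<open>
  Times in the set that decrease to the infimum give, by right continuity and closedness, a visit at
  the infimum itself.
\<close>

lemma hit_attained:
  assumes \<omega>: "\<omega> \<in> space M" and C: "closed C" and ex: "0 \<le> t" "\<Phi> z t \<omega> \<in> C"
  shows "\<exists>u. 0 \<le> u \<and> u \<le> t \<and> \<Phi> z u \<omega> \<in> C \<and> hit C z \<omega> = ennreal u"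
proof -
  let ?I = "{t. 0 \<le> t \<and> \<Phi> z t \<omega> \<in> C}"
  have bdd: "bdd_below ?I" by (rule bdd_belowI[of _ 0]) auto
  have ne: "?I \<noteq> {}" using ex by auto
  define i where "i = Inf ?I"
  have i0: "0 \<le> i" unfolding i_def using ne by (intro cInf_greatest) auto
  have "\<exists>u. u \<in> ?I \<and> u < i + 1 / real (Suc n)" for n
    using cInf_lessD[OF ne, of "i + 1 / real (Suc n)"] unfolding i_def by (simp add: Bex_def)
  then obtain f where f: "\<And>n. f n \<in> ?I" "\<And>n. f n < i + 1 / real (Suc n)"
    using choice[of "\<lambda>n u. u \<in> ?I \<and> u < i + 1 / real (Suc n)"] by blast
  have fi: "i \<le> f n" for n unfolding i_def using f bdd by (intro cInf_lower) auto
  have lim: "f \<longlonglongrightarrow> i"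
  proof (rule tendsto_sandwich[OF always_eventually always_eventually tendsto_const])
    show "\<forall>n. i \<le> f n" "\<forall>n. f n \<le> i + 1 / real (Suc n)" using fi f(2) by (auto intro: less_imp_le)
    show "(\<lambda>n. i + 1 / real (Suc n)) \<longlonglongrightarrow> i"
      using tendsto_add[OF tendsto_const LIMSEQ_inverse_real_of_nat, of i] by (simp add: inverse_eq_divide)
  qed
  have "(\<lambda>n. \<Phi> z (f n) \<omega>) \<longlonglongrightarrow> \<Phi> z i \<omega>" by (rule \<Phi>_tendsto_right[OF \<omega> i0 lim]) (auto simp: fi)
  moreover have "\<Phi> z (f n) \<omega> \<in> C" for n using f(1)[of n] by simp
  ultimately have iC: "\<Phi> z i \<omega> \<in> C" using closed_sequentially[OF C, of "\<lambda>n. \<Phi> z (f n) \<omega>"] by simp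
  have "hit C z \<omega> = ennreal i"
    unfolding hit_def
  proof (rule antisym)
    show "Inf {ennreal t |t. 0 \<le> t \<and> \<Phi> z t \<omega> \<in> C} \<le> ennreal i" 
      using i0 iC by (intro Inf_lower) blast
    show "ennreal i \<le> Inf {ennreal t |t. 0 \<le> t \<and> \<Phi> z t \<omega> \<in> C}"
    proof (rule Inf_greatest)
      fix x assume "x \<in> {ennreal t |t. 0 \<le> t \<and> \<Phi> z t \<omega> \<in> C}"
      then obtain t where t: "x = ennreal t" "t \<in> ?I" by blast
      show "ennreal i \<le> x" unfolding t(1) i_def by (intro ennreal_leI cInf_lower t(2) bdd)
    qed
  qed
  moreover have "i \<le> t" unfolding i_def using ex bdd by (intro cInf_lower) auto
  ultimately show ?thesis using i0 iC by blast
qed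

lemma hit_le_iff:
  assumes \<omega>: "\<omega> \<in> space M" and C: "closed C" and t: "0 \<le> t"
  shows "hit C z \<omega> \<le> ennreal t \<longleftrightarrow> (\<exists>u. 0 \<le> u \<and> u \<le> t \<and> \<Phi> z u \<omega> \<in> C)"
proof
  assume le: "hit C z \<omega> \<le> ennreal t"
  have "\<exists>u\<ge>0. \<Phi> z u \<omega> \<in> C"
  proof (rule ccontr)
    assume "\<not> (\<exists>u\<ge>0. \<Phi> z u \<omega> \<in> C)"
    then have "{ennreal t |t. 0 \<le> t \<and> \<Phi> z t \<omega> \<in> C} = {}" by auto
    then have "hit C z \<omega> = top" unfolding hit_def by (simp only: Inf_empty)
    then show False using le by (simp add: top_unique)
  qed
  then obtain u where "0 \<le> u" "\<Phi> z u \<omega> \<in> C" by blast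
  from hit_attained[OF \<omega> C this] obtain v where "0 \<le> v" "\<Phi> z v \<omega> \<in> C" "hit C z \<omega> = ennreal v" by blast
  then show "\<exists>u. 0 \<le> u \<and> u \<le> t \<and> \<Phi> z u \<omega> \<in> C" using le t by (auto simp: ennreal_le_iff)
next
  assume "\<exists>u. 0 \<le> u \<and> u \<le> t \<and> \<Phi> z u \<omega> \<in> C"
  then obtain u where u: "0 \<le> u" "u \<le> t" "\<Phi> z u \<omega> \<in> C" by blast
  then have "hit C z \<omega> \<le> ennreal u" unfolding hit_def by (intro Inf_lower) blast
  also have "\<dots> \<le> ennreal t" using u by (simp add: ennreal_leI)
  finally show "hit C z \<omega> \<le> ennreal t" .
qed

text \<open>
  The pairs of a duration and a starting point for which the flow meets \<open>C\<close> within that duration.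
  Closedness is compactness of bounded intervals of times; it provides the Borel set through which
  \<open>stopping_time_hit\<close> expresses a visit.
\<close>

lemma closed_flow_hits:
  assumes C: "closed C"
  shows "closed {p :: real \<times> real \<times> real. \<exists>v. 0 \<le> v \<and> v \<le> fst p \<and> flow v (snd p) \<in> C}"
  unfolding closed_sequential_limits
proof (intro allI impI, elim conjE)
  fix p :: "nat \<Rightarrow> real \<times> real \<times> real" and l
  assume ex: "\<forall>n. p n \<in> {p. \<exists>v. 0 \<le> v \<and> v \<le> fst p \<and> flow v (snd p) \<in> C}" and l: "p \<longlonglongrightarrow> l"
  then obtain v where v: "\<And>n. 0 \<le> v n" "\<And>n. v n \<le> fst (p n)" "\<And>n. flow (v n) (snd (p n)) \<in> C"
    unfolding mem_Collect_eq using choice[of "\<lambda>n v. 0 \<le> v \<and> v \<le> fst (p n) \<and> flow v (snd (p n)) \<in> C"] by blast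
  have "Bseq (\<lambda>n. fst (p n))" using tendsto_fst[OF l] by (intro convergent_imp_Bseq convergentI)
  then obtain K where K: "\<And>n. \<bar>fst (p n)\<bar> \<le> K" by (auto simp: Bseq_def)
  have "\<forall>n. v n \<in> {0..K}" 
  proof
    fix n show "v n \<in> {0..K}" using v(1)[of n] v(2)[of n] K[of n] by simp
  qed
  then obtain l' f where f: "l' \<in> {0..K}" "strict_mono f" "(v \<circ> f) \<longlonglongrightarrow> l'"
    using compact_Icc[of 0 K] unfolding compact_def by meson
  have lf: "(\<lambda>n. p (f n)) \<longlonglongrightarrow> l" using LIMSEQ_subseq_LIMSEQ[OF l f(2)] by (simp add: o_def)
  have vf: "(\<lambda>n. v (f n)) \<longlonglongrightarrow> l'" using f(3) by (simp add: o_def)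
  have "(\<lambda>n. flow (v (f n)) (snd (p (f n)))) \<longlonglongrightarrow> flow l' (snd l)"
    by (rule tendsto_flow[OF vf tendsto_snd[OF lf]])
  then have "flow l' (snd l) \<in> C"
    using closed_sequentially[OF C, of "\<lambda>n. flow (v (f n)) (snd (p (f n)))"] v(3) by simp
  moreover have "l' \<le> fst l" by (rule LIMSEQ_le[OF vf tendsto_fst[OF lf]]) (use v(2) in simp)
  ultimately show "l \<in> {p. \<exists>v. 0 \<le> v \<and> v \<le> fst p \<and> flow v (snd p) \<in> C}" using f(1) by auto
qed

text \<open>
  Up to time \<open>t\<close> the path consists of finitely many flow pieces, whose starting points and lengths are
  known at time \<open>t\<close>; a visit happens in one of the completed pieces or in the current one.
\<close>

lemma stopping_time_hit:
  assumes C: "closed C"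
  shows "stopping_time F (hit C z)"
proof
  fix s :: ennreal
  show "Measurable.pred (F s) (\<lambda>\<omega>. hit C z \<omega> \<le> s)"
  proof (cases s)
    case top
    then have "(\<lambda>\<omega>. hit C z \<omega> \<le> s) = (\<lambda>\<omega>. True)" by simp
    then show ?thesis by (simp only: measurable_const UNIV_I space_count_space)
  next
    case (real t)
    then have t: "0 \<le> t" by simp
    define E where "E = {p :: real \<times> real \<times> real. \<exists>v. 0 \<le> v \<and> v \<le> fst p \<and> flow v (snd p) \<in> C}"
    have E [measurable]: "E \<in> sets borel" unfolding E_def using closed_flow_hits[OF C] by (rule borel_closed)
    define T where "T k \<omega> = min (\<sigma> k \<omega>) t" for k \<omega>
    have T [measurable]: "T k \<in> borel_measurable (F (ennreal t))" for k
      unfolding T_def by (rule jump_time_measurable_F[OF t])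
    note [measurable] = stopped_state_measurable_F[OF t] N_measurable_F[OF t order_refl]
    \<comment> \<open>A completed piece must be hit strictly before the next jump, which moves the state; the rational \<open>q\<close> expresses this strictness by countably many closed conditions.\<close>
    have "hit C z \<omega> \<le> s \<longleftrightarrow>
        (\<exists>k. k < N t \<omega> \<and> (\<exists>q\<in>\<rat>. q < T (Suc k) \<omega> - T k \<omega> \<and> (q, stopped_state t z k \<omega>) \<in> E))
        \<or> (t - T (N t \<omega>) \<omega>, stopped_state t z (N t \<omega>) \<omega>) \<in> E" (is "_ \<longleftrightarrow> ?A \<or> ?B")
      if "\<omega> \<in> space M" for \<omega>
    proof -
      note \<omega> = that
      have \<sigma>t: "T k \<omega> = \<sigma> k \<omega>" if "k \<le> N t \<omega>" for k using le_N_iff[OF \<omega> t, of k] that by (auto simp: T_def)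
      have "hit C z \<omega> \<le> s \<longleftrightarrow> (\<exists>u. 0 \<le> u \<and> u \<le> t \<and> \<Phi> z u \<omega> \<in> C)"
        using hit_le_iff[OF \<omega> C t] real by simp
      also have "\<dots> \<longleftrightarrow> ?A \<or> ?B"
      proof
        assume "\<exists>u. 0 \<le> u \<and> u \<le> t \<and> \<Phi> z u \<omega> \<in> C"
        then obtain u where u: "0 \<le> u" "u \<le> t" "\<Phi> z u \<omega> \<in> C" by blast
        let ?k = "N u \<omega>"
        have k: "?k \<le> N t \<omega>" by (rule N_mono[OF \<omega> u(1,2)])
        have fl: "flow (u - \<sigma> ?k \<omega>) (stopped_state t z ?k \<omega>) \<in> C"
          using u(3) \<Phi>_eq_flow[OF \<omega> u(1,2) refl] by simp
        note ku = jump_time_N[OF \<omega> u(1)]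
        show "?A \<or> ?B"
        proof (cases "?k = N t \<omega>")
          case True
          have "(t - \<sigma> ?k \<omega>, stopped_state t z ?k \<omega>) \<in> E"
            unfolding E_def mem_Collect_eq fst_conv snd_conv
            by (rule exI[of _ "u - \<sigma> (N u \<omega>) \<omega>"]) (use fl ku u in simp)
          then have ?B using \<sigma>t[OF k] unfolding True by simp
          then show ?thesis ..
        next
          case False
          then have k': "?k < N t \<omega>" "Suc ?k \<le> N t \<omega>" using k by auto
          obtain q where q: "q \<in> \<rat>" "u - \<sigma> ?k \<omega> < q" "q < \<sigma> (Suc ?k) \<omega> - \<sigma> ?k \<omega>"
            using Rats_dense_in_real[of "u - \<sigma> ?k \<omega>" "\<sigma> (Suc ?k) \<omega> - \<sigma> ?k \<omega>"] ku by auto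
          have "(q, stopped_state t z ?k \<omega>) \<in> E"
            unfolding E_def mem_Collect_eq fst_conv snd_conv
            by (rule exI[of _ "u - \<sigma> (N u \<omega>) \<omega>"]) (use q fl ku in simp)
          then have ?A
            by (intro exI[of _ ?k] conjI bexI[of _ q] k' q(1)) (simp_all only: \<sigma>t[OF k] \<sigma>t[OF k'(2)] q(3))
          then show ?thesis ..
        qed
      next
        assume "?A \<or> ?B"
        then show "\<exists>u. 0 \<le> u \<and> u \<le> t \<and> \<Phi> z u \<omega> \<in> C"
        proof
          assume ?A
          then obtain k q where k: "k < N t \<omega>" and q: "q < T (Suc k) \<omega> - T k \<omega>"
            "(q, stopped_state t z k \<omega>) \<in> E" by blast
          then obtain v where v: "0 \<le> v" "v \<le> q" "flow v (stopped_state t z k \<omega>) \<in> C" by (auto simp: E_def)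
          have q': "q < \<sigma> (Suc k) \<omega> - \<sigma> k \<omega>" using q \<sigma>t[of k] \<sigma>t[of "Suc k"] k by simp
          let ?u = "\<sigma> k \<omega> + v"
          have u: "0 \<le> ?u" "?u \<le> t" using v q' k jump_time_nonneg[OF \<omega>, of k] le_N_iff[OF \<omega> t, of "Suc k"] by auto
          have "N ?u \<omega> = k" by (rule N_eqI[OF \<omega>]) (use v q' in auto)
          from \<Phi>_eq_flow[OF \<omega> u this] v(3) show ?thesis using u by (intro exI[of _ ?u]) simp
        next
          assume ?B
          then obtain v where v: "0 \<le> v" "v \<le> t - \<sigma> (N t \<omega>) \<omega>" "flow v (stopped_state t z (N t \<omega>) \<omega>) \<in> C"
            using \<sigma>t[of "N t \<omega>"] by (auto simp: E_def)
          let ?u = "\<sigma> (N t \<omega>) \<omega> + v"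
          have u: "0 \<le> ?u" "?u \<le> t" using v jump_time_nonneg[OF \<omega>] by auto
          have "N ?u \<omega> = N t \<omega>" by (rule N_eqI[OF \<omega>]) (use v jump_time_N[OF \<omega> t] in auto)
          from \<Phi>_eq_flow[OF \<omega> u this] v(3) show ?thesis using u by (intro exI[of _ ?u]) simp
        qed
      qed
      finally show ?thesis .
    qed
    moreover have "Measurable.pred (F (ennreal t)) (\<lambda>\<omega>.
        (\<exists>k. k < N t \<omega> \<and> (\<exists>q\<in>\<rat>. q < T (Suc k) \<omega> - T k \<omega> \<and> (q, stopped_state t z k \<omega>) \<in> E))
        \<or> (t - T (N t \<omega>) \<omega>, stopped_state t z (N t \<omega>) \<omega>) \<in> E)"
    proof -
      have 1: "(\<lambda>\<omega>. (t - T (N t \<omega>) \<omega>, stopped_state t z (N t \<omega>) \<omega>)) \<in> borel_measurable (F (ennreal t))"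
        by (rule measurable_compose_countable[where f="\<lambda>n \<omega>. (t - T n \<omega>, stopped_state t z n \<omega>)"])
          (intro borel_measurable_Pair borel_measurable_diff borel_measurable_const T
            stopped_state_measurable_F[OF t] N_measurable_F[OF t order_refl])+
      have 2: "(\<lambda>\<omega>. (q, stopped_state t z k \<omega>)) \<in> borel_measurable (F (ennreal t))" for q :: real and k
        by (intro borel_measurable_Pair borel_measurable_const stopped_state_measurable_F[OF t])
      note [measurable] = pred_sets2[OF E 1] pred_sets2[OF E 2]
      have [measurable]: "Measurable.pred (F (ennreal t)) (\<lambda>\<omega>. \<exists>q\<in>\<rat>.
          q < T (Suc k) \<omega> - T k \<omega> \<and> (q, stopped_state t z k \<omega>) \<in> E)" for k
      proof -
        have "(\<exists>q\<in>\<rat>. q < T (Suc k) \<omega> - T k \<omega> \<and> (q, stopped_state t z k \<omega>) \<in> E) \<longleftrightarrow>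
            (\<exists>q::rat. of_rat q < T (Suc k) \<omega> - T k \<omega> \<and> (of_rat q, stopped_state t z k \<omega>) \<in> E)" for \<omega>
          unfolding Rats_def by blast
        then show ?thesis by (simp only:) measurable
      qed
      show ?thesis by measurable
    qed
    ultimately show ?thesis
      unfolding real(2)
      by (subst measurable_cong[where f="\<lambda>\<omega>. hit C z \<omega> \<le> ennreal t"]) simp_all
  qed
qed

end

section \<open>Equality of laws on rectangles\<close>

context prob_space
begin

text \<open>
  Independence of an event \<open>A\<close> from a random element says that two finite measures agree: the law of
  the element under \<open>P\<close> restricted to \<open>A\<close>, and its law times \<open>prob A\<close>.  The two evaluations below
  let the uniqueness theorems for measures be applied to such statements.
\<close>

lemma prob_distr_density_indicator:
  assumes [measurable]: "A \<in> events" "f \<in> measurable M K" "B \<in> sets K"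
  shows "emeasure (distr (density M (indicator A)) K f) B = ennreal (prob (A \<inter> {\<omega>\<in>space M. f \<omega> \<in> B}))"
proof -
  have "emeasure (distr (density M (indicator A)) K f) B =
      (\<integral>\<^sup>+\<omega>. indicator A \<omega> * indicator (f -` B \<inter> space M) \<omega> \<partial>M)"
    by (subst emeasure_distr) (auto simp: emeasure_density)
  also have "\<dots> = (\<integral>\<^sup>+\<omega>. indicator (A \<inter> {\<omega>\<in>space M. f \<omega> \<in> B}) \<omega> \<partial>M)"
    by (intro nn_integral_cong) (auto simp: indicator_def)
  also have "\<dots> = emeasure M (A \<inter> {\<omega>\<in>space M. f \<omega> \<in> B})"
    by (subst nn_integral_indicator) auto
  finally show ?thesis by (simp add: emeasure_eq_measure)
qed

lemma prob_distr_density_const: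
  assumes [measurable]: "f \<in> measurable M K" "B \<in> sets K" and c: "0 \<le> c"
  shows "emeasure (distr (density M (\<lambda>_. ennreal c)) K f) B = ennreal (c * prob {\<omega>\<in>space M. f \<omega> \<in> B})"
proof -
  have "emeasure (distr (density M (\<lambda>_. ennreal c)) K f) B = ennreal c * emeasure M (f -` B \<inter> space M)"
    by (subst emeasure_distr) (auto simp: emeasure_density nn_integral_cmult_indicator)
  also have "f -` B \<inter> space M = {\<omega>\<in>space M. f \<omega> \<in> B}" by auto
  finally show ?thesis using c by (simp add: emeasure_eq_measure ennreal_mult)
qed

lemma prob_PiM_eqI:
  assumes f [measurable]: "f \<in> measurable M (PiM I K)" "h \<in> measurable M (PiM I K)"
    and A [measurable]: "A \<in> events" and c: "0 \<le> c"
    and eq: "\<And>J E. finite J \<Longrightarrow> J \<subseteq> I \<Longrightarrow> (\<And>i. i \<in> J \<Longrightarrow> E i \<in> sets (K i)) \<Longrightarrow>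
      prob (A \<inter> {\<omega>\<in>space M. \<forall>i\<in>J. f \<omega> i \<in> E i}) = c * prob {\<omega>\<in>space M. \<forall>i\<in>J. h \<omega> i \<in> E i}"
    and B [measurable]: "B \<in> sets (PiM I K)"
  shows "prob (A \<inter> {\<omega>\<in>space M. f \<omega> \<in> B}) = c * prob {\<omega>\<in>space M. h \<omega> \<in> B}"
proof -
  let ?P = "distr (density M (indicator A)) (PiM I K) f"
  let ?Q = "distr (density M (\<lambda>_. ennreal c)) (PiM I K) h"
  have "?P = ?Q"
  proof (rule measure_eqI_PiM_infinite)
    fix E J assume J: "finite J" "J \<subseteq> I" and E: "\<And>i. i \<in> J \<Longrightarrow> E i \<in> sets (K i)"
    have emb: "{\<omega>\<in>space M. u \<omega> \<in> prod_emb I K J (Pi\<^sub>E J E)} = {\<omega>\<in>space M. \<forall>i\<in>J. u \<omega> i \<in> E i}"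
      if "u \<in> measurable M (PiM I K)" for u
      using measurable_space[OF that] J by (auto simp: prod_emb_def space_PiM PiE_iff)
    have S: "prod_emb I K J (Pi\<^sub>E J E) \<in> sets (PiM I K)"
      using J E by (intro sets_PiM_I) auto
    show "emeasure ?P (prod_emb I K J (Pi\<^sub>E J E)) = emeasure ?Q (prod_emb I K J (Pi\<^sub>E J E))"
      unfolding prob_distr_density_indicator[OF A f(1) S] prob_distr_density_const[OF f(2) S c]
        emb[OF f(1)] emb[OF f(2)] using eq[OF J E] by simp
  next
    show "finite_measure ?P"
      by (rule finite_measureI) (subst prob_distr_density_indicator[OF A f(1)], auto)
  qed auto
  then have "emeasure ?P B = emeasure ?Q B" by simp
  then show ?thesis
    unfolding prob_distr_density_indicator[OF A f(1) B] prob_distr_density_const[OF f(2) B c]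
    using c by simp
qed

lemma prob_pair_eqI:
  assumes f [measurable]: "f \<in> measurable M (K1 \<Otimes>\<^sub>M K2)" "h \<in> measurable M (K1 \<Otimes>\<^sub>M K2)"
    and A [measurable]: "A \<in> events" and c: "0 \<le> c"
    and eq: "\<And>E1 E2. E1 \<in> sets K1 \<Longrightarrow> E2 \<in> sets K2 \<Longrightarrow>
      prob (A \<inter> {\<omega>\<in>space M. f \<omega> \<in> E1 \<times> E2}) = c * prob {\<omega>\<in>space M. h \<omega> \<in> E1 \<times> E2}"
    and B [measurable]: "B \<in> sets (K1 \<Otimes>\<^sub>M K2)"
  shows "prob (A \<inter> {\<omega>\<in>space M. f \<omega> \<in> B}) = c * prob {\<omega>\<in>space M. h \<omega> \<in> B}"
proof -
  let ?P = "distr (density M (indicator A)) (K1 \<Otimes>\<^sub>M K2) f"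
  let ?Q = "distr (density M (\<lambda>_. ennreal c)) (K1 \<Otimes>\<^sub>M K2) h"
  have "?P = ?Q"
  proof (rule measure_eqI_generator_eq[OF Int_stable_pair_measure_generator pair_measure_closed])
    fix X assume "X \<in> {a \<times> b |a b. a \<in> sets K1 \<and> b \<in> sets K2}"
    then obtain E1 E2 where X: "X = E1 \<times> E2" and E: "E1 \<in> sets K1" "E2 \<in> sets K2" by auto
    then have S: "X \<in> sets (K1 \<Otimes>\<^sub>M K2)" by auto
    show "emeasure ?P X = emeasure ?Q X"
      unfolding prob_distr_density_indicator[OF A f(1) S] prob_distr_density_const[OF f(2) S c]
      using eq[OF E] X by simp
  next
    have top: "space K1 \<times> space K2 \<in> sets (K1 \<Otimes>\<^sub>M K2)" by auto
    show "range (\<lambda>_::nat. space K1 \<times> space K2) \<subseteq> {a \<times> b |a b. a \<in> sets K1 \<and> b \<in> sets K2}" by auto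
    show "emeasure ?P (space K1 \<times> space K2) \<noteq> \<infinity>" for i :: nat
      unfolding prob_distr_density_indicator[OF A f(1) top] by simp
  qed (auto simp: sets_pair_measure)
  then have "emeasure ?P B = emeasure ?Q B" by simp
  then show ?thesis
    unfolding prob_distr_density_indicator[OF A f(1) B] prob_distr_density_const[OF f(2) B c]
    using c by simp
qed

end

section \<open>Independence and stationarity of past and future\<close>

lemma measurable_nat_op:
  fixes h :: "nat \<Rightarrow> nat \<Rightarrow> nat"
  assumes "f \<in> measurable K (count_space UNIV)" "g \<in> measurable K (count_space UNIV)"
  shows "(\<lambda>x. h (f x) (g x)) \<in> measurable K (count_space UNIV)"
  by (rule measurable_compose_countable[where f="\<lambda>i x. h i (g x)" and g=f])
    (auto intro!: measurable_compose[OF assms(2)] assms(1))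

text \<open>
  The assumption on independent increments is formulated for infinite sequences of times, so a
  finite set of times is listed in increasing order with its maximum repeated forever.
\<close>

lemma ex_mono_enumeration:
  fixes S :: "real set"
  assumes S: "finite S" "0 \<in> S" "S \<subseteq> {0..}"
  shows "\<exists>t::nat \<Rightarrow> real. mono t \<and> t 0 = 0 \<and> range t = S"
proof -
  define xs where "xs = sorted_list_of_set S"
  define n where "n = length xs"
  have xs: "sorted xs" "set xs = S" using S(1) by (auto simp: xs_def)
  then have n: "0 < n" using S(2) by (auto simp: n_def)
  then have lt: "min i (n - 1) < length xs" for i unfolding n_def[symmetric] by (simp add: min_less_iff_disj)
  define t where "t i = xs ! min i (n - 1)" for i
  have mono: "mono t"
  proof (rule monoI)
    fix i j :: nat assume "i \<le> j"
    then show "t i \<le> t j" unfolding t_def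
      by (intro sorted_nth_mono[OF xs(1)] lt) simp
  qed
  have rg: "range t = S"
  proof (intro equalityI subsetI)
    fix x assume "x \<in> range t"
    then obtain i where "x = xs ! min i (n - 1)" by (auto simp: t_def)
    then show "x \<in> S" using xs(2) nth_mem[OF lt] by metis
  next
    fix x assume "x \<in> S"
    then obtain i where "i < n" "xs ! i = x" using xs(2) by (metis in_set_conv_nth n_def)
    then have "t i = x" using n by (auto simp: t_def min_def)
    then show "x \<in> range t" by auto
  qed
  obtain i where "t i = 0" using rg S(2) by (metis imageE)
  then have "t 0 \<le> 0" using monoD[OF mono, of 0 i] by simp
  moreover have "t 0 \<in> S" using rg by auto
  ultimately have "t 0 = 0" using S(3) by auto
  then show ?thesis using mono rg by blast
qed

context poisson_disorder
begin

abbreviation "path_space \<equiv> PiM {0::real..} (\<lambda>_. count_space (UNIV :: nat set))"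
abbreviation "mark_space \<equiv> PiM {1::nat..} (\<lambda>_. borel :: (real^'d) measure)"

lemma N_indep_increments:
  assumes "0 \<le> t 0" "mono t"
  shows "indep_vars (\<lambda>_. count_space UNIV) (\<lambda>i \<omega>. N (t (Suc i)) \<omega> - N (t i) \<omega>) UNIV"
  using poisson assms by (auto simp: poisson_process_def)

lemma N_increment_distr:
  assumes "0 \<le> a" "a \<le> b" "0 \<le> s"
  shows "distr M (count_space UNIV) (\<lambda>\<omega>. N (s + b) \<omega> - N (s + a) \<omega>) =
    distr M (count_space UNIV) (\<lambda>\<omega>. N b \<omega> - N a \<omega>)"
proof (cases "a = b")
  case False
  have P: "distr M (count_space UNIV) (\<lambda>\<omega>. N t \<omega> - N s \<omega>) = measure_pmf (poisson_pmf (mu * (t - s)))"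
    if "0 \<le> s" "s < t" for s t
    using poisson that by (auto simp: poisson_process_def)
  show ?thesis using P[of a b] P[of "s + a" "s + b"] False assms by simp
qed simp

lemma N_telescope:
  assumes \<omega>: "\<omega> \<in> space M" and t: "0 \<le> t 0" "mono t" and ik: "i \<le> k"
  shows "N (t k) \<omega> - N (t i) \<omega> = (\<Sum>j\<in>{i..<k}. N (t (Suc j)) \<omega> - N (t j) \<omega>)"
  using ik
proof (induction k rule: dec_induct)
  case (step k)
  have t0: "0 \<le> t j" for j using t monoD[OF t(2), of 0 j] by simp
  have le: "t i \<le> t k" "t k \<le> t (Suc k)" using step(1) by (auto intro!: monoD[OF t(2)])
  have 1: "N (t i) \<omega> \<le> N (t k) \<omega>" by (rule N_mono[OF \<omega> t0 le(1)])
  have 2: "N (t k) \<omega> \<le> N (t (Suc k)) \<omega>" by (rule N_mono[OF \<omega> t0 le(2)])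
  have "N (t (Suc k)) \<omega> - N (t i) \<omega> = (N (t k) \<omega> - N (t i) \<omega>) + (N (t (Suc k)) \<omega> - N (t k) \<omega>)"
    using 1 2 by linarith
  also have "\<dots> = (\<Sum>j\<in>{i..<Suc k}. N (t (Suc j)) \<omega> - N (t j) \<omega>)"
    unfolding step(3) by (rule sum.atLeastLessThan_Suc[OF step(1), symmetric])
  finally show ?case .
qed simp

lemma increments_measurable:
  "finite J \<Longrightarrow> J \<subseteq> I \<Longrightarrow> (\<lambda>x. \<Sum>j\<in>J. x j :: nat) \<in> measurable (PiM I (\<lambda>_. count_space UNIV)) (count_space UNIV)"
proof (induction J rule: finite_induct)
  case (insert j J)
  then have "(\<lambda>x. \<Sum>j\<in>J. x j :: nat) \<in> measurable (PiM I (\<lambda>_. count_space UNIV)) (count_space UNIV)"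
    "(\<lambda>x. x j :: nat) \<in> measurable (PiM I (\<lambda>_. count_space UNIV)) (count_space UNIV)"
    by (auto intro!: measurable_component_singleton)
  then show ?case
    using measurable_nat_op[where h="(+)" and f="\<lambda>x. x j" and g="\<lambda>x. \<Sum>j\<in>J. x j"] insert(1,2) by simp
qed simp

text \<open>
  Each value of the shifted process is a sum of increments over a partition; the increments are
  independent with laws that depend on the lengths of the intervals only.
\<close>

lemma prob_future_N_stationary:
  assumes s: "0 \<le> s" and W: "finite W" "W \<subseteq> {0..}"
  shows "prob {\<omega>\<in>space M. \<forall>w\<in>W. N (s + w) \<omega> - N s \<omega> \<in> A w} =
    prob {\<omega>\<in>space M. \<forall>w\<in>W. N (0 + w) \<omega> - N 0 \<omega> \<in> A w}"
proof -
  have "finite (insert 0 W)" "0 \<in> insert 0 W" "insert 0 W \<subseteq> {0..}" using W by auto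
  from ex_mono_enumeration[OF this]
  obtain t :: "nat \<Rightarrow> real" where t: "mono t" "t 0 = 0" "range t = insert 0 W" by blast
  then have t0: "0 \<le> t i" for i using monoD[OF t(1), of 0 i] by simp
  define ix where "ix w = (SOME i. t i = w)" for w
  have ix: "t (ix w) = w" if "w \<in> W" for w
  proof -
    have "w \<in> range t" unfolding t(3) using that by simp
    then have "\<exists>i. t i = w" by blast
    then show ?thesis unfolding ix_def by (rule someI_ex)
  qed
  let ?D = "\<lambda>s i \<omega>. N (s + t (Suc i)) \<omega> - N (s + t i) \<omega>"
  let ?K = "PiM UNIV (\<lambda>_::nat. count_space (UNIV :: nat set))"
  define S where "S = {x \<in> space ?K. \<forall>w\<in>W. (\<Sum>j\<in>{0..<ix w}. x j) \<in> A w}"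
  have S: "S \<in> sets ?K"
  proof -
    have [measurable]: "(\<lambda>x. \<Sum>j\<in>{0..<ix w}. x j) \<in> measurable ?K (count_space UNIV)" for w
      by (rule increments_measurable) auto
    show ?thesis unfolding S_def using W(1) by measurable
  qed
  have D_meas: "?D s i \<in> measurable M (count_space UNIV)" if "0 \<le> s" for s i
    by (rule measurable_nat_op) (simp_all add: N_measurable that t0)
  have law: "distr M ?K (\<lambda>\<omega>. \<lambda>i\<in>UNIV. ?D s i \<omega>) = PiM UNIV (\<lambda>i. distr M (count_space UNIV) (?D s i))"
    if "0 \<le> s" for s
  proof (rule indep_vars_iff_distr_eq_PiM[THEN iffD1])
    show "indep_vars (\<lambda>_. count_space UNIV) (?D s) UNIV"
    proof (rule N_indep_increments[of "\<lambda>i. s + t i"])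
      show "0 \<le> s + t 0" using that t(2) by simp
      show "mono (\<lambda>i. s + t i)" using t(1) by (simp add: mono_def)
    qed
  qed (auto intro: D_meas that)
  have "distr M ?K (\<lambda>\<omega>. \<lambda>i\<in>UNIV. ?D s i \<omega>) = distr M ?K (\<lambda>\<omega>. \<lambda>i\<in>UNIV. ?D 0 i \<omega>)"
    unfolding law[OF s] law[OF order_refl]
  proof (intro arg_cong[where f="PiM UNIV"] ext)
    fix i
    have "t i \<le> t (Suc i)" using monoD[OF t(1), of i "Suc i"] by simp
    from N_increment_distr[OF t0 this s] N_increment_distr[OF t0 this order_refl]
    show "distr M (count_space UNIV) (?D s i) = distr M (count_space UNIV) (?D 0 i)" by (simp only:)
  qed
  then have "measure (distr M ?K (\<lambda>\<omega>. \<lambda>i\<in>UNIV. ?D s i \<omega>)) S = measure (distr M ?K (\<lambda>\<omega>. \<lambda>i\<in>UNIV. ?D 0 i \<omega>)) S"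
    by simp
  moreover have eq: "measure (distr M ?K (\<lambda>\<omega>. \<lambda>i\<in>UNIV. ?D s i \<omega>)) S =
      prob {\<omega>\<in>space M. \<forall>w\<in>W. N (s + w) \<omega> - N s \<omega> \<in> A w}" if s: "0 \<le> s" for s
  proof -
    have "(\<lambda>\<omega>. \<lambda>i\<in>UNIV. ?D s i \<omega>) \<in> measurable M ?K"
      by (intro measurable_restrict D_meas s)
    moreover have "(\<lambda>\<omega>. \<lambda>i\<in>UNIV. ?D s i \<omega>) -` S \<inter> space M =
        {\<omega>\<in>space M. \<forall>w\<in>W. N (s + w) \<omega> - N s \<omega> \<in> A w}"
    proof -
      have "N (s + w) \<omega> - N s \<omega> = (\<Sum>j\<in>{0..<ix w}. ?D s j \<omega>)" if "\<omega> \<in> space M" "w \<in> W" for w \<omega>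
      proof -
        have "0 \<le> s + t 0" "mono (\<lambda>i. s + t i)" using s t by (simp_all add: mono_def)
        from N_telescope[OF that(1) this, of 0 "ix w"] show ?thesis
          unfolding ix[OF that(2)] t(2) by simp
      qed
      then show ?thesis by (auto simp: S_def space_PiM)
    qed
    ultimately show ?thesis using S by (simp add: measure_distr)
  qed
  ultimately show ?thesis unfolding eq[OF s] eq[OF order_refl] by simp
qed

text \<open>
  On a partition that contains \<open>s\<close>, the past is a function of the increments before \<open>s\<close> and the future
  of those after \<open>s\<close>.
\<close>

lemma prob_past_future_N:
  assumes s: "0 \<le> s" and U: "finite U" "U \<subseteq> {0..s}" and W: "finite W" "W \<subseteq> {0..}"
  shows "prob ({\<omega>\<in>space M. \<forall>u\<in>U. N u \<omega> \<in> A u} \<inter> {\<omega>\<in>space M. \<forall>w\<in>W. N (s + w) \<omega> - N s \<omega> \<in> B w}) =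
    prob {\<omega>\<in>space M. \<forall>u\<in>U. N u \<omega> \<in> A u} * prob {\<omega>\<in>space M. \<forall>w\<in>W. N (s + w) \<omega> - N s \<omega> \<in> B w}"
proof -
  let ?T = "insert 0 (insert s (U \<union> (+) s ` W))"
  have "finite ?T" "0 \<in> ?T" "?T \<subseteq> {0..}" using U W s by auto
  from ex_mono_enumeration[OF this]
  obtain t :: "nat \<Rightarrow> real" where t: "mono t" "t 0 = 0" "range t = ?T" by blast
  then have t0: "0 \<le> t i" for i using monoD[OF t(1), of 0 i] by simp
  define ix where "ix w = (SOME i. t i = w)" for w
  have ix: "t (ix w) = w" if "w \<in> ?T" for w
  proof -
    have "w \<in> range t" unfolding t(3) by (rule that)
    then have "\<exists>i. t i = w" by blast
    then show ?thesis unfolding ix_def by (rule someI_ex)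
  qed
  define p where "p = ix s"
  have p: "t p = s" unfolding p_def by (rule ix) simp
  \<comment> \<open>\<open>t\<close> need not be injective; clamping the indices at \<open>p\<close> puts the past to the left and the future to the right of \<open>p\<close>.\<close>
  define iu where "iu u = min (ix u) p" for u
  define iw where "iw w = max (ix (s + w)) p" for w
  have iu: "t (iu u) = u" if "u \<in> U" for u
  proof -
    have "t (ix u) = u" "u \<le> s" using ix[of u] that U by auto
    then show ?thesis using p monoD[OF t(1), of p "ix u"] by (auto simp: iu_def min_def)
  qed
  have iw: "t (iw w) = s + w" if "w \<in> W" for w
  proof -
    have "t (ix (s + w)) = s + w" "0 \<le> w" using ix[of "s + w"] that W by auto
    then show ?thesis using p monoD[OF t(1), of "ix (s + w)" p] by (auto simp: iw_def max_def)
  qed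
  let ?D = "\<lambda>i \<omega>. N (t (Suc i)) \<omega> - N (t i) \<omega>"
  let ?K = "\<lambda>I. PiM I (\<lambda>_::nat. count_space (UNIV :: nat set))"
  have ind: "indep_var (?K {..<p}) (\<lambda>\<omega>. \<lambda>i\<in>{..<p}. ?D i \<omega>) (?K {p..}) (\<lambda>\<omega>. \<lambda>i\<in>{p..}. ?D i \<omega>)"
  proof (rule indep_var_restrict[OF N_indep_increments])
    show "0 \<le> t 0" using t(2) by simp
    show "mono t" by (rule t(1))
  qed auto
  define S1 where "S1 = {x \<in> space (?K {..<p}). \<forall>u\<in>U. (\<Sum>j\<in>{0..<iu u}. x j) \<in> A u}"
  define S2 where "S2 = {x \<in> space (?K {p..}). \<forall>w\<in>W. (\<Sum>j\<in>{p..<iw w}. x j) \<in> B w}"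
  have S1: "S1 \<in> sets (?K {..<p})"
  proof -
    have [measurable]: "(\<lambda>x. \<Sum>j\<in>{0..<iu w}. x j) \<in> measurable (?K {..<p}) (count_space UNIV)" for w
      by (rule increments_measurable) (auto simp: iu_def)
    show ?thesis unfolding S1_def using U(1) by measurable
  qed
  have S2: "S2 \<in> sets (?K {p..})"
  proof -
    have [measurable]: "(\<lambda>x. \<Sum>j\<in>{p..<iw w}. x j) \<in> measurable (?K {p..}) (count_space UNIV)" for w
      by (rule increments_measurable) auto
    show ?thesis unfolding S2_def using W(1) by measurable
  qed
  have E1: "(\<lambda>\<omega>. \<lambda>i\<in>{..<p}. ?D i \<omega>) -` S1 \<inter> space M = {\<omega>\<in>space M. \<forall>u\<in>U. N u \<omega> \<in> A u}"
  proof -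
    have "N u \<omega> = (\<Sum>j\<in>{0..<iu u}. (\<lambda>i\<in>{..<p}. ?D i \<omega>) j)" if "\<omega> \<in> space M" "u \<in> U" for u \<omega>
    proof -
      have "N u \<omega> = (\<Sum>j\<in>{0..<iu u}. ?D j \<omega>)"
        using N_telescope[OF that(1) t0 t(1), of 0 "iu u"] unfolding iu[OF that(2)] t(2) N_0[OF that(1)] by simp
      also have "\<dots> = (\<Sum>j\<in>{0..<iu u}. (\<lambda>i\<in>{..<p}. ?D i \<omega>) j)"
        by (rule sum.cong) (auto simp: iu_def)
      finally show ?thesis .
    qed
    then show ?thesis by (auto simp: S1_def space_PiM)
  qed
  have E2: "(\<lambda>\<omega>. \<lambda>i\<in>{p..}. ?D i \<omega>) -` S2 \<inter> space M = {\<omega>\<in>space M. \<forall>w\<in>W. N (s + w) \<omega> - N s \<omega> \<in> B w}"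
  proof -
    have "N (s + w) \<omega> - N s \<omega> = (\<Sum>j\<in>{p..<iw w}. (\<lambda>i\<in>{p..}. ?D i \<omega>) j)" if "\<omega> \<in> space M" "w \<in> W" for w \<omega>
    proof -
      have "N (s + w) \<omega> - N s \<omega> = (\<Sum>j\<in>{p..<iw w}. ?D j \<omega>)"
        using N_telescope[OF that(1) t0 t(1), of p "iw w"] unfolding iw[OF that(2)] p by (simp add: iw_def)
      then show ?thesis by simp
    qed
    then show ?thesis by (auto simp: S2_def space_PiM)
  qed
  have "(\<lambda>x. (\<lambda>i\<in>{..<p}. ?D i x, \<lambda>i\<in>{p..}. ?D i x)) -` (S1 \<times> S2) \<inter> space M =
      ((\<lambda>\<omega>. \<lambda>i\<in>{..<p}. ?D i \<omega>) -` S1 \<inter> space M) \<inter> ((\<lambda>\<omega>. \<lambda>i\<in>{p..}. ?D i \<omega>) -` S2 \<inter> space M)"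
    by auto
  then show ?thesis using indep_varD[OF ind S1 S2] unfolding E1 E2 by simp
qed

definition past_N :: "real \<Rightarrow> 'a \<Rightarrow> real \<Rightarrow> nat" where
  "past_N s \<omega> = (\<lambda>u\<in>{0..s}. N u \<omega>)"

definition past_Y :: "nat \<Rightarrow> 'a \<Rightarrow> nat \<Rightarrow> real ^ 'd" where
  "past_Y n \<omega> = (\<lambda>k\<in>{1..n}. Y k \<omega>)"

lemma past_N_measurable [measurable]:
  "past_N s \<in> measurable M (PiM {0..s} (\<lambda>_. count_space UNIV))"
  unfolding past_N_def[abs_def] by (rule measurable_restrict, rule N_measurable) simp

lemma future_N_measurable [measurable]: "0 \<le> s \<Longrightarrow> future_N s \<in> measurable M path_space"
  unfolding future_N_def[abs_def]
  by (rule measurable_restrict, rule measurable_nat_op) (simp_all add: N_measurable)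

lemma past_Y_measurable [measurable]: "past_Y n \<in> measurable M (PiM {1..n} (\<lambda>_. borel))"
  unfolding past_Y_def[abs_def] by (rule measurable_restrict, rule Y_measurable) simp

lemma future_Y_measurable [measurable]: "future_Y n \<in> measurable M mark_space"
  unfolding future_Y_def[abs_def] by (rule measurable_restrict, rule Y_measurable) simp

text \<open>
  Extends independence from finitely many times to the whole paths, one side after the other.
\<close>

lemma past_future_N:
  assumes s: "0 \<le> s" and A: "A \<in> sets (PiM {0..s} (\<lambda>_. count_space UNIV))" and B: "B \<in> sets path_space"
  shows "prob ({\<omega>\<in>space M. past_N s \<omega> \<in> A} \<inter> {\<omega>\<in>space M. future_N s \<omega> \<in> B}) =
    prob {\<omega>\<in>space M. past_N s \<omega> \<in> A} * prob {\<omega>\<in>space M. future_N 0 \<omega> \<in> B}"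
proof -
  have past: "{\<omega>\<in>space M. \<forall>u\<in>U. past_N s \<omega> u \<in> E u} = {\<omega>\<in>space M. \<forall>u\<in>U. N u \<omega> \<in> E u}"
    if "U \<subseteq> {0..s}" for U and E :: "real \<Rightarrow> nat set"
    using that by (auto simp: past_N_def)
  have fut: "{\<omega>\<in>space M. \<forall>w\<in>W. future_N s \<omega> w \<in> E w} = {\<omega>\<in>space M. \<forall>w\<in>W. N (s + w) \<omega> - N s \<omega> \<in> E w}"
    if "W \<subseteq> {0..}" for W s and E :: "real \<Rightarrow> nat set"
    using that by (auto simp: future_N_def)
  have 1: "prob ({\<omega>\<in>space M. \<forall>u\<in>U. past_N s \<omega> u \<in> E u} \<inter> {\<omega>\<in>space M. future_N s \<omega> \<in> B}) =
      prob {\<omega>\<in>space M. \<forall>u\<in>U. past_N s \<omega> u \<in> E u} * prob {\<omega>\<in>space M. future_N 0 \<omega> \<in> B}"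
    if U: "finite U" "U \<subseteq> {0..s}" for U E
  proof (rule prob_PiM_eqI[OF _ _ _ _ _ B])
    have "{\<omega>\<in>space M. \<forall>u\<in>U. N u \<omega> \<in> E u} = space M \<inter> (\<Inter>u\<in>U. {\<omega>\<in>space M. N u \<omega> \<in> E u})" by auto
    also have "\<dots> \<in> events"
    proof (cases "U = {}")
      case False
      then show ?thesis using U
        by (intro sets.Int sets.top sets.finite_INT) (auto intro!: measurable_sets_Collect[OF N_measurable])
    qed simp
    finally show "{\<omega>\<in>space M. \<forall>u\<in>U. past_N s \<omega> u \<in> E u} \<in> events" unfolding past[OF U(2)] .
    fix J :: "real set" and E' :: "real \<Rightarrow> nat set" assume J: "finite J" "J \<subseteq> {0..}"
    show "prob ({\<omega>\<in>space M. \<forall>u\<in>U. past_N s \<omega> u \<in> E u} \<inter> {\<omega>\<in>space M. \<forall>i\<in>J. future_N s \<omega> i \<in> E' i}) =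
        prob {\<omega>\<in>space M. \<forall>u\<in>U. past_N s \<omega> u \<in> E u} * prob {\<omega>\<in>space M. \<forall>i\<in>J. future_N 0 \<omega> i \<in> E' i}"
      unfolding past[OF U(2)] fut[OF J(2)] prob_past_future_N[OF s U J] prob_future_N_stationary[OF s J] ..
  qed (use s in auto)
  have "prob ({\<omega>\<in>space M. future_N s \<omega> \<in> B} \<inter> {\<omega>\<in>space M. past_N s \<omega> \<in> A}) =
      prob {\<omega>\<in>space M. future_N 0 \<omega> \<in> B} * prob {\<omega>\<in>space M. past_N s \<omega> \<in> A}"
  proof (rule prob_PiM_eqI[OF _ _ _ _ _ A])
    show "{\<omega>\<in>space M. future_N s \<omega> \<in> B} \<in> events"
      using measurable_sets_Collect[OF future_N_measurable[OF s]] B by simp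
  qed (use 1 in \<open>auto simp: Int_commute mult.commute\<close>)
  then show ?thesis by (simp add: Int_commute mult.commute)
qed

lemma prob_marks:
  assumes J: "finite J" "J \<subseteq> {1..}" and E: "\<And>i. i \<in> J \<Longrightarrow> E i \<in> sets borel"
  shows "prob {\<omega>\<in>space M. \<forall>i\<in>J. Y (n + i) \<omega> \<in> E i} = (\<Prod>i\<in>J. measure \<beta>0 (E i))"
proof (cases "J = {}")
  case True then show ?thesis by (simp add: prob_space)
next
  case False
  have "prob (\<Inter>j\<in>(+) n ` J. Y j -` E (j - n) \<inter> space M) =
      (\<Prod>j\<in>(+) n ` J. prob (Y j -` E (j - n) \<inter> space M))"
    by (rule indep_varsD[OF Y_indep]) (use False J E in auto)
  also have "\<dots> = (\<Prod>i\<in>J. prob (Y (n + i) -` E i \<inter> space M))"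
    by (subst prod.reindex) (auto simp: o_def)
  also have "\<dots> = (\<Prod>i\<in>J. measure \<beta>0 (E i))"
  proof (rule prod.cong[OF refl])
    fix i assume i: "i \<in> J"
    then have "1 \<le> n + i" using J by auto
    then show "prob (Y (n + i) -` E i \<inter> space M) = measure \<beta>0 (E i)"
      using Y_distr[of "n + i"] E[OF i] Y_measurable[of "n + i"] measure_distr[of "Y (n + i)" M borel "E i"] by simp
  qed
  also have "(\<Inter>j\<in>(+) n ` J. Y j -` E (j - n) \<inter> space M) = {\<omega>\<in>space M. \<forall>i\<in>J. Y (n + i) \<omega> \<in> E i}"
    using False by auto
  finally show ?thesis .
qed

lemma prob_future_Y:
  assumes D: "D \<in> sets mark_space"
  shows "prob {\<omega>\<in>space M. future_Y n \<omega> \<in> D} = prob {\<omega>\<in>space M. future_Y 0 \<omega> \<in> D}"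
proof -
  have "prob (space M \<inter> {\<omega>\<in>space M. future_Y n \<omega> \<in> D}) = 1 * prob {\<omega>\<in>space M. future_Y 0 \<omega> \<in> D}"
  proof (rule prob_PiM_eqI[OF _ _ _ _ _ D])
    fix J :: "nat set" and E assume J: "finite J" "J \<subseteq> {1..}" and E: "\<And>i. i \<in> J \<Longrightarrow> E i \<in> sets (borel :: (real^'d) measure)"
    have eq: "{\<omega>\<in>space M. \<forall>i\<in>J. future_Y n \<omega> i \<in> E i} = {\<omega>\<in>space M. \<forall>i\<in>J. Y (n + i) \<omega> \<in> E i}" for n
      using J by (auto simp: future_Y_def)
    have sp: "space M \<inter> {\<omega>\<in>space M. P \<omega>} = {\<omega>\<in>space M. P \<omega>}" for P by auto
    show "prob (space M \<inter> {\<omega>\<in>space M. \<forall>i\<in>J. future_Y n \<omega> i \<in> E i}) =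
        1 * prob {\<omega>\<in>space M. \<forall>i\<in>J. future_Y 0 \<omega> i \<in> E i}"
      unfolding sp eq mult_1
      by (rule trans[OF prob_marks[where n=n and E=E] prob_marks[where n=0 and E=E, symmetric]]) (use J E in auto)
  qed (rule future_Y_measurable | simp)+
  moreover have "space M \<inter> {\<omega>\<in>space M. future_Y n \<omega> \<in> D} = {\<omega>\<in>space M. future_Y n \<omega> \<in> D}" by auto
  ultimately show ?thesis by simp
qed

text \<open>
  Disjoint blocks of an independent family are independent, and a shifted identically distributed
  block has the law of the original one.
\<close>

lemma past_future_Y:
  assumes C: "C \<in> sets (PiM {1..n} (\<lambda>_. borel :: (real^'d) measure))" and D: "D \<in> sets mark_space"
  shows "prob ({\<omega>\<in>space M. past_Y n \<omega> \<in> C} \<inter> {\<omega>\<in>space M. future_Y n \<omega> \<in> D}) =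
    prob {\<omega>\<in>space M. past_Y n \<omega> \<in> C} * prob {\<omega>\<in>space M. future_Y 0 \<omega> \<in> D}"
proof -
  let ?K = "PiM {Suc n..} (\<lambda>_. borel :: (real^'d) measure)"
  have ind: "indep_var (PiM {1..n} (\<lambda>_. borel)) (\<lambda>\<omega>. \<lambda>i\<in>{1..n}. Y i \<omega>) ?K (\<lambda>\<omega>. \<lambda>i\<in>{Suc n..}. Y i \<omega>)"
    by (rule indep_var_restrict[OF Y_indep]) auto
  define sh where "sh x = (\<lambda>k\<in>{1..}. x (n + k) :: real^'d)" for x
  have sh: "sh \<in> measurable ?K mark_space"
    unfolding sh_def by (intro measurable_restrict measurable_component_singleton) auto
  have eq: "future_Y n \<omega> = sh (\<lambda>i\<in>{Suc n..}. Y i \<omega>)" for \<omega>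
    by (auto simp: future_Y_def sh_def)
  have D': "sh -` D \<inter> space ?K \<in> sets ?K" using sh D by (rule measurable_sets)
  have "prob ((\<lambda>\<omega>. (\<lambda>i\<in>{1..n}. Y i \<omega>, \<lambda>i\<in>{Suc n..}. Y i \<omega>)) -` (C \<times> (sh -` D \<inter> space ?K)) \<inter> space M) =
    prob ((\<lambda>\<omega>. \<lambda>i\<in>{1..n}. Y i \<omega>) -` C \<inter> space M) * prob ((\<lambda>\<omega>. \<lambda>i\<in>{Suc n..}. Y i \<omega>) -` (sh -` D \<inter> space ?K) \<inter> space M)"
    by (rule indep_varD[OF ind C D'])
  moreover have "(\<lambda>\<omega>. (\<lambda>i\<in>{1..n}. Y i \<omega>, \<lambda>i\<in>{Suc n..}. Y i \<omega>)) -` (C \<times> (sh -` D \<inter> space ?K)) \<inter> space M =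
      {\<omega>\<in>space M. past_Y n \<omega> \<in> C} \<inter> {\<omega>\<in>space M. future_Y n \<omega> \<in> D}"
    unfolding eq past_Y_def by (auto simp: space_PiM)
  moreover have "(\<lambda>\<omega>. \<lambda>i\<in>{1..n}. Y i \<omega>) -` C \<inter> space M = {\<omega>\<in>space M. past_Y n \<omega> \<in> C}"
    unfolding past_Y_def by auto
  moreover have "(\<lambda>\<omega>. \<lambda>i\<in>{Suc n..}. Y i \<omega>) -` (sh -` D \<inter> space ?K) \<inter> space M = {\<omega>\<in>space M. future_Y n \<omega> \<in> D}"
    unfolding eq by (auto simp: space_PiM)
  ultimately show ?thesis using prob_future_Y[OF D] by simp
qed

section \<open>The Markov property\<close>

text \<open>
  For a fixed number \<open>n\<close> of past marks, the initial value, the past and future of \<open>N\<close>, and the past and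
  future marks are independent: \<open>X0\<close> is independent of the pair of \<open>N\<close> and the marks, these two are
  independent of each other, and each of them splits into past and future.
\<close>

lemma five_fold_independence:
  assumes s: "0 \<le> s"
    and S: "S0 \<in> sets borel" "S1 \<in> sets (PiM {0..s} (\<lambda>_. count_space UNIV))" "S2 \<in> sets path_space"
      "S3 \<in> sets (PiM {1..n} (\<lambda>_. borel))" "S4 \<in> sets mark_space"
  shows "prob ({\<omega>\<in>space M. X0 \<omega> \<in> S0 \<and> past_N s \<omega> \<in> S1 \<and> past_Y n \<omega> \<in> S3} \<inter>
      {\<omega>\<in>space M. future_N s \<omega> \<in> S2 \<and> future_Y n \<omega> \<in> S4}) =
    (prob {\<omega>\<in>space M. X0 \<omega> \<in> S0} * prob {\<omega>\<in>space M. past_N s \<omega> \<in> S1} * prob {\<omega>\<in>space M. past_Y n \<omega> \<in> S3}) *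
    (prob {\<omega>\<in>space M. future_N 0 \<omega> \<in> S2} * prob {\<omega>\<in>space M. future_Y 0 \<omega> \<in> S4})"
proof -
  define NN where "NN \<omega> = (\<lambda>t\<in>{0..}. N t \<omega>)" for \<omega>
  define YY where "YY \<omega> = (\<lambda>k\<in>{1..}. Y k \<omega>)" for \<omega>
  define SN where "SN = {f\<in>space path_space. restrict f {0..s} \<in> S1 \<and> (\<lambda>v\<in>{0..}. f (s + v) - f s) \<in> S2}"
  define SY where "SY = {y\<in>space mark_space. restrict y {1..n} \<in> S3 \<and> (\<lambda>k\<in>{1..}. y (n + k)) \<in> S4}"
  have SN: "SN \<in> sets path_space"
  proof -
    have 1: "(\<lambda>f. restrict f {0..s}) \<in> measurable path_space (PiM {0..s} (\<lambda>_. count_space UNIV))"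
      by (rule measurable_restrict_subset) auto
    have 2: "(\<lambda>f. \<lambda>v\<in>{0..}. f (s + v) - f s) \<in> measurable path_space path_space"
      by (rule measurable_restrict, rule measurable_nat_op[where h="(-)"])
        (use s in \<open>auto intro!: measurable_component_singleton\<close>)
    have "SN = ((\<lambda>f. restrict f {0..s}) -` S1 \<inter> space path_space) \<inter>
        ((\<lambda>f. \<lambda>v\<in>{0..}. f (s + v) - f s) -` S2 \<inter> space path_space)"
      unfolding SN_def by auto
    then show ?thesis using measurable_sets[OF 1 S(2)] measurable_sets[OF 2 S(3)] by simp
  qed
  have SY: "SY \<in> sets mark_space"
  proof -
    have 1: "(\<lambda>f. restrict f {1..n}) \<in> measurable mark_space (PiM {1..n} (\<lambda>_. borel))"
      by (rule measurable_restrict_subset) auto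
    have 2: "(\<lambda>y. \<lambda>k\<in>{1..}. y (n + k)) \<in> measurable mark_space mark_space"
      by (rule measurable_restrict, rule measurable_component_singleton) auto
    have "SY = ((\<lambda>f. restrict f {1..n}) -` S3 \<inter> space mark_space) \<inter>
        ((\<lambda>y. \<lambda>k\<in>{1..}. y (n + k)) -` S4 \<inter> space mark_space)"
      unfolding SY_def by auto
    then show ?thesis using measurable_sets[OF 1 S(4)] measurable_sets[OF 2 S(5)] by simp
  qed
  have NN: "{\<omega>\<in>space M. past_N s \<omega> \<in> S1 \<and> future_N s \<omega> \<in> S2} = NN -` SN \<inter> space M"
  proof -
    have "restrict (NN \<omega>) {0..s} = past_N s \<omega>" "(\<lambda>v\<in>{0..}. NN \<omega> (s + v) - NN \<omega> s) = future_N s \<omega>"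
      "NN \<omega> \<in> space path_space" for \<omega>
      using s by (auto simp: NN_def past_N_def future_N_def restrict_def space_PiM fun_eq_iff PiE_iff extensional_def)
    then show ?thesis unfolding SN_def by auto
  qed
  have YY: "{\<omega>\<in>space M. past_Y n \<omega> \<in> S3 \<and> future_Y n \<omega> \<in> S4} = YY -` SY \<inter> space M"
  proof -
    have "restrict (YY \<omega>) {1..n} = past_Y n \<omega>" "(\<lambda>k\<in>{1..}. YY \<omega> (n + k)) = future_Y n \<omega>"
      "YY \<omega> \<in> space mark_space" for \<omega>
      by (auto simp: YY_def past_Y_def future_Y_def restrict_def space_PiM fun_eq_iff PiE_iff extensional_def)
    then show ?thesis unfolding SY_def by auto
  qed
  let ?a = "{\<omega>\<in>space M. X0 \<omega> \<in> S0}" and ?b = "NN -` SN \<inter> space M" and ?c = "YY -` SY \<inter> space M"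
  have NY: "prob (?b \<inter> ?c) = prob ?b * prob ?c"
    unfolding NN_def YY_def by (rule indep_setD[OF N_indep_Y in_vimage_algebra[OF SN] in_vimage_algebra[OF SY]])
  have "prob (?a \<inter> ((\<lambda>\<omega>. (NN \<omega>, YY \<omega>)) -` (SN \<times> SY) \<inter> space M)) =
      prob ?a * prob ((\<lambda>\<omega>. (NN \<omega>, YY \<omega>)) -` (SN \<times> SY) \<inter> space M)"
  proof (rule indep_setD[OF X0_indep])
    have "?a = X0 -` S0 \<inter> space M" by auto
    then show "?a \<in> sets (vimage_algebra (space M) X0 borel)" using in_vimage_algebra[OF S(1)] by simp
    show "(\<lambda>\<omega>. (NN \<omega>, YY \<omega>)) -` (SN \<times> SY) \<inter> space M \<in> sets (vimage_algebra (space M)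
        (\<lambda>\<omega>. (\<lambda>t\<in>{0..}. N t \<omega>, \<lambda>k\<in>{1..}. Y k \<omega>)) (path_space \<Otimes>\<^sub>M mark_space))"
      unfolding NN_def YY_def by (intro in_vimage_algebra pair_measureI SN SY)
  qed
  moreover have "(\<lambda>\<omega>. (NN \<omega>, YY \<omega>)) -` (SN \<times> SY) \<inter> space M = ?b \<inter> ?c" by auto
  ultimately have "prob (?a \<inter> (?b \<inter> ?c)) = prob ?a * (prob ?b * prob ?c)" unfolding NY[symmetric] by simp
  moreover have "prob ?b = prob {\<omega>\<in>space M. past_N s \<omega> \<in> S1} * prob {\<omega>\<in>space M. future_N 0 \<omega> \<in> S2}"
  proof -
    have "?b = {\<omega>\<in>space M. past_N s \<omega> \<in> S1} \<inter> {\<omega>\<in>space M. future_N s \<omega> \<in> S2}" unfolding NN[symmetric] by auto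
    then show ?thesis using past_future_N[OF s S(2,3)] by simp
  qed
  moreover have "prob ?c = prob {\<omega>\<in>space M. past_Y n \<omega> \<in> S3} * prob {\<omega>\<in>space M. future_Y 0 \<omega> \<in> S4}"
  proof -
    have "?c = {\<omega>\<in>space M. past_Y n \<omega> \<in> S3} \<inter> {\<omega>\<in>space M. future_Y n \<omega> \<in> S4}" unfolding YY[symmetric] by auto
    then show ?thesis using past_future_Y[OF S(4,5)] by simp
  qed
  moreover have "?a \<inter> (?b \<inter> ?c) =
     {\<omega>\<in>space M. X0 \<omega> \<in> S0 \<and> past_N s \<omega> \<in> S1 \<and> past_Y n \<omega> \<in> S3} \<inter>
      {\<omega>\<in>space M. future_N s \<omega> \<in> S2 \<and> future_Y n \<omega> \<in> S4}"
    unfolding NN[symmetric] YY[symmetric] by auto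
  ultimately show ?thesis by (simp only: mult_ac)
qed

definition past_rectangles :: "real \<Rightarrow> nat \<Rightarrow> 'a set set" where
  "past_rectangles s n = {{\<omega>\<in>space M. X0 \<omega> \<in> S0 \<and> past_N s \<omega> \<in> S1 \<and> past_Y n \<omega> \<in> S3} | S0 S1 S3.
     S0 \<in> sets borel \<and> S1 \<in> sets (PiM {0..s} (\<lambda>_. count_space UNIV)) \<and> S3 \<in> sets (PiM {1..n} (\<lambda>_. borel))}"

text \<open>
  The information in the initial value, the counting path up to \<open>s\<close> and the first \<open>n\<close> marks.  The
  number of marks is deterministic here, which makes independence of the future marks
  \<open>Y (n + 1), Y (n + 2), \<dots>\<close> accessible.
\<close>

definition past_algebra :: "real \<Rightarrow> nat \<Rightarrow> 'a measure" where
  "past_algebra s n = sigma (space M) (past_rectangles s n)"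

lemma space_past_algebra [simp]: "space (past_algebra s n) = space M"
  unfolding past_algebra_def past_rectangles_def by (rule space_measure_of) auto

lemma sets_past_algebra: "sets (past_algebra s n) = sigma_sets (space M) (past_rectangles s n)"
  unfolding past_algebra_def past_rectangles_def by (rule sets_measure_of) auto

lemma past_rectangleI:
  assumes "S0 \<in> sets borel" "S1 \<in> sets (PiM {0..s} (\<lambda>_. count_space UNIV))" "S3 \<in> sets (PiM {1..n} (\<lambda>_. borel))"
  shows "{\<omega>\<in>space M. X0 \<omega> \<in> S0 \<and> past_N s \<omega> \<in> S1 \<and> past_Y n \<omega> \<in> S3} \<in> sets (past_algebra s n)"
  unfolding sets_past_algebra past_rectangles_def using assms by blast

lemma past_N_space: "past_N s \<omega> \<in> space (PiM {0..s} (\<lambda>_. count_space UNIV))"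
  by (auto simp: past_N_def space_PiM)

lemma past_Y_space: "past_Y n \<omega> \<in> space (PiM {1..n} (\<lambda>_. borel))"
  by (auto simp: past_Y_def space_PiM)

lemma X0_measurable_past: "X0 \<in> borel_measurable (past_algebra s n)"
proof (rule measurableI)
  fix B assume B: "B \<in> sets (borel :: (real^'d) measure)"
  have "X0 -` B \<inter> space (past_algebra s n) = {\<omega>\<in>space M. X0 \<omega> \<in> B \<and>
      past_N s \<omega> \<in> space (PiM {0..s} (\<lambda>_. count_space UNIV)) \<and> past_Y n \<omega> \<in> space (PiM {1..n} (\<lambda>_. borel))}"
    using past_N_space[of s] past_Y_space[of n] by auto
  also have "\<dots> \<in> sets (past_algebra s n)"
    by (rule past_rectangleI[OF B sets.top sets.top])
  finally show "X0 -` B \<inter> space (past_algebra s n) \<in> sets (past_algebra s n)" .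
qed simp

lemma N_measurable_past:
  assumes u: "0 \<le> u" "u \<le> s"
  shows "N u \<in> measurable (past_algebra s n) (count_space UNIV)"
proof (rule measurableI)
  fix B :: "nat set"
  let ?S = "{f \<in> space (PiM {0..s} (\<lambda>_. count_space UNIV)). f u \<in> B}"
  have "(\<lambda>f. f u) \<in> measurable (PiM {0..s} (\<lambda>_. count_space (UNIV :: nat set))) (count_space UNIV)"
    by (rule measurable_component_singleton) (use u in simp)
  from measurable_sets[OF this, of B] have S: "?S \<in> sets (PiM {0..s} (\<lambda>_. count_space UNIV))"
    by (simp add: vimage_def Int_def conj_commute)
  have "N u -` B \<inter> space (past_algebra s n) =
      {\<omega>\<in>space M. X0 \<omega> \<in> space borel \<and> past_N s \<omega> \<in> ?S \<and> past_Y n \<omega> \<in> space (PiM {1..n} (\<lambda>_. borel))}"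
    using past_N_space[of s] past_Y_space[of n] u by (auto simp: past_N_def)
  also have "\<dots> \<in> sets (past_algebra s n)"
    by (rule past_rectangleI[OF sets.top S sets.top])
  finally show "N u -` B \<inter> space (past_algebra s n) \<in> sets (past_algebra s n)" .
qed simp

lemma Y_measurable_past:
  assumes k: "1 \<le> k" "k \<le> n"
  shows "Y k \<in> borel_measurable (past_algebra s n)"
proof (rule measurableI)
  fix B assume B: "B \<in> sets (borel :: (real^'d) measure)"
  let ?S = "{f \<in> space (PiM {1..n} (\<lambda>_. borel)). f k \<in> B}"
  have "(\<lambda>f. f k) \<in> measurable (PiM {1..n} (\<lambda>_. borel :: (real^'d) measure)) borel"
    by (rule measurable_component_singleton) (use k in simp)
  from measurable_sets[OF this B] have S: "?S \<in> sets (PiM {1..n} (\<lambda>_. borel))"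
    by (simp add: vimage_def Int_def conj_commute)
  have "Y k -` B \<inter> space (past_algebra s n) =
      {\<omega>\<in>space M. X0 \<omega> \<in> space borel \<and> past_N s \<omega> \<in> space (PiM {0..s} (\<lambda>_. count_space UNIV)) \<and> past_Y n \<omega> \<in> ?S}"
    using past_N_space[of s] past_Y_space[of n] k by (auto simp: past_Y_def)
  also have "\<dots> \<in> sets (past_algebra s n)"
    by (rule past_rectangleI[OF sets.top sets.top S])
  finally show "Y k -` B \<inter> space (past_algebra s n) \<in> sets (past_algebra s n)" .
qed simp

lemma prob_past_algebra_future:
  assumes s: "0 \<le> s" and A: "A \<in> sets (past_algebra s n)"
    and S: "S2 \<in> sets path_space" "S4 \<in> sets mark_space"
  shows "prob (A \<inter> {\<omega>\<in>space M. future_N s \<omega> \<in> S2 \<and> future_Y n \<omega> \<in> S4}) =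
    prob A * (prob {\<omega>\<in>space M. future_N 0 \<omega> \<in> S2} * prob {\<omega>\<in>space M. future_Y 0 \<omega> \<in> S4})"
proof -
  let ?K1 = "PiM {0..s} (\<lambda>_. count_space (UNIV :: nat set))" and ?K3 = "PiM {1..n} (\<lambda>_. borel :: (real^'d) measure)"
  let ?B = "\<lambda>S2 S4. {\<omega>\<in>space M. future_N s \<omega> \<in> S2 \<and> future_Y n \<omega> \<in> S4}"
  have fN: "future_N t \<omega> \<in> space path_space" for t \<omega> by (auto simp: future_N_def space_PiM)
  have fY: "future_Y k \<omega> \<in> space mark_space" for k \<omega> by (auto simp: future_Y_def space_PiM)
  have pB: "prob (?B S2 S4) = prob {\<omega>\<in>space M. future_N 0 \<omega> \<in> S2} * prob {\<omega>\<in>space M. future_Y 0 \<omega> \<in> S4}"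
    using five_fold_independence[OF s sets.top sets.top S(1) sets.top S(2), of n] past_N_space[of s] past_Y_space[of n]
    by (simp add: prob_space Int_absorb1 subset_eq Int_def)
  have ind: "indep_set (sigma_sets (space M) (past_rectangles s n)) (sigma_sets (space M) {?B S2 S4})"
  proof (rule indep_set_sigma_sets)
    show "Int_stable (past_rectangles s n)"
    proof (rule Int_stableI)
      fix a b assume "a \<in> past_rectangles s n" "b \<in> past_rectangles s n"
      then obtain S0 S1 S3 T0 T1 T3 where ST: "S0 \<in> sets borel" "S1 \<in> sets ?K1" "S3 \<in> sets ?K3"
          "T0 \<in> sets borel" "T1 \<in> sets ?K1" "T3 \<in> sets ?K3"
        and ab: "a = {\<omega>\<in>space M. X0 \<omega> \<in> S0 \<and> past_N s \<omega> \<in> S1 \<and> past_Y n \<omega> \<in> S3}"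
          "b = {\<omega>\<in>space M. X0 \<omega> \<in> T0 \<and> past_N s \<omega> \<in> T1 \<and> past_Y n \<omega> \<in> T3}"
        unfolding past_rectangles_def by blast
      have "a \<inter> b = {\<omega>\<in>space M. X0 \<omega> \<in> S0 \<inter> T0 \<and> past_N s \<omega> \<in> S1 \<inter> T1 \<and> past_Y n \<omega> \<in> S3 \<inter> T3}"
        unfolding ab by auto
      then show "a \<inter> b \<in> past_rectangles s n"
        unfolding past_rectangles_def using ST by blast
    qed
    show "Int_stable {?B S2 S4}" by (rule Int_stableI) simp
    show "indep_set (past_rectangles s n) {?B S2 S4}"
    proof (rule indep_setI)
      have m: "{\<omega>\<in>space M. X0 \<omega> \<in> S0 \<and> past_N s \<omega> \<in> S1 \<and> past_Y n \<omega> \<in> S3} \<in> events"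
        if "S0 \<in> sets borel" "S1 \<in> sets ?K1" "S3 \<in> sets ?K3" for S0 S1 S3
      proof -
        have "{\<omega>\<in>space M. X0 \<omega> \<in> S0 \<and> past_N s \<omega> \<in> S1 \<and> past_Y n \<omega> \<in> S3} =
            (X0 -` S0 \<inter> space M) \<inter> (past_N s -` S1 \<inter> space M) \<inter> (past_Y n -` S3 \<inter> space M)" by auto
        then show ?thesis
          using measurable_sets[OF X0_measurable that(1)] measurable_sets[OF past_N_measurable that(2)]
            measurable_sets[OF past_Y_measurable that(3)] by simp
      qed
      show "past_rectangles s n \<subseteq> events" unfolding past_rectangles_def using m by blast
      have "?B S2 S4 = (future_N s -` S2 \<inter> space M) \<inter> (future_Y n -` S4 \<inter> space M)" by auto
      then show "{?B S2 S4} \<subseteq> events"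
        using measurable_sets[OF future_N_measurable[OF s] S(1)] measurable_sets[OF future_Y_measurable S(2)]
        by simp
      fix a b assume a: "a \<in> past_rectangles s n" and b: "b \<in> {?B S2 S4}"
      then obtain S0 S1 S3 where S013: "S0 \<in> sets borel" "S1 \<in> sets ?K1" "S3 \<in> sets ?K3"
        and a: "a = {\<omega>\<in>space M. X0 \<omega> \<in> S0 \<and> past_N s \<omega> \<in> S1 \<and> past_Y n \<omega> \<in> S3}"
        unfolding past_rectangles_def by blast
      note five = five_fold_independence[OF s S013(1,2) _ S013(3), of _ _]
      have "prob (a \<inter> ?B (space path_space) (space mark_space)) =
          (prob {\<omega>\<in>space M. X0 \<omega> \<in> S0} * prob {\<omega>\<in>space M. past_N s \<omega> \<in> S1} * prob {\<omega>\<in>space M. past_Y n \<omega> \<in> S3}) *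
          (prob {\<omega>\<in>space M. future_N 0 \<omega> \<in> space path_space} * prob {\<omega>\<in>space M. future_Y 0 \<omega> \<in> space mark_space})"
        unfolding a by (rule five[OF sets.top sets.top])
      moreover have "a \<inter> ?B (space path_space) (space mark_space) = a"
        using fN[of s] fY[of n] unfolding a by auto
      ultimately have "prob a =
          prob {\<omega>\<in>space M. X0 \<omega> \<in> S0} * prob {\<omega>\<in>space M. past_N s \<omega> \<in> S1} * prob {\<omega>\<in>space M. past_Y n \<omega> \<in> S3}"
        using fN[of 0] fY[of 0] by (simp add: prob_space)
      moreover have "prob (a \<inter> b) =
          (prob {\<omega>\<in>space M. X0 \<omega> \<in> S0} * prob {\<omega>\<in>space M. past_N s \<omega> \<in> S1} * prob {\<omega>\<in>space M. past_Y n \<omega> \<in> S3}) *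
          (prob {\<omega>\<in>space M. future_N 0 \<omega> \<in> S2} * prob {\<omega>\<in>space M. future_Y 0 \<omega> \<in> S4})"
        using five[OF S] b unfolding a by simp
      ultimately show "prob (a \<inter> b) = prob a * prob b" using pB b by simp
    qed
  qed
  have "prob (A \<inter> ?B S2 S4) = prob A * prob (?B S2 S4)"
    by (rule indep_setD[OF ind]) (use A in \<open>auto simp: sets_past_algebra\<close>)
  then show ?thesis unfolding pB .
qed

text \<open>
  On the event of exactly \<open>n\<close> jumps, the observed process up to \<open>s\<close> involves the first \<open>n\<close> marks only, so
  the random number of past marks may be replaced by the number \<open>n\<close>.
\<close>

lemma F_Int_N_in_past:
  assumes s: "0 \<le> s" and A: "A \<in> sets (F (ennreal s))"
  shows "A \<inter> {\<omega>\<in>space M. N s \<omega> = n} \<in> sets (past_algebra s n)"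
proof -
  let ?P = "past_algebra s n"
  have Nn: "{\<omega>\<in>space M. N s \<omega> = n} \<in> sets ?P"
  proof -
    have "{\<omega>\<in>space M. N s \<omega> = n} = N s -` {n} \<inter> space ?P" by auto
    then show ?thesis using measurable_sets[OF N_measurable_past[OF s order_refl], of "{n}" n] by simp
  qed
  show ?thesis
    using A unfolding sets_F
  proof induction
    case (Basic a)
    then obtain u B where u: "0 \<le> u" "u \<le> s" and B: "B \<in> sets borel" and a: "a = X u -` B \<inter> space M"
      using s by (auto simp: ennreal_le_iff)
    let ?Z = "\<lambda>\<omega>. X0 \<omega> + (\<Sum>k=1..min (N u \<omega>) n. Y k \<omega>)"
    have Z: "?Z \<in> borel_measurable ?P"
    proof (rule measurable_compose_countable[where f="\<lambda>j \<omega>. X0 \<omega> + (\<Sum>k=1..min j n. Y k \<omega>)" and g="N u"])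
      show "(\<lambda>\<omega>. X0 \<omega> + (\<Sum>k=1..min j n. Y k \<omega>)) \<in> borel_measurable ?P" for j
        by (intro borel_measurable_add X0_measurable_past borel_measurable_sum Y_measurable_past) auto
      show "N u \<in> measurable ?P (count_space UNIV)" by (rule N_measurable_past[OF u])
    qed
    have "a \<inter> {\<omega>\<in>space M. N s \<omega> = n} = (?Z -` B \<inter> space ?P) \<inter> {\<omega>\<in>space M. N s \<omega> = n}"
      unfolding a using N_mono[OF _ u] by (auto simp: X_def min_def)
    then show ?case using measurable_sets[OF Z B] Nn by simp
  next
    case Empty then show ?case by simp
  next
    case (Compl a)
    have "(space M - a) \<inter> {\<omega>\<in>space M. N s \<omega> = n} =
        {\<omega>\<in>space M. N s \<omega> = n} - (a \<inter> {\<omega>\<in>space M. N s \<omega> = n})" by auto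
    then show ?case using Compl Nn by simp
  next
    case (Union a)
    have "(\<Union>i. a i) \<inter> {\<omega>\<in>space M. N s \<omega> = n} = (\<Union>i. a i \<inter> {\<omega>\<in>space M. N s \<omega> = n})" by auto
    also have "\<dots> \<in> sets ?P" by (rule sets.countable_UN'') (use Union in auto)
    finally show ?case .
  qed
qed

definition future :: "real \<Rightarrow> 'a \<Rightarrow> (real \<Rightarrow> nat) \<times> (nat \<Rightarrow> real ^ 'd)" where
  "future s \<omega> = (future_N s \<omega>, future_Y (N s \<omega>) \<omega>)"

abbreviation "future_space \<equiv> path_space \<Otimes>\<^sub>M mark_space"

lemma future_measurable: "0 \<le> s \<Longrightarrow> future s \<in> measurable M future_space"
  unfolding future_def[abs_def]
proof (rule measurable_Pair)
  assume s: "0 \<le> s"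
  show "future_N s \<in> measurable M path_space" by (rule future_N_measurable[OF s])
  show "(\<lambda>\<omega>. future_Y (N s \<omega>) \<omega>) \<in> measurable M mark_space"
    by (rule measurable_compose_countable[where f="future_Y" and g="N s"])
      (rule future_Y_measurable, rule N_measurable[OF s])
qed

lemma prob_future_0:
  assumes S: "S2 \<in> sets path_space" "S4 \<in> sets mark_space"
  shows "prob {\<omega>\<in>space M. future 0 \<omega> \<in> S2 \<times> S4} =
    prob {\<omega>\<in>space M. future_N 0 \<omega> \<in> S2} * prob {\<omega>\<in>space M. future_Y 0 \<omega> \<in> S4}"
proof -
  have "{\<omega>\<in>space M. future 0 \<omega> \<in> S2 \<times> S4} = space M \<inter> {\<omega>\<in>space M. future_N 0 \<omega> \<in> S2 \<and> future_Y 0 \<omega> \<in> S4}"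
    using N_0 by (auto simp: future_def)
  moreover have "space M \<in> sets (past_algebra 0 0)" using sets.top[of "past_algebra 0 0"] by simp
  ultimately show ?thesis
    using prob_past_algebra_future[OF order_refl _ S, of "space M" 0] by (simp add: prob_space)
qed

text \<open>
  The future at time \<open>s\<close> starts after a random number of marks.  Decomposing by that number reduces
  to the independence for a deterministic one, and the common law of the future does not depend on it.
\<close>

lemma prob_F_future:
  assumes s: "0 \<le> s" and A: "A \<in> sets (F (ennreal s))" and B: "B \<in> sets future_space"
  shows "prob (A \<inter> {\<omega>\<in>space M. future s \<omega> \<in> B}) = prob A * prob {\<omega>\<in>space M. future 0 \<omega> \<in> B}"
proof (rule prob_pair_eqI[OF future_measurable[OF s] future_measurable[OF order_refl] _ _ _ B])
  show AM: "A \<in> events" using A sets_F_subset by blast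
  show "0 \<le> prob A" by simp
  fix E1 E2 assume E: "E1 \<in> sets path_space" "E2 \<in> sets mark_space"
  let ?q = "prob {\<omega>\<in>space M. future 0 \<omega> \<in> E1 \<times> E2}"
  have Nn: "{\<omega>\<in>space M. N s \<omega> = n} \<in> events" for n
    using measurable_sets[OF N_measurable[OF s], of "{n}"] by (simp add: vimage_def Int_def conj_commute)
  have C: "{\<omega>\<in>space M. future s \<omega> \<in> E1 \<times> E2} \<in> events"
  proof -
    have "E1 \<times> E2 \<in> sets future_space" using E by (rule pair_measureI)
    from measurable_sets[OF future_measurable[OF s] this] show ?thesis
      by (simp add: vimage_def Int_def conj_commute)
  qed
  \<comment> \<open>On \<open>N s = n\<close> the future marks are those with index above \<open>n\<close>.\<close>
  have eq: "prob (A \<inter> {\<omega>\<in>space M. future s \<omega> \<in> E1 \<times> E2} \<inter> {\<omega>\<in>space M. N s \<omega> = n}) =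
      prob (A \<inter> {\<omega>\<in>space M. N s \<omega> = n}) * ?q" for n
  proof -
    have "A \<inter> {\<omega>\<in>space M. future s \<omega> \<in> E1 \<times> E2} \<inter> {\<omega>\<in>space M. N s \<omega> = n} =
        (A \<inter> {\<omega>\<in>space M. N s \<omega> = n}) \<inter> {\<omega>\<in>space M. future_N s \<omega> \<in> E1 \<and> future_Y n \<omega> \<in> E2}"
      by (auto simp: future_def)
    then show ?thesis
      using prob_past_algebra_future[OF s F_Int_N_in_past[OF s A] E, of n] prob_future_0[OF E] by simp
  qed
  have sums: "(\<lambda>n. prob (D \<inter> {\<omega>\<in>space M. N s \<omega> = n})) sums prob D" if D: "D \<in> events" for D
  proof -
    have "(\<lambda>n. prob (D \<inter> {\<omega>\<in>space M. N s \<omega> = n})) sums prob (\<Union>n. D \<inter> {\<omega>\<in>space M. N s \<omega> = n})"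
      by (rule finite_measure_UNION) (use D Nn in \<open>auto simp: disjoint_family_on_def\<close>)
    moreover have "(\<Union>n. D \<inter> {\<omega>\<in>space M. N s \<omega> = n}) = D" using sets.sets_into_space[OF D] by auto
    ultimately show ?thesis by simp
  qed
  have "(\<lambda>n. prob (A \<inter> {\<omega>\<in>space M. N s \<omega> = n}) * ?q) sums (prob A * ?q)"
    by (rule sums_mult2[OF sums[OF AM]])
  moreover have "(\<lambda>n. prob (A \<inter> {\<omega>\<in>space M. N s \<omega> = n}) * ?q) sums
      prob (A \<inter> {\<omega>\<in>space M. future s \<omega> \<in> E1 \<times> E2})"
    using sums[OF sets.Int[OF AM C]] unfolding eq .
  ultimately show "prob (A \<inter> {\<omega>\<in>space M. future s \<omega> \<in> E1 \<times> E2}) = prob A * ?q"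
    by (rule sums_unique2[symmetric])
qed

text \<open>
  Conditioning on the present: the joint law of a quantity known at time \<open>s\<close> and the future is a product
  measure, and Fubini's theorem evaluates the integral.
\<close>

lemma nn_integral_F_future:
  fixes Z :: "'a \<Rightarrow> real \<times> real"
  assumes s: "0 \<le> s" and A: "A \<in> sets (F (ennreal s))"
    and Z: "Z \<in> borel_measurable (F (ennreal s))"
    and H: "H \<in> borel_measurable (borel \<Otimes>\<^sub>M future_space)"
  shows "(\<integral>\<^sup>+\<omega>. indicator A \<omega> * H (Z \<omega>, future s \<omega>) \<partial>M) =
    (\<integral>\<^sup>+\<omega>. indicator A \<omega> * (\<integral>\<^sup>+\<omega>'. H (Z \<omega>, future 0 \<omega>') \<partial>M) \<partial>M)"
proof -
  have AM [measurable]: "A \<in> events" using A sets_F_subset by blast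
  have ZM: "Z \<in> borel_measurable M" using Z by (rule measurable_F_imp_M)
  let ?K = "borel \<Otimes>\<^sub>M future_space"
  define MA where "MA = density M (indicator A)"
  have ind: "indicator A \<in> borel_measurable M" by (rule borel_measurable_indicator[OF AM])
  have sets_MA: "sets MA = sets M" unfolding MA_def by simp
  have MA: "f \<in> measurable M L \<Longrightarrow> f \<in> measurable MA L" for f and L :: "'z measure"
    using measurable_cong_sets[OF sets_MA refl, of L] by blast
  define P where "P = distr MA ?K (\<lambda>\<omega>. (Z \<omega>, future s \<omega>))"
  define Q1 where "Q1 = distr MA borel Z"
  define Q2 where "Q2 = distr M future_space (future 0)"
  have Zf: "(\<lambda>\<omega>. (Z \<omega>, future s \<omega>)) \<in> measurable M ?K"
    by (rule measurable_Pair[OF ZM future_measurable[OF s]])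
  interpret Q2: prob_space Q2
    unfolding Q2_def by (rule prob_space_distr[OF future_measurable[OF order_refl]])
  have Q1fin: "finite_measure Q1"
  proof (rule finite_measureI)
    have "emeasure Q1 (space Q1) = ennreal (prob (A \<inter> {\<omega>\<in>space M. Z \<omega> \<in> space borel}))"
      unfolding Q1_def MA_def space_distr by (rule prob_distr_density_indicator[OF AM ZM sets.top])
    then show "emeasure Q1 (space Q1) \<noteq> \<infinity>" by simp
  qed
  have "Q1 \<Otimes>\<^sub>M Q2 = P"
  proof (rule pair_measure_eqI)
    show "sigma_finite_measure Q1" by (rule finite_measure.axioms(1)[OF Q1fin])
    show "sigma_finite_measure Q2" by unfold_locales
    show "sets (Q1 \<Otimes>\<^sub>M Q2) = sets P"
      unfolding P_def Q1_def Q2_def sets_distr by (rule sets_pair_measure_cong) simp_all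
    fix B C assume "B \<in> sets Q1" "C \<in> sets Q2"
    then have B: "B \<in> sets borel" and C: "C \<in> sets future_space" by (auto simp: Q1_def Q2_def)
    have AB: "A \<inter> {\<omega>\<in>space M. Z \<omega> \<in> B} \<in> sets (F (ennreal s))"
    proof -
      have "A \<inter> {\<omega>\<in>space M. Z \<omega> \<in> B} = A \<inter> (Z -` B \<inter> space (F (ennreal s)))" by auto
      then show ?thesis using A measurable_sets[OF Z B] by simp
    qed
    have BC: "B \<times> C \<in> sets ?K" using B C by (rule pair_measureI)
    have "emeasure P (B \<times> C) = ennreal (prob (A \<inter> {\<omega>\<in>space M. (Z \<omega>, future s \<omega>) \<in> B \<times> C}))"
      unfolding P_def MA_def by (rule prob_distr_density_indicator[OF AM Zf BC])
    also have "A \<inter> {\<omega>\<in>space M. (Z \<omega>, future s \<omega>) \<in> B \<times> C} =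
        (A \<inter> {\<omega>\<in>space M. Z \<omega> \<in> B}) \<inter> {\<omega>\<in>space M. future s \<omega> \<in> C}" by auto
    also have "prob \<dots> = prob (A \<inter> {\<omega>\<in>space M. Z \<omega> \<in> B}) * prob {\<omega>\<in>space M. future 0 \<omega> \<in> C}"
      by (rule prob_F_future[OF s AB C])
    also have "ennreal \<dots> = emeasure Q1 B * emeasure Q2 C"
    proof -
      have "emeasure Q2 C = ennreal (prob {\<omega>\<in>space M. future 0 \<omega> \<in> C})"
        unfolding Q2_def emeasure_distr[OF future_measurable[OF order_refl] C] emeasure_eq_measure
        by (simp add: vimage_def Int_def conj_commute)
      then show ?thesis
        unfolding Q1_def MA_def prob_distr_density_indicator[OF AM ZM B] by (simp add: ennreal_mult)
    qed
    finally show "emeasure Q1 B * emeasure Q2 C = emeasure P (B \<times> C)" by simp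
  qed
  note PQ = this
  have "(\<integral>\<^sup>+\<omega>. indicator A \<omega> * H (Z \<omega>, future s \<omega>) \<partial>M) = (\<integral>\<^sup>+\<omega>. H (Z \<omega>, future s \<omega>) \<partial>MA)"
    unfolding MA_def by (rule nn_integral_density[symmetric, OF ind measurable_compose[OF Zf H]])
  also have "\<dots> = (\<integral>\<^sup>+x. H x \<partial>P)"
    unfolding P_def by (rule nn_integral_distr[symmetric, OF MA[OF Zf]])
      (simp only: measurable_distr_eq1 H)
  also have "\<dots> = (\<integral>\<^sup>+x. H x \<partial>(Q1 \<Otimes>\<^sub>M Q2))" unfolding PQ ..
  also have "\<dots> = (\<integral>\<^sup>+z. (\<integral>\<^sup>+y. H (z, y) \<partial>Q2) \<partial>Q1)"
  proof (rule Q2.nn_integral_fst[symmetric])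
    have "sets (Q1 \<Otimes>\<^sub>M Q2) = sets ?K"
      unfolding Q1_def Q2_def by (rule sets_pair_measure_cong) simp_all
    then show "H \<in> borel_measurable (Q1 \<Otimes>\<^sub>M Q2)" using H measurable_cong_sets[OF _ refl] by blast
  qed
  also have "\<dots> = (\<integral>\<^sup>+z. (\<integral>\<^sup>+\<omega>'. H (z, future 0 \<omega>') \<partial>M) \<partial>Q1)"
    unfolding Q2_def
  proof (rule nn_integral_cong)
    fix z
    have "(\<lambda>y. H (z, y)) \<in> borel_measurable future_space"
      by (rule measurable_compose[OF measurable_Pair1' H]) simp
    then show "(\<integral>\<^sup>+y. H (z, y) \<partial>distr M future_space (future 0)) = (\<integral>\<^sup>+\<omega>'. H (z, future 0 \<omega>') \<partial>M)"
      by (intro nn_integral_distr future_measurable) (simp_all only: measurable_distr_eq1 order_refl)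
  qed
  also have "\<dots> = (\<integral>\<^sup>+\<omega>. (\<integral>\<^sup>+\<omega>'. H (Z \<omega>, future 0 \<omega>') \<partial>M) \<partial>MA)"
    unfolding Q1_def
  proof (rule nn_integral_distr)
    show "Z \<in> measurable MA borel" by (rule MA[OF ZM])
    have "(\<lambda>p. H (fst p, future 0 (snd p))) \<in> borel_measurable (borel \<Otimes>\<^sub>M M)"
      by (rule measurable_compose[OF measurable_Pair[OF measurable_fst
          measurable_compose[OF measurable_snd future_measurable[OF order_refl]]] H])
    from borel_measurable_nn_integral_fst[OF this]
    show "(\<lambda>z. \<integral>\<^sup>+\<omega>'. H (z, future 0 \<omega>') \<partial>M) \<in> borel_measurable (distr MA borel Z)" by simp
  qed
  also have "\<dots> = (\<integral>\<^sup>+\<omega>. indicator A \<omega> * (\<integral>\<^sup>+\<omega>'. H (Z \<omega>, future 0 \<omega>') \<partial>M) \<partial>M)"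
    unfolding MA_def
  proof (rule nn_integral_density)
    have "(\<lambda>p. H (Z (fst p), future 0 (snd p))) \<in> borel_measurable (M \<Otimes>\<^sub>M M)"
      by (rule measurable_compose[OF measurable_Pair[OF measurable_compose[OF measurable_fst ZM]
          measurable_compose[OF measurable_snd future_measurable[OF order_refl]]] H])
    from borel_measurable_nn_integral_fst[OF this]
    show "(\<lambda>\<omega>. \<integral>\<^sup>+\<omega>'. H (Z \<omega>, future 0 \<omega>') \<partial>M) \<in> borel_measurable M" by simp
  qed simp
  finally show ?thesis .
qed

section \<open>The shifted cost and the operator of running for a fixed time\<close>

text \<open>
  The shifted cost of stopping immediately.
\<close>

definition stop_cost :: ennreal where "stop_cost = ennreal (1 / c)"

definition load :: "real \<times> real \<Rightarrow> ennreal" where "load z = ennreal (fst z + snd z)"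

text \<open>
  The discount factor, with value 0 at infinity.
\<close>

definition disc :: "ennreal \<Rightarrow> ennreal" where
  "disc t = (if t = \<infinity> then 0 else ennreal (exp (- lam * enn2real t)))"

text \<open>
  The same accumulated cost as in \<open>run\<close>, as a function of jump times and marks.
\<close>

definition path_run :: "(nat \<Rightarrow> real) \<Rightarrow> (nat \<Rightarrow> real) \<Rightarrow> real \<times> real \<Rightarrow> ennreal \<Rightarrow> ennreal" where
  "path_run T R z \<tau> = (\<integral>\<^sup>+t. indicator {t. 0 \<le> t \<and> ennreal t < \<tau>} t *
     (ennreal (exp (- lam * t)) * load (evo T R z t)) \<partial>lborel)"

text \<open>
  The discounted load accumulated before \<open>\<tau>\<close>.  The inequality \<open>t < \<tau>\<close> is strict, so that the integrand
  is left-continuous in \<open>\<tau>\<close> and monotone convergence applies to increasing sequences of times,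
  including those that tend to infinity.
\<close>

definition run :: "real \<times> real \<Rightarrow> 'a \<Rightarrow> ennreal \<Rightarrow> ennreal" where
  "run z \<omega> \<tau> = (\<integral>\<^sup>+t. indicator {t. 0 \<le> t \<and> ennreal t < \<tau>} t *
     (ennreal (exp (- lam * t)) * load (\<Phi> z t \<omega>)) \<partial>lborel)"

lemma run_eq_path_run:
  assumes \<omega>: "\<omega> \<in> space M"
  shows "run z \<omega> \<tau> = path_run (\<lambda>k. \<sigma> k \<omega>) (\<lambda>k. r (Y k \<omega>)) z \<tau>"
  unfolding run_def path_run_def
  by (rule nn_integral_cong) (simp add: indicator_def \<Phi>_eq_evo[OF \<omega>])

lemma disc_ennreal: "0 \<le> t \<Longrightarrow> disc (ennreal t) = ennreal (exp (- lam * t))"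
  by (simp add: disc_def)

lemma disc_0 [simp]: "disc 0 = 1"
  by (simp add: disc_def)

lemma disc_le_1: "disc t \<le> 1"
proof (cases t)
  case (real u)
  then have "exp (- lam * u) \<le> 1" using lam_pos by simp
  then show ?thesis using real by (simp add: disc_ennreal del: ennreal_1 flip: ennreal_1)
qed (simp add: disc_def)

lemma disc_antimono: "s \<le> t \<Longrightarrow> disc t \<le> disc s"
proof (cases t)
  case (real u)
  assume "s \<le> t"
  then obtain v where v: "s = ennreal v" "0 \<le> v" using real by (cases s) (auto simp: top_unique)
  then have "v \<le> u" using \<open>s \<le> t\<close> real by (simp add: ennreal_le_iff)
  then show ?thesis using real v lam_pos by (simp add: disc_ennreal ennreal_leI)
qed (simp add: disc_def)

lemma disc_add: "0 \<le> s \<Longrightarrow> 0 \<le> t \<Longrightarrow> disc (ennreal (s + t)) = disc (ennreal s) * disc (ennreal t)"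
  by (subst (1 2 3) disc_ennreal) (simp_all add: ennreal_mult[symmetric] exp_add[symmetric] algebra_simps)

lemma disc_measurable [measurable]: "disc \<in> borel_measurable borel"
  unfolding disc_def[abs_def] by measurable

lemma measurable_load [measurable (raw)]:
  assumes "f \<in> borel_measurable K"
  shows "(\<lambda>x. load (f x)) \<in> borel_measurable K"
proof -
  have [measurable]: "f \<in> measurable K (borel \<Otimes>\<^sub>M borel)" using assms by (simp only: borel_prod)
  show ?thesis unfolding load_def by measurable
qed

lemma measurable_evo:
  assumes T: "\<And>n. (\<lambda>\<omega>. T \<omega> n) \<in> borel_measurable K"
    and R: "\<And>n. (\<lambda>\<omega>. R \<omega> (Suc n)) \<in> borel_measurable K"
    and z: "z \<in> borel_measurable K" and t: "t \<in> borel_measurable K"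
  shows "(\<lambda>\<omega>. evo (T \<omega>) (R \<omega>) (z \<omega>) (t \<omega>)) \<in> borel_measurable K"
proof -
  have z': "z \<in> measurable K (borel \<Otimes>\<^sub>M borel)" using z by (simp only: borel_prod)
  show ?thesis
    unfolding evo_def
    by (rule borel_measurable_Pair)
      (rule measurable_pdmp, rule T, rule R, rule measurable_compose[OF z' measurable_fst], rule t,
       rule measurable_pdmp, rule T, rule R, rule measurable_compose[OF z' measurable_snd], rule t)
qed

lemma path_jumps_measurable: "(\<lambda>f. path_jumps f k) \<in> borel_measurable path_space"
proof (cases "k = 0")
  case True then show ?thesis by (simp add: path_jumps_def)
next
  case False
  have "(\<lambda>f. INF q\<in>\<rat> \<inter> {0..}. if k \<le> f q then ereal q else \<infinity>) \<in> borel_measurable path_space"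
  proof (rule borel_measurable_INF)
    show "countable (\<rat> \<inter> {0::real..})" by (simp add: countable_rat countable_Int1)
    fix q :: real assume q: "q \<in> \<rat> \<inter> {0..}"
    have "(\<lambda>f. f q) \<in> measurable path_space (count_space UNIV)"
      by (rule measurable_component_singleton) (use q in simp)
    moreover have "(\<lambda>n. if k \<le> n then ereal q else \<infinity>) \<in> measurable (count_space UNIV) borel" by simp
    ultimately show "(\<lambda>f. if k \<le> f q then ereal q else \<infinity>) \<in> borel_measurable path_space"
      by (rule measurable_compose)
  qed
  from measurable_compose[OF this borel_measurable_real_of_ereal[OF measurable_ident]]
  show ?thesis using False by (simp add: path_jumps_def)
qed

lemma jump_time_measurable: "\<sigma> k \<in> borel_measurable M"
proof (rule borel_measurableI_le)
  fix u
  show "{\<omega> \<in> space M. \<sigma> k \<omega> \<le> u} \<in> events"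
  proof (cases "0 \<le> u")
    case True
    then have "{\<omega> \<in> space M. \<sigma> k \<omega> \<le> u} = {\<omega>\<in>space M. k \<le> N u \<omega>}" using le_N_iff by auto
    then show ?thesis using le_N_event_F[OF True order_refl] sets_F_subset by auto
  next
    case False
    then have "\<not> \<sigma> k \<omega> \<le> u" if "\<omega> \<in> space M" for \<omega> using jump_time_nonneg[OF that, of k] by simp
    then have "{\<omega> \<in> space M. \<sigma> k \<omega> \<le> u} = {}" by blast
    then show ?thesis by (simp only: sets.empty_sets)
  qed
qed

lemma path_evo_measurable_M:
  assumes z: "z \<in> borel_measurable K" and t: "t \<in> borel_measurable K" and w: "w \<in> measurable K M"
  shows "(\<lambda>x. evo (\<lambda>k. \<sigma> k (w x)) (\<lambda>k. r (Y k (w x))) (z x) (t x)) \<in> borel_measurable K"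
proof (rule measurable_evo[OF _ _ z t])
  show "(\<lambda>x. \<sigma> n (w x)) \<in> borel_measurable K" for n
    by (rule measurable_compose[OF w jump_time_measurable])
  show "(\<lambda>x. r (Y (Suc n) (w x))) \<in> borel_measurable K" for n
    by (rule measurable_compose[OF measurable_compose[OF w Y_measurable] r_measurable]) simp
qed

lemma path_evo_measurable_future:
  assumes z: "z \<in> borel_measurable K" and t: "t \<in> borel_measurable K" and w: "w \<in> measurable K future_space"
  shows "(\<lambda>x. evo (path_jumps (fst (w x))) (\<lambda>k. r (snd (w x) k)) (z x) (t x)) \<in> borel_measurable K"
proof (rule measurable_evo[OF _ _ z t])
  show "(\<lambda>x. path_jumps (fst (w x)) n) \<in> borel_measurable K" for n
    by (rule measurable_compose[OF measurable_compose[OF w measurable_fst] path_jumps_measurable])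
  show "(\<lambda>x. r (snd (w x) (Suc n))) \<in> borel_measurable K" for n
    by (rule measurable_compose[OF measurable_compose[OF measurable_compose[OF w measurable_snd]
        measurable_component_singleton] r_measurable]) simp
qed

lemma path_integrand_measurable:
  assumes [measurable]: "t \<in> borel_measurable K" "\<tau> \<in> borel_measurable K" and e [measurable]: "e \<in> borel_measurable K"
  shows "(\<lambda>p. indicator {t. 0 \<le> t \<and> ennreal t < \<tau> p} (t p) * (ennreal (exp (- lam * t p)) * load (e p)))
    \<in> borel_measurable K"
proof -
  have "(\<lambda>p. (if 0 \<le> t p \<and> ennreal (t p) < \<tau> p then 1 else 0) * (ennreal (exp (- lam * t p)) * load (e p)))
    \<in> borel_measurable K" by measurable
  then show ?thesis by (simp add: indicator_def)
qed

lemma measurable_snd_lborel: "snd \<in> borel_measurable (K \<Otimes>\<^sub>M lborel)"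
  using measurable_snd[of K lborel] measurable_cong_sets[OF refl sets_lborel, of "K \<Otimes>\<^sub>M lborel"] by blast

lemma run_integrand_measurable:
  assumes \<tau>: "\<tau> \<in> borel_measurable M"
  shows "(\<lambda>p. indicator {t. 0 \<le> t \<and> ennreal t < \<tau> (fst p)} (snd p) *
     (ennreal (exp (- lam * snd p)) * load (evo (\<lambda>k. \<sigma> k (fst p)) (\<lambda>k. r (Y k (fst p))) z (snd p))))
     \<in> borel_measurable (M \<Otimes>\<^sub>M lborel)"
  by (intro path_integrand_measurable path_evo_measurable_M measurable_compose[OF measurable_fst \<tau>]
      measurable_snd_lborel borel_measurable_const measurable_fst)

lemma run_measurable:
  assumes \<tau>: "\<tau> \<in> borel_measurable M"
  shows "(\<lambda>\<omega>. run z \<omega> (\<tau> \<omega>)) \<in> borel_measurable M"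
proof -
  from lborel.borel_measurable_nn_integral_fst[OF run_integrand_measurable[OF \<tau>, of z]]
  have "(\<lambda>\<omega>. path_run (\<lambda>k. \<sigma> k \<omega>) (\<lambda>k. r (Y k \<omega>)) z (\<tau> \<omega>)) \<in> borel_measurable M"
    by (simp add: path_run_def)
  then show ?thesis
    by (rule measurable_cong[THEN iffD1, rotated]) (simp add: run_eq_path_run)
qed

lemma \<Phi>_measurable: "0 \<le> s \<Longrightarrow> \<Phi> z s \<in> borel_measurable M"
  by (rule measurable_F_imp_M[OF \<Phi>_measurable_F])

lemma \<Phi>_time_measurable:
  assumes \<tau>: "\<tau> \<in> borel_measurable M" and pos: "\<And>\<omega>. \<omega> \<in> space M \<Longrightarrow> 0 \<le> \<tau> \<omega>"
  shows "(\<lambda>\<omega>. \<Phi> z (\<tau> \<omega>) \<omega>) \<in> borel_measurable M"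
proof (rule measurable_cong[THEN iffD1])
  show "(\<lambda>\<omega>. evo (\<lambda>k. \<sigma> k \<omega>) (\<lambda>k. r (Y k \<omega>)) z (\<tau> \<omega>)) \<in> borel_measurable M"
    by (rule path_evo_measurable_M) (simp_all add: \<tau>)
qed (simp add: \<Phi>_eq_evo pos)

lemma run_mono: "\<sigma>1 \<le> \<sigma>2 \<Longrightarrow> run z \<omega> \<sigma>1 \<le> run z \<omega> \<sigma>2"
  unfolding run_def by (rule nn_integral_mono) (auto simp: indicator_def dest: less_le_trans)

lemma run_0 [simp]: "run z \<omega> 0 = 0"
  unfolding run_def by simp

lemma run_restart:
  assumes \<omega>: "\<omega> \<in> space M" and s: "0 \<le> s" and h: "0 \<le> h"
  shows "run z \<omega> (ennreal (s + h)) = run z \<omega> (ennreal s) +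
    disc (ennreal s) * path_run (path_jumps (fst (future s \<omega>))) (\<lambda>k. r (snd (future s \<omega>) k)) (\<Phi> z s \<omega>) (ennreal h)"
proof -
  define G where "G t = ennreal (exp (- lam * t)) * load (evo (\<lambda>k. \<sigma> k \<omega>) (\<lambda>k. r (Y k \<omega>)) z t)" for t
  have G: "G \<in> borel_measurable borel"
  proof -
    have "(\<lambda>t. evo (\<lambda>k. \<sigma> k \<omega>) (\<lambda>k. r (Y k \<omega>)) z t) \<in> borel_measurable borel"
      by (rule measurable_evo) simp_all
    from measurable_load[OF this] show ?thesis unfolding G_def by measurable
  qed
  have run_G: "run z \<omega> (ennreal t) = (\<integral>\<^sup>+u. indicator {0..<t} u * G u \<partial>lborel)" if "0 \<le> t" for t
    unfolding run_eq_path_run[OF \<omega>] path_run_def G_def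
    by (rule nn_integral_cong) (use that in \<open>auto simp: indicator_def ennreal_less_iff\<close>)
  have "run z \<omega> (ennreal (s + h)) = (\<integral>\<^sup>+u. indicator {0..<s} u * G u + indicator {s..<s+h} u * G u \<partial>lborel)"
    unfolding run_G[OF add_nonneg_nonneg[OF s h]]
    by (rule nn_integral_cong) (use s h in \<open>auto simp: indicator_def\<close>)
  also have "\<dots> = run z \<omega> (ennreal s) + (\<integral>\<^sup>+u. indicator {s..<s+h} u * G u \<partial>lborel)"
    unfolding run_G[OF s] by (rule nn_integral_add) (use G in auto)
  also have "(\<integral>\<^sup>+u. indicator {s..<s+h} u * G u \<partial>lborel) =
      (\<integral>\<^sup>+v. indicator {s..<s+h} (s + v) * G (s + v) \<partial>lborel)"
    using nn_integral_real_affine[of "\<lambda>u. indicator {s..<s+h} u * G u" 1 s] G by simp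
  also have "\<dots> = (\<integral>\<^sup>+v. disc (ennreal s) * (indicator {t. 0 \<le> t \<and> ennreal t < ennreal h} v *
     (ennreal (exp (- lam * v)) * load (evo (path_jumps (fst (future s \<omega>))) (\<lambda>k. r (snd (future s \<omega>) k)) (\<Phi> z s \<omega>) v))) \<partial>lborel)"
  proof (rule nn_integral_cong)
    fix v :: real
    show "indicator {s..<s+h} (s + v) * G (s + v) =
      disc (ennreal s) * (indicator {t. 0 \<le> t \<and> ennreal t < ennreal h} v *
     (ennreal (exp (- lam * v)) * load (evo (path_jumps (fst (future s \<omega>))) (\<lambda>k. r (snd (future s \<omega>) k)) (\<Phi> z s \<omega>) v)))"
    proof (cases "0 \<le> v \<and> v < h")
      case True
      then have v: "0 \<le> v" "v < h" by auto
      have "evo (\<lambda>k. \<sigma> k \<omega>) (\<lambda>k. r (Y k \<omega>)) z (s + v) =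
          evo (path_jumps (fst (future s \<omega>))) (\<lambda>k. r (snd (future s \<omega>) k)) (\<Phi> z s \<omega>) v"
        using \<Phi>_restart[OF \<omega> s v(1), of z] \<Phi>_eq_evo[OF \<omega> add_nonneg_nonneg[OF s v(1)], of z]
        by (simp add: future_def)
      moreover have "ennreal (exp (- lam * (s + v))) = disc (ennreal s) * ennreal (exp (- lam * v))"
        unfolding disc_ennreal[OF s] by (simp add: ennreal_mult[symmetric] exp_add[symmetric] algebra_simps)
      ultimately show ?thesis using v unfolding G_def by (simp add: ennreal_less_iff mult.assoc)
    next
      case False
      then show ?thesis by (auto simp: indicator_def ennreal_less_iff)
    qed
  qed
  also have "\<dots> = disc (ennreal s) * path_run (path_jumps (fst (future s \<omega>))) (\<lambda>k. r (snd (future s \<omega>) k)) (\<Phi> z s \<omega>) (ennreal h)"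
    unfolding path_run_def
  proof (rule nn_integral_cmult)
    have "(\<lambda>t. evo (path_jumps (fst (future s \<omega>))) (\<lambda>k. r (snd (future s \<omega>) k)) (\<Phi> z s \<omega>) t) \<in> borel_measurable lborel"
      by (rule measurable_evo) auto
    then show "(\<lambda>v. indicator {t. 0 \<le> t \<and> ennreal t < ennreal h} v *
     (ennreal (exp (- lam * v)) * load (evo (path_jumps (fst (future s \<omega>))) (\<lambda>k. r (snd (future s \<omega>) k)) (\<Phi> z s \<omega>) v))) \<in> borel_measurable lborel"
      by (intro path_integrand_measurable) auto
  qed
  finally show ?thesis .
qed

text \<open>
  Projection onto the closed quadrant in which the process lives.  Composing with it makes the
  functions below total, measurable and continuous on the whole plane.
\<close>

definition quadrant :: "real \<times> real \<Rightarrow> real \<times> real" where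
  "quadrant z = (max 0 (fst z), max 0 (snd z))"

lemma quadrant_nonneg [simp]: "0 \<le> fst (quadrant z)" "0 \<le> snd (quadrant z)" by (auto simp: quadrant_def)

lemma quadrant_id: "0 \<le> fst z \<Longrightarrow> 0 \<le> snd z \<Longrightarrow> quadrant z = z" by (cases z) (auto simp: quadrant_def)

lemma quadrant_quadrant [simp]: "quadrant (quadrant z) = quadrant z" by (simp add: quadrant_id)

lemma quadrant_measurable: "quadrant \<in> borel_measurable borel"
  unfolding quadrant_def[abs_def] by (intro borel_measurable_continuous_onI continuous_intros)

text \<open>
  Expected shifted cost of running for the time \<open>h\<close> and then paying \<open>f\<close>.
\<close>

definition Q :: "real \<Rightarrow> (real \<times> real \<Rightarrow> ennreal) \<Rightarrow> real \<times> real \<Rightarrow> ennreal" where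
  "Q h f z = (\<integral>\<^sup>+\<omega>. run (quadrant z) \<omega> (ennreal h) + disc (ennreal h) * f (\<Phi> (quadrant z) h \<omega>) \<partial>M)"

text \<open>
  The integrand of \<open>Q\<close> as a function of the starting point and of the driving noise, the form in which
  independence of the future can be used.
\<close>

definition path_cost :: "real \<Rightarrow> (real \<times> real \<Rightarrow> ennreal) \<Rightarrow>
    (real \<times> real) \<times> (real \<Rightarrow> nat) \<times> (nat \<Rightarrow> real ^ 'd) \<Rightarrow> ennreal" where
  "path_cost h f p = path_run (path_jumps (fst (snd p))) (\<lambda>k. r (snd (snd p) k)) (fst p) (ennreal h) +
     disc (ennreal h) * f (evo (path_jumps (fst (snd p))) (\<lambda>k. r (snd (snd p) k)) (fst p) h)"

lemma path_cost_measurable: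
  assumes f: "f \<in> borel_measurable borel"
  shows "path_cost h f \<in> borel_measurable (borel \<Otimes>\<^sub>M future_space)"
  unfolding path_cost_def[abs_def]
proof (rule borel_measurable_add)
  have "(\<lambda>p. indicator {t. 0 \<le> t \<and> ennreal t < ennreal h} (snd p) *
     (ennreal (exp (- lam * snd p)) * load (evo (path_jumps (fst (snd (fst p)))) (\<lambda>k. r (snd (snd (fst p)) k)) (fst (fst p)) (snd p))))
     \<in> borel_measurable ((borel \<Otimes>\<^sub>M future_space) \<Otimes>\<^sub>M lborel)"
  proof (intro path_integrand_measurable path_evo_measurable_future)
    show "snd \<in> borel_measurable ((borel \<Otimes>\<^sub>M future_space) \<Otimes>\<^sub>M lborel)"
      by (rule measurable_snd_lborel)
    show "(\<lambda>p. fst (fst p)) \<in> borel_measurable ((borel \<Otimes>\<^sub>M future_space) \<Otimes>\<^sub>M lborel)"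
      by (rule measurable_compose[OF measurable_fst measurable_fst])
    show "(\<lambda>p. snd (fst p)) \<in> measurable ((borel \<Otimes>\<^sub>M future_space) \<Otimes>\<^sub>M lborel) future_space"
      by (rule measurable_compose[OF measurable_fst measurable_snd])
  qed (simp_all add: measurable_snd_lborel)
  from lborel.borel_measurable_nn_integral_fst[OF this]
  show "(\<lambda>p. path_run (path_jumps (fst (snd p))) (\<lambda>k. r (snd (snd p) k)) (fst p) (ennreal h))
      \<in> borel_measurable (borel \<Otimes>\<^sub>M future_space)"
    by (simp add: path_run_def)
  show "(\<lambda>p. disc (ennreal h) * f (evo (path_jumps (fst (snd p))) (\<lambda>k. r (snd (snd p) k)) (fst p) h))
      \<in> borel_measurable (borel \<Otimes>\<^sub>M future_space)"
    by (intro borel_measurable_times_ennreal borel_measurable_const measurable_compose[OF _ f]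
        path_evo_measurable_future measurable_fst measurable_snd)
qed

lemma Q_eq_path_cost:
  assumes h: "0 \<le> h" and z: "0 \<le> fst z" "0 \<le> snd z"
  shows "Q h f z = (\<integral>\<^sup>+\<omega>. path_cost h f (z, future 0 \<omega>) \<partial>M)"
  unfolding Q_def quadrant_id[OF z]
proof (rule nn_integral_cong)
  fix \<omega> assume \<omega>: "\<omega> \<in> space M"
  have "run z \<omega> (ennreal h) =
      path_run (path_jumps (fst (future 0 \<omega>))) (\<lambda>k. r (snd (future 0 \<omega>) k)) z (ennreal h)"
    using run_restart[OF \<omega> order_refl h, of z] \<omega> by (simp add: disc_ennreal)
  moreover have "\<Phi> z h \<omega> = evo (path_jumps (fst (future 0 \<omega>))) (\<lambda>k. r (snd (future 0 \<omega>) k)) z h"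
    using evo_start[OF \<omega> h, of z] by (simp add: future_def N_0[OF \<omega>])
  ultimately show "run z \<omega> (ennreal h) + disc (ennreal h) * f (\<Phi> z h \<omega>) = path_cost h f (z, future 0 \<omega>)"
    by (simp add: path_cost_def)
qed

lemma Q_measurable:
  assumes f: "f \<in> borel_measurable borel" and h: "0 \<le> h"
  shows "Q h f \<in> borel_measurable borel"
proof -
  have "(\<lambda>p. path_cost h f (quadrant (fst p), future 0 (snd p))) \<in> borel_measurable (borel \<Otimes>\<^sub>M M)"
    by (rule measurable_compose[OF measurable_Pair[OF measurable_compose[OF measurable_fst quadrant_measurable]
          measurable_compose[OF measurable_snd future_measurable[OF order_refl]]] path_cost_measurable[OF f]])
  from borel_measurable_nn_integral_fst[OF this]
  have "(\<lambda>z. \<integral>\<^sup>+\<omega>. path_cost h f (quadrant z, future 0 \<omega>) \<partial>M) \<in> borel_measurable borel" by simp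
  moreover have "Q h f = (\<lambda>z. \<integral>\<^sup>+\<omega>. path_cost h f (quadrant z, future 0 \<omega>) \<partial>M)"
    by (rule ext) (use Q_eq_path_cost[OF h quadrant_nonneg] in \<open>simp add: Q_def\<close>)
  ultimately show ?thesis by (simp only:)
qed

text \<open>
  The form of the Markov property used throughout: on an event known at time \<open>s\<close>, continuing for a time
  \<open>h\<close> may be replaced by applying \<open>Q h\<close> at the state reached at \<open>s\<close>.
\<close>

lemma markov_step:
  assumes s: "0 \<le> s" and h: "0 \<le> h" and A: "A \<in> sets (F (ennreal s))"
    and f: "f \<in> borel_measurable borel" and z: "0 \<le> fst z" "0 \<le> snd z"
  shows "(\<integral>\<^sup>+\<omega>. indicator A \<omega> * (run z \<omega> (ennreal (s + h)) + disc (ennreal (s + h)) * f (\<Phi> z (s + h) \<omega>)) \<partial>M) =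
    (\<integral>\<^sup>+\<omega>. indicator A \<omega> * (run z \<omega> (ennreal s) + disc (ennreal s) * Q h f (\<Phi> z s \<omega>)) \<partial>M)"
proof -
  have AM: "A \<in> events" using A sets_F_subset by blast
  have ind: "indicator A \<in> borel_measurable M" by (rule borel_measurable_indicator[OF AM])
  have run: "(\<lambda>\<omega>. run z \<omega> (ennreal s)) \<in> borel_measurable M" by (rule run_measurable) simp
  have PC: "(\<lambda>\<omega>. path_cost h f (\<Phi> z s \<omega>, future s \<omega>)) \<in> borel_measurable M"
    by (rule measurable_compose[OF measurable_Pair[OF \<Phi>_measurable[OF s] future_measurable[OF s]] path_cost_measurable[OF f]])
  have QM: "(\<lambda>\<omega>. Q h f (\<Phi> z s \<omega>)) \<in> borel_measurable M"
    by (rule measurable_compose[OF \<Phi>_measurable[OF s] Q_measurable[OF f h]])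
  have "(\<integral>\<^sup>+\<omega>. indicator A \<omega> * (run z \<omega> (ennreal (s + h)) + disc (ennreal (s + h)) * f (\<Phi> z (s + h) \<omega>)) \<partial>M) =
      (\<integral>\<^sup>+\<omega>. indicator A \<omega> * run z \<omega> (ennreal s) + disc (ennreal s) * (indicator A \<omega> * path_cost h f (\<Phi> z s \<omega>, future s \<omega>)) \<partial>M)"
  proof (rule nn_integral_cong)
    fix \<omega> assume \<omega>: "\<omega> \<in> space M"
    have "\<Phi> z (s + h) \<omega> = evo (path_jumps (fst (future s \<omega>))) (\<lambda>k. r (snd (future s \<omega>) k)) (\<Phi> z s \<omega>) h"
      using \<Phi>_restart[OF \<omega> s h] by (simp add: future_def)
    then show "indicator A \<omega> * (run z \<omega> (ennreal (s + h)) + disc (ennreal (s + h)) * f (\<Phi> z (s + h) \<omega>)) =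
        indicator A \<omega> * run z \<omega> (ennreal s) + disc (ennreal s) * (indicator A \<omega> * path_cost h f (\<Phi> z s \<omega>, future s \<omega>))"
      unfolding run_restart[OF \<omega> s h] disc_add[OF s h] path_cost_def by (simp add: distrib_left mult_ac add_ac)
  qed
  also have "\<dots> = (\<integral>\<^sup>+\<omega>. indicator A \<omega> * run z \<omega> (ennreal s) \<partial>M) +
      disc (ennreal s) * (\<integral>\<^sup>+\<omega>. indicator A \<omega> * path_cost h f (\<Phi> z s \<omega>, future s \<omega>) \<partial>M)"
    unfolding nn_integral_cmult[OF borel_measurable_times_ennreal[OF ind PC], symmetric]
    by (rule nn_integral_add[OF borel_measurable_times_ennreal[OF ind run]
        borel_measurable_times_ennreal[OF borel_measurable_const borel_measurable_times_ennreal[OF ind PC]]])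
  also have "(\<integral>\<^sup>+\<omega>. indicator A \<omega> * path_cost h f (\<Phi> z s \<omega>, future s \<omega>) \<partial>M) =
      (\<integral>\<^sup>+\<omega>. indicator A \<omega> * (\<integral>\<^sup>+\<omega>'. path_cost h f (\<Phi> z s \<omega>, future 0 \<omega>') \<partial>M) \<partial>M)"
    by (rule nn_integral_F_future[OF s A \<Phi>_measurable_F[OF s] path_cost_measurable[OF f]])
  also have "\<dots> = (\<integral>\<^sup>+\<omega>. indicator A \<omega> * Q h f (\<Phi> z s \<omega>) \<partial>M)"
    by (rule nn_integral_cong) (simp add: Q_eq_path_cost[OF h] \<Phi>_nonneg s z)
  also have "(\<integral>\<^sup>+\<omega>. indicator A \<omega> * run z \<omega> (ennreal s) \<partial>M) +
      disc (ennreal s) * (\<integral>\<^sup>+\<omega>. indicator A \<omega> * Q h f (\<Phi> z s \<omega>) \<partial>M) =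
      (\<integral>\<^sup>+\<omega>. indicator A \<omega> * run z \<omega> (ennreal s) + disc (ennreal s) * (indicator A \<omega> * Q h f (\<Phi> z s \<omega>)) \<partial>M)"
    unfolding nn_integral_cmult[OF borel_measurable_times_ennreal[OF ind QM], symmetric]
    by (rule nn_integral_add[symmetric, OF borel_measurable_times_ennreal[OF ind run]
        borel_measurable_times_ennreal[OF borel_measurable_const borel_measurable_times_ennreal[OF ind QM]]])
  also have "\<dots> = (\<integral>\<^sup>+\<omega>. indicator A \<omega> * (run z \<omega> (ennreal s) + disc (ennreal s) * Q h f (\<Phi> z s \<omega>)) \<partial>M)"
    by (rule nn_integral_cong) (simp add: distrib_left mult_ac)
  finally show ?thesis .
qed

section \<open>Finiteness of the expected running cost\<close>

lemma prob_N_eq: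
  assumes h: "0 < h"
  shows "prob {\<omega>\<in>space M. N h \<omega> = n} = pmf (poisson_pmf (mu * h)) n"
proof -
  have d: "distr M (count_space UNIV) (\<lambda>\<omega>. N h \<omega> - N 0 \<omega>) = measure_pmf (poisson_pmf (mu * (h - 0)))"
    using poisson h by (auto simp: poisson_process_def)
  have m: "(\<lambda>\<omega>. N h \<omega> - N 0 \<omega>) \<in> measurable M (count_space UNIV)"
    by (rule measurable_nat_op[OF N_measurable N_measurable]) (use h in simp_all)
  have "measure (distr M (count_space UNIV) (\<lambda>\<omega>. N h \<omega> - N 0 \<omega>)) {n} =
      prob ((\<lambda>\<omega>. N h \<omega> - N 0 \<omega>) -` {n} \<inter> space M)"
    by (rule measure_distr[OF m]) simp
  moreover have "(\<lambda>\<omega>. N h \<omega> - N 0 \<omega>) -` {n} \<inter> space M = {\<omega>\<in>space M. N h \<omega> = n}"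
    using N_0 by auto
  ultimately show ?thesis unfolding d by (simp add: measure_pmf_single)
qed

text \<open>
  \<open>r\<close> is a probability density with respect to the law of the marks.
\<close>

lemma mark_mean:
  assumes k: "1 \<le> k"
  shows "(\<integral>\<^sup>+\<omega>. ennreal (r (Y k \<omega>)) \<partial>M) = 1"
proof -
  have rm: "(\<lambda>y. ennreal (r y)) \<in> borel_measurable borel" by simp
  have \<beta>0: "\<beta>0 = distr M borel (Y k)" using Y_distr[OF k] by simp
  have "(\<integral>\<^sup>+\<omega>. ennreal (r (Y k \<omega>)) \<partial>M) = (\<integral>\<^sup>+y. ennreal (r y) \<partial>\<beta>0)"
    unfolding \<beta>0 by (rule nn_integral_distr[symmetric, OF Y_measurable[OF k]]) simp
  also have "\<dots> = emeasure \<beta>1 (space \<beta>0)"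
  proof -
    have sp: "space \<beta>0 \<in> sets \<beta>0" by simp
    have "emeasure (density \<beta>0 (\<lambda>y. ennreal (r y))) (space \<beta>0) = (\<integral>\<^sup>+y. ennreal (r y) * indicator (space \<beta>0) y \<partial>\<beta>0)"
      by (rule emeasure_density) (auto simp: \<beta>0)
    also have "\<dots> = (\<integral>\<^sup>+y. ennreal (r y) \<partial>\<beta>0)"
      by (rule nn_integral_cong) simp
    finally show ?thesis unfolding r_density by simp
  qed
  also have "space \<beta>0 = space \<beta>1" unfolding \<beta>0 using sets_eq_imp_space_eq[OF \<beta>1_sets] by simp
  also have "emeasure \<beta>1 (space \<beta>1) = 1" by (rule prob_space.emeasure_space_1[OF \<beta>1_prob])
  finally show ?thesis .
qed

lemma marks_product_mean:
  assumes \<rho>: "0 \<le> \<rho>"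
  shows "(\<integral>\<^sup>+\<omega>. ennreal (\<Prod>k=1..n. 1 + \<rho> * r (Y k \<omega>)) \<partial>M) = ennreal ((1 + \<rho>) ^ n)"
proof -
  have ind: "indep_vars (\<lambda>_. borel) (\<lambda>k \<omega>. ennreal (1 + \<rho> * r (Y k \<omega>))) {1..n}"
  proof (rule indep_vars_compose2[where X=Y and Y="\<lambda>_ y. ennreal (1 + \<rho> * r y)" and M'="\<lambda>_. borel"])
    show "indep_vars (\<lambda>_. borel) Y {1..n}" by (rule indep_vars_subset[OF Y_indep]) auto
  qed simp
  have one: "(\<integral>\<^sup>+\<omega>. ennreal (1 + \<rho> * r (Y k \<omega>)) \<partial>M) = ennreal (1 + \<rho>)" if k: "k \<in> {1..n}" for k
  proof -
    have k1: "1 \<le> k" using k by simp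
    have m: "(\<lambda>\<omega>. ennreal (r (Y k \<omega>))) \<in> borel_measurable M"
      by (rule measurable_compose[OF Y_measurable[OF k1]]) simp
    have "(\<integral>\<^sup>+\<omega>. ennreal (1 + \<rho> * r (Y k \<omega>)) \<partial>M) = (\<integral>\<^sup>+\<omega>. 1 + ennreal \<rho> * ennreal (r (Y k \<omega>)) \<partial>M)"
      using \<rho> r_nonneg by (intro nn_integral_cong) (simp add: ennreal_plus ennreal_mult)
    also have "\<dots> = (\<integral>\<^sup>+\<omega>. 1 \<partial>M) + (\<integral>\<^sup>+\<omega>. ennreal \<rho> * ennreal (r (Y k \<omega>)) \<partial>M)"
      by (rule nn_integral_add) (use m in auto)
    also have "\<dots> = 1 + ennreal \<rho> * 1"
      unfolding nn_integral_cmult[OF m] mark_mean[OF k1] by (simp add: emeasure_space_1)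
    finally show ?thesis using \<rho> by (simp add: ennreal_plus)
  qed
  have "(\<integral>\<^sup>+\<omega>. ennreal (\<Prod>k=1..n. 1 + \<rho> * r (Y k \<omega>)) \<partial>M) =
      (\<integral>\<^sup>+\<omega>. (\<Prod>k=1..n. ennreal (1 + \<rho> * r (Y k \<omega>))) \<partial>M)"
    using \<rho> r_nonneg by (intro nn_integral_cong prod_ennreal[symmetric]) simp
  also have "\<dots> = (\<Prod>k=1..n. \<integral>\<^sup>+\<omega>. ennreal (1 + \<rho> * r (Y k \<omega>)) \<partial>M)"
    by (rule indep_vars_nn_integral[OF _ ind]) auto
  also have "\<dots> = (\<Prod>k=1..n. ennreal (1 + \<rho>))" by (rule prod.cong[OF refl one])
  also have "\<dots> = ennreal ((1 + \<rho>) ^ n)"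
    unfolding prod_constant using \<rho> by (simp add: ennreal_power del: ennreal_plus)
  finally show ?thesis .
qed

text \<open>
  Since \<open>N\<close> and the marks are independent, the random number of factors can be conditioned on.
\<close>

lemma marks_product_on_N:
  assumes h: "0 \<le> h" and \<rho>: "0 \<le> \<rho>"
  shows "(\<integral>\<^sup>+\<omega>. indicator {\<omega>\<in>space M. N h \<omega> = n} \<omega> * ennreal (\<Prod>k=1..n. 1 + \<rho> * r (Y k \<omega>)) \<partial>M) =
    ennreal (prob {\<omega>\<in>space M. N h \<omega> = n} * (1 + \<rho>) ^ n)"
proof -
  let ?A = "{\<omega>\<in>space M. N h \<omega> = n}"
  define G where "G y = ennreal (\<Prod>k=1..n. 1 + \<rho> * r (y k))" for y :: "nat \<Rightarrow> real^'d"
  have Ap: "?A \<in> sets (past_algebra h 0)"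
  proof -
    have "?A = N h -` {n} \<inter> space (past_algebra h 0)" by auto
    then show ?thesis using measurable_sets[OF N_measurable_past[OF h order_refl], of "{n}" 0] by simp
  qed
  have A: "?A \<in> events"
    using measurable_sets[OF N_measurable[OF h], of "{n}"] by (simp add: vimage_def Int_def conj_commute)
  have ind: "indicator ?A \<in> borel_measurable M" by (rule borel_measurable_indicator[OF A])
  have G: "G \<in> borel_measurable mark_space"
  proof -
    have "(\<lambda>y. r (y k)) \<in> borel_measurable mark_space" if "k \<in> {1..n}" for k
      by (rule measurable_compose[OF _ r_measurable], rule measurable_component_singleton) (use that in auto)
    then have "(\<lambda>y. \<Prod>k=1..n. 1 + \<rho> * r (y k)) \<in> borel_measurable mark_space"
      by (intro borel_measurable_prod borel_measurable_add borel_measurable_times borel_measurable_const)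
    then show ?thesis unfolding G_def[abs_def] by (rule measurable_compose[OF _ measurable_ennreal])
  qed
  have GY: "G (future_Y 0 \<omega>) = ennreal (\<Prod>k=1..n. 1 + \<rho> * r (Y k \<omega>))" for \<omega>
    unfolding G_def future_Y_def by (intro arg_cong[where f=ennreal] prod.cong) auto
  have Gm: "(\<lambda>\<omega>. G (future_Y 0 \<omega>)) \<in> borel_measurable M"
    by (rule measurable_compose[OF future_Y_measurable G])
  let ?P = "distr (density M (indicator ?A)) mark_space (future_Y 0)"
  let ?Q = "distr (density M (\<lambda>_. ennreal (prob ?A))) mark_space (future_Y 0)"
  have fd: "future_Y 0 \<in> measurable (density M u) mark_space" for u
    using future_Y_measurable measurable_cong_sets[OF sets_density refl] by blast
  have Gd: "G \<in> borel_measurable (distr L mark_space u)" for L and u :: "'a \<Rightarrow> nat \<Rightarrow> real^'d"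
    unfolding measurable_distr_eq1 by (rule G)
  have PQ: "?P = ?Q"
  proof (rule measure_eqI)
    fix D assume "D \<in> sets ?P"
    then have D: "D \<in> sets mark_space" by simp
    have "{\<omega>\<in>space M. future_N h \<omega> \<in> space path_space \<and> future_Y 0 \<omega> \<in> D} = {\<omega>\<in>space M. future_Y 0 \<omega> \<in> D}"
      by (auto simp: future_N_def space_PiM)
    moreover have "{\<omega>\<in>space M. future_N 0 \<omega> \<in> space path_space} = space M"
      by (auto simp: future_N_def space_PiM)
    ultimately have "prob (?A \<inter> {\<omega>\<in>space M. future_Y 0 \<omega> \<in> D}) = prob ?A * prob {\<omega>\<in>space M. future_Y 0 \<omega> \<in> D}"
      using prob_past_algebra_future[OF h Ap sets.top D] by (simp add: prob_space)
    then show "emeasure ?P D = emeasure ?Q D"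
      unfolding prob_distr_density_indicator[OF A future_Y_measurable D]
        prob_distr_density_const[OF future_Y_measurable D measure_nonneg] by simp
  qed simp
  have "(\<integral>\<^sup>+\<omega>. indicator ?A \<omega> * G (future_Y 0 \<omega>) \<partial>M) = (\<integral>\<^sup>+\<omega>. G (future_Y 0 \<omega>) \<partial>density M (indicator ?A))"
    by (rule nn_integral_density[symmetric, OF ind Gm])
  also have "\<dots> = (\<integral>\<^sup>+y. G y \<partial>?P)"
    by (rule nn_integral_distr[symmetric, OF fd Gd])
  also have "\<dots> = (\<integral>\<^sup>+\<omega>. G (future_Y 0 \<omega>) \<partial>density M (\<lambda>_. ennreal (prob ?A)))"
    unfolding PQ by (rule nn_integral_distr[OF fd Gd])
  also have "\<dots> = (\<integral>\<^sup>+\<omega>. ennreal (prob ?A) * G (future_Y 0 \<omega>) \<partial>M)"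
    by (rule nn_integral_density[OF borel_measurable_const Gm])
  also have "\<dots> = ennreal (prob ?A) * (\<integral>\<^sup>+\<omega>. G (future_Y 0 \<omega>) \<partial>M)"
    by (rule nn_integral_cmult[OF Gm])
  finally show ?thesis
    unfolding GY marks_product_mean[OF \<rho>] using \<rho> by (simp add: ennreal_mult)
qed

text \<open>
  The expectation is the value of the probability generating function of a Poisson variable at
  \<open>1 + \<rho>\<close>.
\<close>

lemma marks_product_finite:
  assumes h: "0 < h" and \<rho>: "0 \<le> \<rho>"
  shows "(\<integral>\<^sup>+\<omega>. ennreal (\<Prod>k=1..N h \<omega>. 1 + \<rho> * r (Y k \<omega>)) \<partial>M) < \<infinity>"
proof -
  let ?A = "\<lambda>n. {\<omega>\<in>space M. N h \<omega> = n}"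
  let ?g = "\<lambda>n \<omega>. ennreal (\<Prod>k=1..n. 1 + \<rho> * r (Y k \<omega>))"
  have "(\<integral>\<^sup>+\<omega>. ?g (N h \<omega>) \<omega> \<partial>M) = (\<integral>\<^sup>+\<omega>. (\<Sum>n. indicator (?A n) \<omega> * ?g n \<omega>) \<partial>M)"
  proof (rule nn_integral_cong)
    fix \<omega> assume \<omega>: "\<omega> \<in> space M"
    have "(\<lambda>n. indicator (?A n) \<omega> * ?g n \<omega>) sums (\<Sum>n\<in>{N h \<omega>}. indicator (?A n) \<omega> * ?g n \<omega>)"
      by (rule sums_finite) (auto simp: indicator_def)
    then show "?g (N h \<omega>) \<omega> = (\<Sum>n. indicator (?A n) \<omega> * ?g n \<omega>)"
      using \<omega> by (simp add: sums_iff indicator_def)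
  qed
  also have "\<dots> = (\<Sum>n. \<integral>\<^sup>+\<omega>. indicator (?A n) \<omega> * ?g n \<omega> \<partial>M)"
  proof (rule nn_integral_suminf)
    fix n
    have A: "?A n \<in> events"
      using measurable_sets[OF N_measurable[of h], of "{n}"] h by (simp add: vimage_def Int_def conj_commute)
    have "(\<lambda>\<omega>. r (Y k \<omega>)) \<in> borel_measurable M" if "k \<in> {1..n}" for k
      by (rule measurable_compose[OF Y_measurable r_measurable]) (use that in auto)
    then have "(\<lambda>\<omega>. \<Prod>k=1..n. 1 + \<rho> * r (Y k \<omega>)) \<in> borel_measurable M"
      by (intro borel_measurable_prod borel_measurable_add borel_measurable_times borel_measurable_const)
    from measurable_compose[OF this measurable_ennreal] borel_measurable_indicator[OF A]
    show "(\<lambda>\<omega>. indicator (?A n) \<omega> * ?g n \<omega>) \<in> borel_measurable M"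
      by (intro borel_measurable_times_ennreal)
  qed
  also have "\<dots> = (\<Sum>n. ennreal (pmf (poisson_pmf (mu * h)) n * (1 + \<rho>) ^ n))"
    using marks_product_on_N[OF less_imp_le[OF h] \<rho>] prob_N_eq[OF h] by simp
  also have "\<dots> < \<infinity>"
  proof -
    have mh: "0 < mu * h" using mu_pos h by simp
    have eq: "pmf (poisson_pmf (mu * h)) n * (1 + \<rho>) ^ n =
        exp (- (mu * h)) * (inverse (fact n) * (mu * h * (1 + \<rho>)) ^ n)" for n
      using mh unfolding power_mult_distrib[of "mu * h" "1 + \<rho>" n] by (simp add: divide_inverse mult_ac)
    have "summable (\<lambda>n. pmf (poisson_pmf (mu * h)) n * (1 + \<rho>) ^ n)"
      unfolding eq by (intro summable_mult summable_exp)
    then have "(\<Sum>n. ennreal (pmf (poisson_pmf (mu * h)) n * (1 + \<rho>) ^ n)) =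
        ennreal (\<Sum>n. pmf (poisson_pmf (mu * h)) n * (1 + \<rho>) ^ n)"
      using \<rho> by (intro suminf_ennreal2) auto
    then show ?thesis by simp
  qed
  finally show ?thesis .
qed

text \<open>
  Combines the pathwise growth bounds of both coordinates; the larger jump factor \<open>1 + 2 / mu\<close> serves
  for both, and the product over all jumps up to the horizon \<open>h\<close> dominates that up to \<open>t\<close>.
\<close>

lemma load_growth:
  assumes \<omega>: "\<omega> \<in> space M" and t: "0 \<le> t" "t \<le> h" and z: "0 \<le> fst z" "0 \<le> snd z"
  shows "load (\<Phi> z t \<omega>) \<le> ennreal ((exp ((\<bar>lam - 1\<bar> + lam * (2 - m)) * h) * (fst z + 1) +
      exp ((\<bar>lam - 2\<bar> + lam * (m - 1)) * h) * (snd z + 1)) * (\<Prod>k=1..N h \<omega>. 1 + (1 + 2 / mu) * r (Y k \<omega>)))"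
proof -
  have ex: "\<exists>n. t < \<sigma> (Suc n) \<omega>" using jump_time_N[OF \<omega> t(1)] by blast
  let ?P = "\<lambda>\<rho> n. \<Prod>k=1..n. 1 + \<rho> * r (Y k \<omega>)"
  have P: "?P \<rho> (N t \<omega>) \<le> ?P (1 + 2 / mu) (N h \<omega>)" if \<rho>: "0 \<le> \<rho>" "\<rho> \<le> 1 + 2 / mu" for \<rho>
  proof -
    have "?P \<rho> (N t \<omega>) \<le> ?P (1 + 2 / mu) (N t \<omega>)"
      using \<rho> r_nonneg by (intro prod_mono) (auto intro!: mult_right_mono)
    also have "\<dots> \<le> ?P (1 + 2 / mu) (N h \<omega>)"
      using N_mono[OF \<omega> t] a_nonneg(4) r_nonneg by (intro prod_mono2) auto
    finally show ?thesis .
  qed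
  have P0: "0 \<le> ?P \<rho> n" if "0 \<le> \<rho>" for \<rho> n using that r_nonneg by (intro prod_nonneg) auto
  have gen: "pdmp a b \<rho> (\<lambda>k. \<sigma> k \<omega>) (\<lambda>k. r (Y k \<omega>)) x t \<le> exp ((\<bar>a\<bar> + b) * h) * (x + 1) * ?P (1 + 2 / mu) (N h \<omega>)"
    if "0 \<le> b" "0 \<le> \<rho>" "\<rho> \<le> 1 + 2 / mu" "0 \<le> x" for a b \<rho> x
  proof -
    have t': "\<sigma> 0 \<omega> \<le> t" using jump_time_0[OF \<omega>] t by simp
    have "pdmp a b \<rho> (\<lambda>k. \<sigma> k \<omega>) (\<lambda>k. r (Y k \<omega>)) x t + 1 \<le>
        exp ((\<bar>a\<bar> + b) * (t - \<sigma> 0 \<omega>)) * (x + 1) * ?P \<rho> (jump_index (\<lambda>k. \<sigma> k \<omega>) t)"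
      by (rule pdmp_growth[OF that(1,2) _ jump_time_mono[OF \<omega>] t' ex that(4)]) (rule r_nonneg)
    also have "\<dots> = exp ((\<bar>a\<bar> + b) * t) * (x + 1) * ?P \<rho> (N t \<omega>)"
      using jump_time_0[OF \<omega>] jump_index_N[OF \<omega> t(1)] by simp
    also have "\<dots> \<le> exp ((\<bar>a\<bar> + b) * h) * (x + 1) * ?P (1 + 2 / mu) (N h \<omega>)"
      using P[OF that(2,3)] that t P0[OF that(2)]
      by (intro mult_mono) (auto intro!: mult_left_mono mult_nonneg_nonneg)
    finally show ?thesis by simp
  qed
  have \<rho>: "1 + 1 / mu \<le> 1 + 2 / mu" using mu_pos by (simp add: divide_right_mono)
  note add_mono[OF gen[OF a_nonneg(1,3) \<rho> z(1)] gen[OF a_nonneg(2,4) order_refl z(2)]]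
  from this[folded distrib_right[of _ _ "\<Prod>k=1..N h \<omega>. 1 + (1 + 2 / mu) * r (Y k \<omega>)"]] show ?thesis
    unfolding load_def \<Phi>_eq_evo[OF \<omega> t(1)] evo_def fst_conv snd_conv by (rule ennreal_leI)
qed

lemma run_growth:
  assumes \<omega>: "\<omega> \<in> space M" and h: "0 \<le> h" and z: "0 \<le> fst z" "0 \<le> snd z"
  shows "run z \<omega> (ennreal h) \<le> ennreal ((exp ((\<bar>lam - 1\<bar> + lam * (2 - m)) * h) * (fst z + 1) +
      exp ((\<bar>lam - 2\<bar> + lam * (m - 1)) * h) * (snd z + 1)) * h) * ennreal (\<Prod>k=1..N h \<omega>. 1 + (1 + 2 / mu) * r (Y k \<omega>))"
proof -
  let ?C = "exp ((\<bar>lam - 1\<bar> + lam * (2 - m)) * h) * (fst z + 1) +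
      exp ((\<bar>lam - 2\<bar> + lam * (m - 1)) * h) * (snd z + 1)"
  let ?P = "\<Prod>k=1..N h \<omega>. 1 + (1 + 2 / mu) * r (Y k \<omega>)"
  have C: "0 \<le> ?C" using z by (intro add_nonneg_nonneg mult_nonneg_nonneg) auto
  have P: "0 \<le> ?P" using a_nonneg(4) r_nonneg by (intro prod_nonneg) auto
  have "run z \<omega> (ennreal h) \<le> (\<integral>\<^sup>+t. ennreal (?C * ?P) * indicator {0..<h} t \<partial>lborel)"
    unfolding run_def
  proof (rule nn_integral_mono)
    fix t :: real
    show "indicator {t. 0 \<le> t \<and> ennreal t < ennreal h} t * (ennreal (exp (- lam * t)) * load (\<Phi> z t \<omega>))
        \<le> ennreal (?C * ?P) * indicator {0..<h} t"
    proof (cases "0 \<le> t \<and> t < h")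
      case True
      then have "ennreal (exp (- lam * t)) \<le> 1" using lam_pos disc_le_1[of "ennreal t"] by (simp add: disc_ennreal)
      then have "ennreal (exp (- lam * t)) * load (\<Phi> z t \<omega>) \<le> 1 * ennreal (?C * ?P)"
        using load_growth[OF \<omega> _ _ z, of t h] True by (intro mult_mono) auto
      then show ?thesis using True by (simp add: ennreal_less_iff)
    next
      case False then show ?thesis by (auto simp: ennreal_less_iff indicator_def)
    qed
  qed
  also have "\<dots> = ennreal (?C * ?P) * ennreal h"
    using h by (subst nn_integral_cmult_indicator) auto
  also have "\<dots> = ennreal (?C * h) * ennreal ?P"
    using C P h by (simp add: ennreal_mult[symmetric] mult_ac)
  finally show ?thesis .
qed

text \<open>
  This provides the integrable majorant for all dominated convergence arguments below.
\<close>

lemma expected_run_finite: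
  assumes h: "0 \<le> h" and z: "0 \<le> fst z" "0 \<le> snd z"
  shows "(\<integral>\<^sup>+\<omega>. run z \<omega> (ennreal h) \<partial>M) < \<infinity>"
proof -
  \<comment> \<open>A strictly positive horizon, as required for the Poisson law of \<open>N\<close>.\<close>
  let ?h = "h + 1"
  have h': "0 < ?h" "0 \<le> ?h" using h by auto
  let ?C = "(exp ((\<bar>lam - 1\<bar> + lam * (2 - m)) * ?h) * (fst z + 1) +
      exp ((\<bar>lam - 2\<bar> + lam * (m - 1)) * ?h) * (snd z + 1)) * ?h"
  let ?g = "\<lambda>\<omega>. ennreal (\<Prod>k=1..N ?h \<omega>. 1 + (1 + 2 / mu) * r (Y k \<omega>))"
  have "(\<lambda>\<omega>. (\<lambda>n \<omega>. ennreal (\<Prod>k=1..n. 1 + (1 + 2 / mu) * r (Y k \<omega>))) (N ?h \<omega>) \<omega>) \<in> borel_measurable M"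
  proof (rule measurable_compose_countable[where f="\<lambda>n \<omega>. ennreal (\<Prod>k=1..n. 1 + (1 + 2 / mu) * r (Y k \<omega>))"])
    fix n
    have "(\<lambda>\<omega>. r (Y k \<omega>)) \<in> borel_measurable M" if "k \<in> {1..n}" for k
      by (rule measurable_compose[OF Y_measurable r_measurable]) (use that in auto)
    then have "(\<lambda>\<omega>. \<Prod>k=1..n. 1 + (1 + 2 / mu) * r (Y k \<omega>)) \<in> borel_measurable M"
      by (intro borel_measurable_prod borel_measurable_add borel_measurable_times borel_measurable_const)
    then show "(\<lambda>\<omega>. ennreal (\<Prod>k=1..n. 1 + (1 + 2 / mu) * r (Y k \<omega>))) \<in> borel_measurable M"
      by (rule measurable_compose[OF _ measurable_ennreal])
  qed (rule N_measurable[OF h'(2)])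
  then have gm: "?g \<in> borel_measurable M" by simp
  have "(\<integral>\<^sup>+\<omega>. run z \<omega> (ennreal h) \<partial>M) \<le> (\<integral>\<^sup>+\<omega>. ennreal ?C * ?g \<omega> \<partial>M)"
  proof (rule nn_integral_mono)
    fix \<omega> assume \<omega>: "\<omega> \<in> space M"
    have "run z \<omega> (ennreal h) \<le> run z \<omega> (ennreal ?h)" by (rule run_mono) (rule ennreal_leI, simp)
    also have "\<dots> \<le> ennreal ?C * ?g \<omega>" by (rule run_growth[OF \<omega> h'(2) z])
    finally show "run z \<omega> (ennreal h) \<le> ennreal ?C * ?g \<omega>" .
  qed
  also have "\<dots> = ennreal ?C * (\<integral>\<^sup>+\<omega>. ?g \<omega> \<partial>M)" by (rule nn_integral_cmult[OF gm])
  also have "\<dots> < \<infinity>"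
    using marks_product_finite[OF h'(1) a_nonneg(4)] by (simp add: ennreal_mult_less_top)
  finally show ?thesis .
qed

section \<open>Dependence on the starting point\<close>

context
  fixes \<omega> and t :: real
  assumes \<omega>: "\<omega> \<in> space M" and t: "0 \<le> t"
begin

lemma \<Phi>_mono:
  assumes "fst z \<le> fst z'" "snd z \<le> snd z'"
  shows "fst (\<Phi> z t \<omega>) \<le> fst (\<Phi> z' t \<omega>)" "snd (\<Phi> z t \<omega>) \<le> snd (\<Phi> z' t \<omega>)"
  unfolding \<Phi>_eq_evo[OF \<omega> t] evo_def fst_conv snd_conv
  by (rule pdmp_mono[OF a_nonneg(1,3) r_nonneg jump_time_mono[OF \<omega>] assms(1)],
      rule pdmp_mono[OF a_nonneg(2,4) r_nonneg jump_time_mono[OF \<omega>] assms(2)])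

lemma \<Phi>_tendsto_start:
  assumes "u \<longlonglongrightarrow> z"
  shows "(\<lambda>i. \<Phi> (u i) t \<omega>) \<longlonglongrightarrow> \<Phi> z t \<omega>"
  unfolding \<Phi>_eq_evo[OF \<omega> t] evo_def
  by (rule tendsto_Pair;
      rule tendsto_pdmp[OF _ _ r_nonneg jump_time_mono[OF \<omega>]]; intro a_nonneg tendsto_fst tendsto_snd assms)

lemma \<Phi>_scale:
  assumes "0 \<le> \<alpha>" "\<alpha> \<le> 1"
  shows "\<alpha> * fst (\<Phi> z t \<omega>) \<le> fst (\<Phi> (\<alpha> * fst z, \<alpha> * snd z) t \<omega>)"
    "\<alpha> * snd (\<Phi> z t \<omega>) \<le> snd (\<Phi> (\<alpha> * fst z, \<alpha> * snd z) t \<omega>)"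
proof -
  have ex: "\<exists>n. t < \<sigma> (Suc n) \<omega>" using jump_time_N[OF \<omega> t] by blast
  have t': "\<sigma> 0 \<omega> \<le> t" using jump_time_0[OF \<omega>] t by simp
  show "\<alpha> * fst (\<Phi> z t \<omega>) \<le> fst (\<Phi> (\<alpha> * fst z, \<alpha> * snd z) t \<omega>)"
    "\<alpha> * snd (\<Phi> z t \<omega>) \<le> snd (\<Phi> (\<alpha> * fst z, \<alpha> * snd z) t \<omega>)"
    unfolding \<Phi>_eq_evo[OF \<omega> t] evo_def fst_conv snd_conv
    by (rule pdmp_scale[OF a_nonneg(1,3) r_nonneg jump_time_mono[OF \<omega>] t' ex assms],
        rule pdmp_scale[OF a_nonneg(2,4) r_nonneg jump_time_mono[OF \<omega>] t' ex assms])
qed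

end

lemma load_mono: "fst z \<le> fst z' \<Longrightarrow> snd z \<le> snd z' \<Longrightarrow> load z \<le> load z'"
  unfolding load_def by (intro ennreal_leI add_mono)

lemma tendsto_load: "(u \<longlongrightarrow> z) G \<Longrightarrow> ((\<lambda>i. load (u i)) \<longlongrightarrow> load z) G"
  unfolding load_def by (intro tendsto_ennrealI tendsto_intros)

lemma run_mono_start:
  assumes \<omega>: "\<omega> \<in> space M" and "fst z \<le> fst z'" "snd z \<le> snd z'"
  shows "run z \<omega> \<tau> \<le> run z' \<omega> \<tau>"
  unfolding run_def
proof (rule nn_integral_mono)
  fix t
  show "indicator {t. 0 \<le> t \<and> ennreal t < \<tau>} t * (ennreal (exp (- lam * t)) * load (\<Phi> z t \<omega>)) \<le>
     indicator {t. 0 \<le> t \<and> ennreal t < \<tau>} t * (ennreal (exp (- lam * t)) * load (\<Phi> z' t \<omega>))"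
    using load_mono[OF \<Phi>_mono[OF \<omega> _ assms(2,3)]] by (auto simp: indicator_def intro!: mult_left_mono)
qed

lemma evo_path_measurable: "(\<lambda>t. evo (\<lambda>k. \<sigma> k \<omega>) (\<lambda>k. r (Y k \<omega>)) z t) \<in> borel_measurable borel"
  by (rule measurable_evo) simp_all

lemma run_path_measurable:
  "(\<lambda>t. indicator {t. 0 \<le> t \<and> ennreal t < \<tau>} t *
     (ennreal (exp (- lam * t)) * load (evo (\<lambda>k. \<sigma> k \<omega>) (\<lambda>k. r (Y k \<omega>)) z t))) \<in> borel_measurable lborel"
  by (rule path_integrand_measurable[of "\<lambda>t. t" lborel "\<lambda>_. \<tau>"]) (simp_all add: evo_path_measurable)

lemma run_scale:
  assumes \<omega>: "\<omega> \<in> space M" and \<alpha>: "0 \<le> \<alpha>" "\<alpha> \<le> 1"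
  shows "ennreal \<alpha> * run z \<omega> \<tau> \<le> run (\<alpha> * fst z, \<alpha> * snd z) \<omega> \<tau>"
proof -
  let ?I = "\<lambda>z t. indicator {t. 0 \<le> t \<and> ennreal t < \<tau>} t *
     (ennreal (exp (- lam * t)) * load (evo (\<lambda>k. \<sigma> k \<omega>) (\<lambda>k. r (Y k \<omega>)) z t))"
  have "ennreal \<alpha> * run z \<omega> \<tau> = (\<integral>\<^sup>+t. ennreal \<alpha> * ?I z t \<partial>lborel)"
    unfolding run_eq_path_run[OF \<omega>] path_run_def
    by (rule nn_integral_cmult[symmetric, OF run_path_measurable])
  also have "\<dots> \<le> (\<integral>\<^sup>+t. ?I (\<alpha> * fst z, \<alpha> * snd z) t \<partial>lborel)"
  proof (rule nn_integral_mono)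
    fix t
    show "ennreal \<alpha> * ?I z t \<le> ?I (\<alpha> * fst z, \<alpha> * snd z) t"
    proof (cases "0 \<le> t \<and> ennreal t < \<tau>")
      case True
      then have t: "0 \<le> t" by simp
      have "ennreal \<alpha> * load (\<Phi> z t \<omega>) \<le> load (\<Phi> (\<alpha> * fst z, \<alpha> * snd z) t \<omega>)"
        unfolding load_def ennreal_mult'[OF \<alpha>(1), symmetric] distrib_left
        by (intro ennreal_leI add_mono \<Phi>_scale[OF \<omega> t \<alpha>])
      from mult_left_mono[OF this, of "ennreal (exp (- lam * t))"] show ?thesis
        using True unfolding \<Phi>_eq_evo[OF \<omega> t] by (simp add: mult_ac)
    qed auto
  qed
  also have "\<dots> = run (\<alpha> * fst z, \<alpha> * snd z) \<omega> \<tau>"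
    unfolding run_eq_path_run[OF \<omega>] path_run_def ..
  finally show ?thesis .
qed

text \<open>
  Dominated convergence; by monotonicity in the starting point, a path started at a larger corner
  is a majorant.
\<close>

lemma run_tendsto_start:
  assumes \<omega>: "\<omega> \<in> space M" and u: "u \<longlonglongrightarrow> z" and B: "\<And>i. fst (u i) \<le> B" "\<And>i. snd (u i) \<le> B"
    and fin: "run (B, B) \<omega> \<tau> < \<infinity>"
  shows "(\<lambda>i. run (u i) \<omega> \<tau>) \<longlonglongrightarrow> run z \<omega> \<tau>"
  unfolding run_eq_path_run[OF \<omega>] path_run_def
proof (rule nn_integral_dominated_convergence)
  let ?I = "\<lambda>z t. indicator {t. 0 \<le> t \<and> ennreal t < \<tau>} t *
     (ennreal (exp (- lam * t)) * load (evo (\<lambda>k. \<sigma> k \<omega>) (\<lambda>k. r (Y k \<omega>)) z t))"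
  show "?I z \<in> borel_measurable lborel" "?I (B, B) \<in> borel_measurable lborel"
    "\<And>i. ?I (u i) \<in> borel_measurable lborel" by (rule run_path_measurable)+
  show "(\<integral>\<^sup>+t. ?I (B, B) t \<partial>lborel) < \<infinity>"
    using fin unfolding run_eq_path_run[OF \<omega>] path_run_def .
  show "AE t in lborel. ?I (u i) t \<le> ?I (B, B) t" for i
  proof (rule AE_I2)
    fix t :: real
    show "?I (u i) t \<le> ?I (B, B) t"
    proof (cases "0 \<le> t \<and> ennreal t < \<tau>")
      case True
      then have t: "0 \<le> t" by simp
      show ?thesis
        using True load_mono[OF \<Phi>_mono[OF \<omega> t, of "u i" "(B, B)"]] B
        unfolding \<Phi>_eq_evo[OF \<omega> t] by (auto intro!: mult_left_mono)
    qed auto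
  qed
  show "AE t in lborel. (\<lambda>i. ?I (u i) t) \<longlonglongrightarrow> ?I z t"
  proof (rule AE_I2)
    fix t :: real
    show "(\<lambda>i. ?I (u i) t) \<longlonglongrightarrow> ?I z t"
    proof (cases "0 \<le> t \<and> ennreal t < \<tau>")
      case True
      then have t: "0 \<le> t" by simp
      have "(\<lambda>i. ennreal (exp (- lam * t)) * load (\<Phi> (u i) t \<omega>)) \<longlonglongrightarrow> ennreal (exp (- lam * t)) * load (\<Phi> z t \<omega>)"
        by (intro ennreal_tendsto_cmult tendsto_load \<Phi>_tendsto_start[OF \<omega> t u]) simp
      then show ?thesis using True unfolding \<Phi>_eq_evo[OF \<omega> t] by simp
    qed simp
  qed
qed

section \<open>The value of the shifted problem\<close>

lemma stop_cost_finite: "stop_cost < top"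
  by (simp add: stop_cost_def)

text \<open>
  The properties that pass from a terminal cost to the value of one more step.  Monotonicity and the
  scaling inequality are the two that survive infima and still give lower semicontinuity.
\<close>

definition value_like :: "(real \<times> real \<Rightarrow> ennreal) \<Rightarrow> bool" where
  "value_like f \<longleftrightarrow> continuous_on UNIV f \<and> (\<forall>z. f z \<le> stop_cost) \<and>
     (\<forall>z z'. fst z \<le> fst z' \<longrightarrow> snd z \<le> snd z' \<longrightarrow> f z \<le> f z') \<and>
     (\<forall>\<alpha> z. 0 \<le> \<alpha> \<longrightarrow> \<alpha> \<le> 1 \<longrightarrow> ennreal \<alpha> * f z \<le> f (\<alpha> * fst z, \<alpha> * snd z)) \<and>
     (\<forall>z. f (quadrant z) = f z)"

lemma value_likeD:
  assumes "value_like f"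
  shows "continuous_on UNIV f" "f \<in> borel_measurable borel" "f z \<le> stop_cost"
    "fst z \<le> fst z' \<Longrightarrow> snd z \<le> snd z' \<Longrightarrow> f z \<le> f z'"
    "0 \<le> \<alpha> \<Longrightarrow> \<alpha> \<le> 1 \<Longrightarrow> ennreal \<alpha> * f z \<le> f (\<alpha> * fst z, \<alpha> * snd z)"
    "f (quadrant z) = f z"
proof -
  note f = assms[unfolded value_like_def]
  note n = f[THEN conjunct1] f[THEN conjunct2, THEN conjunct1, rule_format]
    f[THEN conjunct2, THEN conjunct2, THEN conjunct1, rule_format]
    f[THEN conjunct2, THEN conjunct2, THEN conjunct2, THEN conjunct1, rule_format]
    f[THEN conjunct2, THEN conjunct2, THEN conjunct2, THEN conjunct2, rule_format]
  show "continuous_on UNIV f" "f \<in> borel_measurable borel" "f z \<le> stop_cost"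
    "fst z \<le> fst z' \<Longrightarrow> snd z \<le> snd z' \<Longrightarrow> f z \<le> f z'"
    "0 \<le> \<alpha> \<Longrightarrow> \<alpha> \<le> 1 \<Longrightarrow> ennreal \<alpha> * f z \<le> f (\<alpha> * fst z, \<alpha> * snd z)"
    "f (quadrant z) = f z"
    by (rule n(1), rule borel_measurable_continuous_onI[OF n(1)], rule n(2), erule (1) n(3), erule (1) n(4), rule n(5))
qed

lemma value_like_const: "value_like (\<lambda>_. stop_cost)"
proof -
  have "ennreal \<alpha> * stop_cost \<le> stop_cost" if "\<alpha> \<le> 1" for \<alpha>
  proof -
    have "ennreal \<alpha> \<le> 1" using that by (simp del: ennreal_1 flip: ennreal_1 add: ennreal_leI)
    from mult_right_mono[OF this, of stop_cost] show ?thesis by simp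
  qed
  then show ?thesis unfolding value_like_def by simp
qed

lemma quadrant_mono: "fst z \<le> fst z' \<Longrightarrow> fst (quadrant z) \<le> fst (quadrant z')" "snd z \<le> snd z' \<Longrightarrow> snd (quadrant z) \<le> snd (quadrant z')"
  by (auto simp: quadrant_def)

lemma quadrant_scale: "0 \<le> \<alpha> \<Longrightarrow> quadrant (\<alpha> * fst z, \<alpha> * snd z) = (\<alpha> * fst (quadrant z), \<alpha> * snd (quadrant z))"
  by (auto simp: quadrant_def max_def zero_le_mult_iff mult_le_0_iff)

lemma tendsto_quadrant: "(u \<longlongrightarrow> z) G \<Longrightarrow> ((\<lambda>i. quadrant (u i)) \<longlongrightarrow> quadrant z) G"
  unfolding quadrant_def by (intro tendsto_intros)

lemma cost_measurable:
  assumes f: "f \<in> borel_measurable borel" and h: "0 \<le> h"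
  shows "(\<lambda>\<omega>. run z \<omega> (ennreal h) + disc (ennreal h) * f (\<Phi> z h \<omega>)) \<in> borel_measurable M"
proof -
  have 1: "(\<lambda>\<omega>. run z \<omega> (ennreal h)) \<in> borel_measurable M" by (rule run_measurable) simp
  have 2: "(\<lambda>\<omega>. f (\<Phi> z h \<omega>)) \<in> borel_measurable M" by (rule measurable_compose[OF \<Phi>_measurable[OF h] f])
  show ?thesis by (rule borel_measurable_add[OF 1 borel_measurable_times_ennreal[OF borel_measurable_const 2]])
qed

lemma Q_mono: "(\<And>z. f z \<le> f' z) \<Longrightarrow> Q h f z \<le> Q h f' z"
  unfolding Q_def by (intro nn_integral_mono add_left_mono mult_left_mono) auto

lemma disc_mult_le: "a \<le> b \<Longrightarrow> disc t * a \<le> b"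
  using mult_mono[OF disc_le_1[of t], of a b] by simp

lemma disc_finite: "disc t < top"
  by (rule le_less_trans[OF disc_le_1]) simp

text \<open>
  Joint continuity in the starting point and the terminal cost, which covers both continuity of
  \<open>Q h f\<close> and passage to a pointwise limit of terminal costs.
\<close>

lemma Q_tendsto:
  assumes h: "0 \<le> h" and fs: "\<And>i. fs i \<in> borel_measurable borel" and f: "f \<in> borel_measurable borel"
    and le: "\<And>i x. fs i x \<le> stop_cost" and u: "u \<longlonglongrightarrow> z"
    and conv: "\<And>\<omega>. \<omega> \<in> space M \<Longrightarrow> (\<lambda>i. fs i (\<Phi> (quadrant (u i)) h \<omega>)) \<longlonglongrightarrow> f (\<Phi> (quadrant z) h \<omega>)"
  shows "(\<lambda>i. Q h (fs i) (u i)) \<longlonglongrightarrow> Q h f z"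
proof -
  have pu: "(\<lambda>i. quadrant (u i)) \<longlonglongrightarrow> quadrant z" by (rule tendsto_quadrant[OF u])
  have "Bseq (\<lambda>i. fst (quadrant (u i)))" "Bseq (\<lambda>i. snd (quadrant (u i)))"
    using tendsto_fst[OF pu] tendsto_snd[OF pu] by (auto intro: convergent_imp_Bseq convergentI)
  then obtain B1 B2 where "\<And>i. norm (fst (quadrant (u i))) \<le> B1" "\<And>i. norm (snd (quadrant (u i))) \<le> B2"
    unfolding Bseq_def by blast
  then have B1: "fst (quadrant (u i)) \<le> max B1 B2" and B2: "snd (quadrant (u i)) \<le> max B1 B2" for i
    by (simp_all add: le_max_iff_disj)
  define B where "B = max B1 B2"
  have B: "fst (quadrant (u i)) \<le> B" "snd (quadrant (u i)) \<le> B" for i using B1 B2 by (auto simp: B_def)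
  have B0: "0 \<le> B" using B(1)[of 0] quadrant_nonneg(1)[of "u 0"] by linarith
  have Bz: "0 \<le> fst (B, B)" "0 \<le> snd (B, B)" using B0 by auto
  have rB: "(\<lambda>\<omega>. run (B, B) \<omega> (ennreal h)) \<in> borel_measurable M" by (rule run_measurable) simp
  have fin: "(\<integral>\<^sup>+\<omega>. run (B, B) \<omega> (ennreal h) \<partial>M) < \<infinity>" by (rule expected_run_finite[OF h Bz])
  show ?thesis
    unfolding Q_def
  proof (rule nn_integral_dominated_convergence[where w="\<lambda>\<omega>. run (B, B) \<omega> (ennreal h) + stop_cost"])
    show "(\<lambda>\<omega>. run (quadrant (u i)) \<omega> (ennreal h) + disc (ennreal h) * fs i (\<Phi> (quadrant (u i)) h \<omega>)) \<in> borel_measurable M" for i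
      by (rule cost_measurable[OF fs h])
    show "(\<lambda>\<omega>. run (quadrant z) \<omega> (ennreal h) + disc (ennreal h) * f (\<Phi> (quadrant z) h \<omega>)) \<in> borel_measurable M"
      by (rule cost_measurable[OF f h])
    show "(\<lambda>\<omega>. run (B, B) \<omega> (ennreal h) + stop_cost) \<in> borel_measurable M"
      by (rule borel_measurable_add[OF rB borel_measurable_const])
    show "AE \<omega> in M. run (quadrant (u i)) \<omega> (ennreal h) + disc (ennreal h) * fs i (\<Phi> (quadrant (u i)) h \<omega>)
        \<le> run (B, B) \<omega> (ennreal h) + stop_cost" for i
      by (rule AE_I2) (intro add_mono run_mono_start disc_mult_le le, simp_all add: B)
    show "(\<integral>\<^sup>+\<omega>. run (B, B) \<omega> (ennreal h) + stop_cost \<partial>M) < \<infinity>"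
      using fin stop_cost_finite by (subst nn_integral_add[OF rB]) (simp_all add: emeasure_space_1)
    have "AE \<omega> in M. run (B, B) \<omega> (ennreal h) \<noteq> \<infinity>"
      using nn_integral_PInf_AE[OF rB] fin by simp
    then show "AE \<omega> in M. (\<lambda>i. run (quadrant (u i)) \<omega> (ennreal h) + disc (ennreal h) * fs i (\<Phi> (quadrant (u i)) h \<omega>))
        \<longlonglongrightarrow> run (quadrant z) \<omega> (ennreal h) + disc (ennreal h) * f (\<Phi> (quadrant z) h \<omega>)"
    proof (rule AE_mp, intro AE_I2 impI)
      fix \<omega> assume \<omega>: "\<omega> \<in> space M" and "run (B, B) \<omega> (ennreal h) \<noteq> \<infinity>"
      then have "run (B, B) \<omega> (ennreal h) < \<infinity>" by (simp add: less_top)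
      from run_tendsto_start[OF \<omega> pu B this]
      show "(\<lambda>i. run (quadrant (u i)) \<omega> (ennreal h) + disc (ennreal h) * fs i (\<Phi> (quadrant (u i)) h \<omega>))
        \<longlonglongrightarrow> run (quadrant z) \<omega> (ennreal h) + disc (ennreal h) * f (\<Phi> (quadrant z) h \<omega>)"
        by (intro tendsto_add ennreal_tendsto_cmult conv[OF \<omega>])
          (simp_all add: disc_finite)
    qed
  qed
qed

text \<open>
  Each property of the terminal cost is combined with the corresponding property of the process and
  of the accumulated load.
\<close>

lemma value_like_step:
  assumes f: "value_like f" and h: "0 \<le> h"
  shows "value_like (\<lambda>z. min stop_cost (Q h f z))"
  unfolding value_like_def
proof (intro conjI allI impI)
  show "continuous_on UNIV (\<lambda>z. min stop_cost (Q h f z))"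
    unfolding continuous_on_sequentially
  proof (intro allI ballI impI, elim conjE)
    fix u :: "nat \<Rightarrow> real \<times> real" and z assume u: "u \<longlonglongrightarrow> z"
    have "(\<lambda>i. Q h f (u i)) \<longlonglongrightarrow> Q h f z"
    proof (rule Q_tendsto[OF h value_likeD(2)[OF f] value_likeD(2)[OF f] value_likeD(3)[OF f] u])
      fix \<omega> assume \<omega>: "\<omega> \<in> space M"
      have "(\<lambda>i. \<Phi> (quadrant (u i)) h \<omega>) \<longlonglongrightarrow> \<Phi> (quadrant z) h \<omega>"
        by (rule \<Phi>_tendsto_start[OF \<omega> h tendsto_quadrant[OF u]])
      then show "(\<lambda>i. f (\<Phi> (quadrant (u i)) h \<omega>)) \<longlonglongrightarrow> f (\<Phi> (quadrant z) h \<omega>)"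
        by (rule continuous_on_tendsto_compose[OF value_likeD(1)[OF f]]) auto
    qed
    then show "((\<lambda>z. min stop_cost (Q h f z)) \<circ> u) \<longlonglongrightarrow> min stop_cost (Q h f z)"
      unfolding o_def by (intro tendsto_min tendsto_const)
  qed
next
  show "min stop_cost (Q h f z) \<le> stop_cost" for z by simp
next
  fix z z' :: "real \<times> real" assume le: "fst z \<le> fst z'" "snd z \<le> snd z'"
  have "Q h f z \<le> Q h f z'"
    unfolding Q_def
  proof (rule nn_integral_mono)
    fix \<omega> assume \<omega>: "\<omega> \<in> space M"
    show "run (quadrant z) \<omega> (ennreal h) + disc (ennreal h) * f (\<Phi> (quadrant z) h \<omega>) \<le>
        run (quadrant z') \<omega> (ennreal h) + disc (ennreal h) * f (\<Phi> (quadrant z') h \<omega>)"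
      by (intro add_mono run_mono_start[OF \<omega>] mult_left_mono value_likeD(4)[OF f] \<Phi>_mono[OF \<omega> h] quadrant_mono le) simp
  qed
  then show "min stop_cost (Q h f z) \<le> min stop_cost (Q h f z')" by (intro min.mono order_refl)
next
  fix \<alpha> :: real and z :: "real \<times> real" assume \<alpha>: "0 \<le> \<alpha>" "\<alpha> \<le> 1"
  let ?z = "(\<alpha> * fst (quadrant z), \<alpha> * snd (quadrant z))"
  have "ennreal \<alpha> * Q h f z = (\<integral>\<^sup>+\<omega>. ennreal \<alpha> * (run (quadrant z) \<omega> (ennreal h) + disc (ennreal h) * f (\<Phi> (quadrant z) h \<omega>)) \<partial>M)"
    unfolding Q_def by (rule nn_integral_cmult[symmetric, OF cost_measurable[OF value_likeD(2)[OF f] h]])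
  also have "\<dots> \<le> (\<integral>\<^sup>+\<omega>. run ?z \<omega> (ennreal h) + disc (ennreal h) * f (\<Phi> ?z h \<omega>) \<partial>M)"
  proof (rule nn_integral_mono)
    fix \<omega> assume \<omega>: "\<omega> \<in> space M"
    have "ennreal \<alpha> * f (\<Phi> (quadrant z) h \<omega>) \<le> f (\<alpha> * fst (\<Phi> (quadrant z) h \<omega>), \<alpha> * snd (\<Phi> (quadrant z) h \<omega>))"
      by (rule value_likeD(5)[OF f \<alpha>])
    also have "\<dots> \<le> f (\<Phi> ?z h \<omega>)"
      by (rule value_likeD(4)[OF f]) (simp_all add: \<Phi>_scale[OF \<omega> h \<alpha>])
    finally have "disc (ennreal h) * (ennreal \<alpha> * f (\<Phi> (quadrant z) h \<omega>)) \<le> disc (ennreal h) * f (\<Phi> ?z h \<omega>)"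
      by (rule mult_left_mono) simp
    with run_scale[OF \<omega> \<alpha>, of "quadrant z" "ennreal h"]
    show "ennreal \<alpha> * (run (quadrant z) \<omega> (ennreal h) + disc (ennreal h) * f (\<Phi> (quadrant z) h \<omega>)) \<le>
        run ?z \<omega> (ennreal h) + disc (ennreal h) * f (\<Phi> ?z h \<omega>)"
      unfolding distrib_left by (intro add_mono) (simp_all add: mult_ac)
  qed
  also have "\<dots> = Q h f (\<alpha> * fst z, \<alpha> * snd z)"
    unfolding Q_def quadrant_scale[OF \<alpha>(1)] ..
  finally have 1: "ennreal \<alpha> * Q h f z \<le> Q h f (\<alpha> * fst z, \<alpha> * snd z)" .
  have 2: "ennreal \<alpha> * stop_cost \<le> stop_cost" using value_likeD(5)[OF value_like_const \<alpha>] by simp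
  have "ennreal \<alpha> * min stop_cost (Q h f z) \<le> ennreal \<alpha> * stop_cost"
    "ennreal \<alpha> * min stop_cost (Q h f z) \<le> ennreal \<alpha> * Q h f z"
    by (intro mult_left_mono; simp)+
  then show "ennreal \<alpha> * min stop_cost (Q h f z) \<le> min stop_cost (Q h f (\<alpha> * fst z, \<alpha> * snd z))"
    using 1 2 by (intro min.boundedI) (blast intro: order_trans)+
next
  show "min stop_cost (Q h f (quadrant z)) = min stop_cost (Q h f z)" for z by (simp add: Q_def)
qed

text \<open>
  Value of the problem in which stopping is allowed at the times \<open>i / 2 ^ k\<close> only and is forced after \<open>n\<close>
  steps.
\<close>

primrec bermudan :: "nat \<Rightarrow> nat \<Rightarrow> real \<times> real \<Rightarrow> ennreal" where
  "bermudan k 0 = (\<lambda>_. stop_cost)"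
| "bermudan k (Suc n) = (\<lambda>z. min stop_cost (Q (1 / 2 ^ k) (bermudan k n) z))"

lemma value_like_bermudan: "value_like (bermudan k n)"
  by (induction n) (simp_all add: value_like_const value_like_step)

lemma bermudan_Suc: "bermudan k (Suc n) z = min stop_cost (Q (1 / 2 ^ k) (bermudan k n) z)"
  by simp

lemma bermudan_Suc_le: "bermudan k (Suc n) z \<le> bermudan k n z"
proof (induction n arbitrary: z)
  case (Suc n)
  show ?case
    unfolding bermudan_Suc[of k "Suc n" z] bermudan_Suc[of k n z]
    by (intro min.mono order_refl Q_mono Suc)
qed simp

lemma bermudan_antimono: "n \<le> n' \<Longrightarrow> bermudan k n' z \<le> bermudan k n z"
proof (induction n' rule: dec_induct)
  case (step m) show ?case by (rule order_trans[OF bermudan_Suc_le step(3)])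
qed simp

text \<open>
  The semigroup property is \<open>markov_step\<close> on the whole space.
\<close>

lemma Q_add:
  assumes s: "0 \<le> s" and h: "0 \<le> h" and f: "f \<in> borel_measurable borel"
  shows "Q (s + h) f z = Q s (Q h f) z"
proof -
  have sp: "space M \<in> sets (F (ennreal s))" using sets.top[of "F (ennreal s)"] by simp
  have "Q (s + h) f z = (\<integral>\<^sup>+\<omega>. indicator (space M) \<omega> *
      (run (quadrant z) \<omega> (ennreal (s + h)) + disc (ennreal (s + h)) * f (\<Phi> (quadrant z) (s + h) \<omega>)) \<partial>M)"
    unfolding Q_def[of "s + h"] by (rule nn_integral_cong) simp
  also have "\<dots> = (\<integral>\<^sup>+\<omega>. indicator (space M) \<omega> *
      (run (quadrant z) \<omega> (ennreal s) + disc (ennreal s) * Q h f (\<Phi> (quadrant z) s \<omega>)) \<partial>M)"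
    by (rule markov_step[OF s h sp f]) simp_all
  also have "\<dots> = Q s (Q h f) z"
    unfolding Q_def[of s] by (rule nn_integral_cong) simp
  finally show ?thesis .
qed

text \<open>
  Running through several steps without stopping is one of the possible decisions.
\<close>

lemma bermudan_le_Q: "bermudan k (n + Suc i) z \<le> Q (real (Suc i) / 2 ^ k) (bermudan k n) z"
proof (induction i arbitrary: z)
  case 0 show ?case by simp
next
  case (Suc i)
  have "bermudan k (n + Suc (Suc i)) z \<le> Q (1 / 2 ^ k) (bermudan k (n + Suc i)) z" by simp
  also have "\<dots> \<le> Q (1 / 2 ^ k) (Q (real (Suc i) / 2 ^ k) (bermudan k n)) z" by (intro Q_mono Suc)
  also have "\<dots> = Q (1 / 2 ^ k + real (Suc i) / 2 ^ k) (bermudan k n) z"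
    by (rule Q_add[symmetric]) (simp_all add: value_likeD(2)[OF value_like_bermudan])
  also have "1 / 2 ^ k + real (Suc i) / 2 ^ k = real (Suc (Suc i)) / 2 ^ k"
    by (simp add: add_divide_distrib)
  finally show ?case .
qed

text \<open>
  Every decision on the coarse grid is also available on the finer one.
\<close>

lemma bermudan_refine: "bermudan (Suc k) (2 * n) z \<le> bermudan k n z"
proof (induction n arbitrary: z)
  case (Suc n)
  have "bermudan (Suc k) (2 * n + Suc 1) z \<le> Q (real (Suc 1) / 2 ^ Suc k) (bermudan (Suc k) (2 * n)) z"
    by (rule bermudan_le_Q)
  also have "\<dots> \<le> Q (real (Suc 1) / 2 ^ Suc k) (bermudan k n) z" by (intro Q_mono Suc)
  also have "real (Suc 1) / 2 ^ Suc k = 1 / 2 ^ k" by simp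
  finally have "bermudan (Suc k) (2 * Suc n) z \<le> Q (1 / 2 ^ k) (bermudan k n) z" by simp
  then show ?case using value_likeD(3)[OF value_like_bermudan] by simp
qed simp

text \<open>
  Mesh \<open>2 ^ (- j)\<close> and horizon \<open>j\<close>; increasing \<open>j\<close> enlarges the set of admissible decisions.
\<close>

definition approx :: "nat \<Rightarrow> real \<times> real \<Rightarrow> ennreal" where
  "approx j = bermudan j (j * 2 ^ j)"

text \<open>
  The value function of the shifted problem, as \<open>hit_contact_optimal\<close> and \<open>w_le_J\<close> show in the end.
\<close>

definition w :: "real \<times> real \<Rightarrow> ennreal" where
  "w z = (INF j. approx j z)"

lemma approx_Suc_le: "approx (Suc j) z \<le> bermudan j n z" if "n \<le> Suc j * 2 ^ j" for n
proof -
  have "approx (Suc j) z = bermudan (Suc j) (2 * (Suc j * 2 ^ j)) z" by (simp add: approx_def mult_ac)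
  also have "\<dots> \<le> bermudan j (Suc j * 2 ^ j) z" by (rule bermudan_refine)
  also have "\<dots> \<le> bermudan j n z" by (rule bermudan_antimono[OF that])
  finally show ?thesis .
qed

lemma decseq_approx: "decseq (\<lambda>j. approx j z)"
proof (rule decseq_SucI)
  fix j
  have "approx (Suc j) z \<le> bermudan j (j * 2 ^ j) z" by (rule approx_Suc_le) simp
  then show "approx (Suc j) z \<le> approx j z" unfolding approx_def[of j] .
qed

lemma w_le_approx: "w z \<le> approx j z"
  unfolding w_def by (rule INF_lower) simp

lemma approx_tendsto_w: "(\<lambda>j. approx j z) \<longlonglongrightarrow> w z"
  unfolding w_def by (rule LIMSEQ_INF[OF decseq_approx])

lemma value_like_approx: "value_like (approx j)"
  unfolding approx_def by (rule value_like_bermudan)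

lemma w_le_stop_cost: "w z \<le> stop_cost"
  using w_le_approx value_likeD(3)[OF value_like_approx] by (rule order_trans)

lemma w_quadrant: "w (quadrant z) = w z"
  unfolding w_def by (simp add: value_likeD(6)[OF value_like_approx])

lemma w_mono: "fst z \<le> fst z' \<Longrightarrow> snd z \<le> snd z' \<Longrightarrow> w z \<le> w z'"
  unfolding w_def by (intro INF_mono) (use value_likeD(4)[OF value_like_approx] in blast)

lemma w_scale:
  assumes "0 \<le> \<alpha>" "\<alpha> \<le> 1"
  shows "ennreal \<alpha> * w z \<le> w (\<alpha> * fst z, \<alpha> * snd z)"
  unfolding w_def[of "(\<alpha> * fst z, \<alpha> * snd z)"]
proof (rule INF_greatest)
  fix j
  have "ennreal \<alpha> * w z \<le> ennreal \<alpha> * approx j z" by (intro mult_left_mono w_le_approx) simp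
  also have "\<dots> \<le> approx j (\<alpha> * fst z, \<alpha> * snd z)" by (rule value_likeD(5)[OF value_like_approx assms])
  finally show "ennreal \<alpha> * w z \<le> approx j (\<alpha> * fst z, \<alpha> * snd z)" .
qed

text \<open>
  Upper semicontinuity holds for every infimum of continuous functions.  For lower
  semicontinuity, points close to \<open>z\<close> dominate \<open>\<alpha> * z\<close> coordinatewise when \<open>\<alpha> < 1\<close>, so
  monotonicity and scaling bound \<open>w\<close> there from below by \<open>\<alpha> * w z\<close>.
\<close>

lemma w_continuous: "continuous_on UNIV w"
  unfolding continuous_on_sequentially
proof (intro allI ballI impI, elim conjE, unfold o_def)
  fix u :: "nat \<Rightarrow> real \<times> real" and z assume u: "u \<longlonglongrightarrow> z"
  show "(\<lambda>i. w (u i)) \<longlonglongrightarrow> w z"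
  proof (rule order_tendstoI)
    fix a assume "w z < a"
    then obtain j where j: "approx j z < a" unfolding w_def by (auto simp: INF_less_iff)
    have "(\<lambda>i. approx j (u i)) \<longlonglongrightarrow> approx j z"
      by (rule continuous_on_tendsto_compose[OF value_likeD(1)[OF value_like_approx] u]) auto
    from order_tendstoD(2)[OF this j] show "\<forall>\<^sub>F i in sequentially. w (u i) < a"
      by eventually_elim (rule le_less_trans[OF w_le_approx])
  next
    fix a assume a: "a < w z"
    have wz: "w z < top" using w_le_stop_cost[of z] stop_cost_finite by (rule le_less_trans)
    obtain x where x: "w z = ennreal x" "0 \<le> x" using wz by (cases "w z") auto
    obtain y where y: "a = ennreal y" "0 \<le> y" using a wz by (cases a) auto
    have yx: "y < x" using a x y by (simp add: ennreal_less_iff)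
    then have x0: "0 < x" using y by simp
    \<comment> \<open>Any \<open>\<alpha>\<close> strictly between \<open>y / x\<close> and 1 works: \<open>a < \<alpha> * w z\<close>, while \<open>\<alpha> * z\<close> lies below all points near \<open>z\<close>.\<close>
    define \<alpha> where "\<alpha> = (1 + y / x) / 2"
    have yx1: "y / x < 1" "0 \<le> y / x" using yx x0 y by auto
    have "p < (1 + p) / 2" "(1 + p) / 2 < 1" "0 \<le> (1 + p) / 2" if "p < 1" "0 \<le> p" for p :: real using that by auto
    from this[OF yx1] have \<alpha>: "0 \<le> \<alpha>" "\<alpha> < 1" "y / x < \<alpha>" unfolding \<alpha>_def by auto
    have "y < \<alpha> * x" using \<alpha>(3) x0 by (simp add: pos_divide_less_eq)
    then have a\<alpha>: "a < ennreal \<alpha> * w z"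
      unfolding x(1) y(1) ennreal_mult'[OF \<alpha>(1), symmetric] using y(2) by (simp add: ennreal_less_iff)
    have ev: "\<forall>\<^sub>F i in sequentially. \<alpha> * p \<le> max 0 (q i)" if "q \<longlonglongrightarrow> p'" "p = max 0 p'" for p p' and q :: "nat \<Rightarrow> real"
    proof (cases "p' \<le> 0")
      case True then show ?thesis using that by simp
    next
      case False
      then have "\<alpha> * p < p'" using that \<alpha> by simp
      from order_tendstoD(1)[OF that(1) this] show ?thesis by eventually_elim simp
    qed
    have "\<forall>\<^sub>F i in sequentially. \<alpha> * fst (quadrant z) \<le> max 0 (fst (u i))"
      by (rule ev[OF tendsto_fst[OF u]]) (simp add: quadrant_def)
    moreover have "\<forall>\<^sub>F i in sequentially. \<alpha> * snd (quadrant z) \<le> max 0 (snd (u i))"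
      by (rule ev[OF tendsto_snd[OF u]]) (simp add: quadrant_def)
    ultimately show "\<forall>\<^sub>F i in sequentially. a < w (u i)"
    proof eventually_elim
      case (elim i)
      have "ennreal \<alpha> * w z = ennreal \<alpha> * w (quadrant z)" by (simp add: w_quadrant)
      also have "\<dots> \<le> w (\<alpha> * fst (quadrant z), \<alpha> * snd (quadrant z))" using \<alpha> by (intro w_scale) auto
      also have "\<dots> \<le> w (quadrant (u i))" by (rule w_mono) (use elim in \<open>simp_all add: quadrant_def\<close>)
      also have "\<dots> = w (u i)" by (rule w_quadrant)
      finally show ?case using a\<alpha> by (rule less_le_trans[rotated])
    qed
  qed
qed

lemma w_measurable: "w \<in> borel_measurable borel"
  by (rule borel_measurable_continuous_onI[OF w_continuous])

text \<open>
  On a fine grid, waiting for the time \<open>1 / 2 ^ k\<close> and continuing with the remaining horizon is one of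
  the possible decisions; the limit of infinitely fine grids is taken inside \<open>Q\<close>.
\<close>

lemma w_le_Q: "w z \<le> Q (1 / 2 ^ k) w z"
proof (rule LIMSEQ_le_const)
  show "(\<lambda>j. Q (1 / 2 ^ k) (approx j) z) \<longlonglongrightarrow> Q (1 / 2 ^ k) w z"
    by (rule Q_tendsto[where u="\<lambda>_. z"])
      (simp_all add: value_likeD(2,3)[OF value_like_approx] w_measurable approx_tendsto_w)
  show "\<exists>n. \<forall>j\<ge>n. w z \<le> Q (1 / 2 ^ k) (approx j) z"
  proof (intro exI allI impI)
    \<comment> \<open>Then \<open>1 / 2 ^ k\<close> consists of \<open>2 ^ (j - k)\<close> steps of the finer grid, and level \<open>j + 1\<close> has room for these in addition to the steps of level \<open>j\<close>.\<close>
    fix j assume j: "k \<le> j"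
    obtain i where i: "Suc i = 2 ^ (j - k)" using not0_implies_Suc[of "2 ^ (j - k)"] by auto
    have "w z \<le> approx (Suc j) z" by (rule w_le_approx)
    also have "\<dots> \<le> bermudan j (j * 2 ^ j + Suc i) z"
    proof (rule approx_Suc_le)
      have "(2::nat) ^ (j - k) \<le> 2 ^ j" by (rule power_increasing) auto
      then show "j * 2 ^ j + Suc i \<le> Suc j * 2 ^ j" unfolding i by simp
    qed
    also have "\<dots> \<le> Q (real (Suc i) / 2 ^ j) (approx j) z"
      unfolding approx_def by (rule bermudan_le_Q)
    also have "real (Suc i) / 2 ^ j = 1 / 2 ^ k"
    proof -
      have "(2::real) ^ j = 2 ^ (j - k) * 2 ^ k" using j by (simp flip: power_add)
      then show ?thesis unfolding i by simp
    qed
    finally show "w z \<le> Q (1 / 2 ^ k) (approx j) z" .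
  qed
qed

end

section \<open>The submartingale inequality\<close>

lemma nn_integral_split_set:
  assumes D: "D \<in> sets M" and G: "G \<in> borel_measurable M"
  shows "(\<integral>\<^sup>+x. G x \<partial>M) = (\<integral>\<^sup>+x. indicator D x * G x \<partial>M) + (\<integral>\<^sup>+x. indicator (space M - D) x * G x \<partial>M)"
proof -
  have 1: "indicator D \<in> borel_measurable M" "indicator (space M - D) \<in> borel_measurable M"
    using D by (auto intro: borel_measurable_indicator)
  have "(\<integral>\<^sup>+x. G x \<partial>M) = (\<integral>\<^sup>+x. indicator D x * G x + indicator (space M - D) x * G x \<partial>M)"
    by (rule nn_integral_cong) (auto simp: indicator_def)
  also have "\<dots> = (\<integral>\<^sup>+x. indicator D x * G x \<partial>M) + (\<integral>\<^sup>+x. indicator (space M - D) x * G x \<partial>M)"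
    by (rule nn_integral_add[OF borel_measurable_times_ennreal[OF 1(1) G] borel_measurable_times_ennreal[OF 1(2) G]])
  finally show ?thesis .
qed

context poisson_disorder
begin

lemma grid_time_measurable:
  fixes f :: "'a \<Rightarrow> nat"
  assumes "\<And>i. {\<omega>\<in>space M. f \<omega> \<le> i} \<in> sets (F (ennreal (real i / 2 ^ k)))"
  shows "f \<in> measurable M (count_space UNIV)"
  unfolding measurable_count_space_eq2_countable
proof (intro conjI ballI)
  fix i :: nat
  have le: "{\<omega>\<in>space M. f \<omega> \<le> j} \<in> events" for j using assms[of j] sets_F_subset by blast
  have "f -` {i} \<inter> space M = {\<omega>\<in>space M. f \<omega> \<le> i} - (if i = 0 then {} else {\<omega>\<in>space M. f \<omega> \<le> i - 1})"
    by auto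
  then show "f -` {i} \<inter> space M \<in> events" using le[of i] le[of "i - 1"] by (cases "i = 0") simp_all
qed simp

text \<open>
  Cost so far plus the discounted optimal cost to go: a submartingale, by \<open>w_le_Q\<close>.
\<close>

definition bellman :: "real \<times> real \<Rightarrow> real \<Rightarrow> 'a \<Rightarrow> ennreal" where
  "bellman z t \<omega> = run z \<omega> (ennreal t) + disc (ennreal t) * w (\<Phi> z t \<omega>)"

lemma bellman_measurable:
  assumes T: "T \<in> borel_measurable M" and pos: "\<And>\<omega>. \<omega> \<in> space M \<Longrightarrow> 0 \<le> T \<omega>"
  shows "(\<lambda>\<omega>. bellman z (T \<omega>) \<omega>) \<in> borel_measurable M"
proof -
  have eT: "(\<lambda>\<omega>. ennreal (T \<omega>)) \<in> borel_measurable M" by (rule measurable_compose[OF T measurable_ennreal])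
  have 1: "(\<lambda>\<omega>. run z \<omega> (ennreal (T \<omega>))) \<in> borel_measurable M" by (rule run_measurable[OF eT])
  have 2: "(\<lambda>\<omega>. disc (ennreal (T \<omega>))) \<in> borel_measurable M" by (rule measurable_compose[OF eT disc_measurable])
  have 3: "(\<lambda>\<omega>. w (\<Phi> z (T \<omega>) \<omega>)) \<in> borel_measurable M"
    by (rule measurable_compose[OF \<Phi>_time_measurable[OF T pos] w_measurable])
  show ?thesis unfolding bellman_def
    by (rule borel_measurable_add[OF 1 borel_measurable_times_ennreal[OF 2 3]])
qed

text \<open>
  Optional stopping on a grid.  The two times are connected by a chain of intermediate times that differ
  by at most one grid step, and only on an event known at the beginning of that step.
\<close>

lemma discrete_submartingale:
  fixes a b :: "'a \<Rightarrow> nat"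
  assumes z: "0 \<le> fst z" "0 \<le> snd z"
    and ab: "\<And>\<omega>. \<omega> \<in> space M \<Longrightarrow> a \<omega> \<le> b \<omega>" and bm: "\<And>\<omega>. \<omega> \<in> space M \<Longrightarrow> b \<omega> \<le> l"
    and a: "\<And>i. {\<omega>\<in>space M. a \<omega> \<le> i} \<in> sets (F (ennreal (real i / 2 ^ k)))"
    and b: "\<And>i. {\<omega>\<in>space M. b \<omega> \<le> i} \<in> sets (F (ennreal (real i / 2 ^ k)))"
  shows "(\<integral>\<^sup>+\<omega>. bellman z (real (a \<omega>) / 2 ^ k) \<omega> \<partial>M) \<le> (\<integral>\<^sup>+\<omega>. bellman z (real (b \<omega>) / 2 ^ k) \<omega> \<partial>M)"
proof -
  \<comment> \<open>\<open>R i\<close> equals \<open>a\<close> for \<open>i = 0\<close> and \<open>b\<close> for \<open>i = l\<close>, and moves from \<open>i\<close> to \<open>i + 1\<close> exactly on \<open>a \<le> i < b\<close>.\<close>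
  define R where "R i \<omega> = min (max (a \<omega>) i) (b \<omega>)" for i \<omega>
  let ?B = "\<lambda>j \<omega>. bellman z (real j / 2 ^ k) \<omega>"
  have R_meas: "R i \<in> measurable M (count_space UNIV)" for i
    unfolding R_def by (rule measurable_nat_op[where h="\<lambda>x y. min (max x i) y", OF grid_time_measurable[OF a] grid_time_measurable[OF b]])
  have BR: "(\<lambda>\<omega>. ?B (R i \<omega>) \<omega>) \<in> borel_measurable M" for i
    by (rule bellman_measurable) (rule measurable_compose[OF R_meas], simp_all)
  have B_meas: "?B j \<in> borel_measurable M" for j
    by (rule bellman_measurable) simp_all
  have step: "(\<integral>\<^sup>+\<omega>. ?B (R i \<omega>) \<omega> \<partial>M) \<le> (\<integral>\<^sup>+\<omega>. ?B (R (Suc i) \<omega>) \<omega> \<partial>M)" for i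
  proof -
    let ?D = "{\<omega>\<in>space M. a \<omega> \<le> i} - {\<omega>\<in>space M. b \<omega> \<le> i}"
    have D: "?D \<in> sets (F (ennreal (real i / 2 ^ k)))" by (intro sets.Diff a b)
    then have DM: "?D \<in> events" using sets_F_subset by blast
    have onD: "R i \<omega> = i" "R (Suc i) \<omega> = Suc i" if "\<omega> \<in> ?D" for \<omega>
      using that by (auto simp: R_def)
    have offD: "R (Suc i) \<omega> = R i \<omega>" if "\<omega> \<in> space M - ?D" for \<omega>
      using that ab[of \<omega>] by (auto simp: R_def)
    have "(\<integral>\<^sup>+\<omega>. indicator ?D \<omega> * ?B (R i \<omega>) \<omega> \<partial>M) =
        (\<integral>\<^sup>+\<omega>. indicator ?D \<omega> * (run z \<omega> (ennreal (real i / 2 ^ k)) + disc (ennreal (real i / 2 ^ k)) * w (\<Phi> z (real i / 2 ^ k) \<omega>)) \<partial>M)"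
      by (rule nn_integral_cong) (auto simp: indicator_def onD bellman_def)
    also have "\<dots> \<le> (\<integral>\<^sup>+\<omega>. indicator ?D \<omega> * (run z \<omega> (ennreal (real i / 2 ^ k)) +
        disc (ennreal (real i / 2 ^ k)) * Q (1 / 2 ^ k) w (\<Phi> z (real i / 2 ^ k) \<omega>)) \<partial>M)"
      by (intro nn_integral_mono mult_left_mono add_left_mono w_le_Q) simp_all
    also have "\<dots> = (\<integral>\<^sup>+\<omega>. indicator ?D \<omega> * (run z \<omega> (ennreal (real i / 2 ^ k + 1 / 2 ^ k)) +
        disc (ennreal (real i / 2 ^ k + 1 / 2 ^ k)) * w (\<Phi> z (real i / 2 ^ k + 1 / 2 ^ k) \<omega>)) \<partial>M)"
      by (rule markov_step[symmetric, OF _ _ D w_measurable z]) simp_all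
    also have "real i / 2 ^ k + 1 / 2 ^ k = real (Suc i) / 2 ^ k" by (simp add: add_divide_distrib)
    also have "(\<integral>\<^sup>+\<omega>. indicator ?D \<omega> * (run z \<omega> (ennreal (real (Suc i) / 2 ^ k)) +
        disc (ennreal (real (Suc i) / 2 ^ k)) * w (\<Phi> z (real (Suc i) / 2 ^ k) \<omega>)) \<partial>M) =
        (\<integral>\<^sup>+\<omega>. indicator ?D \<omega> * ?B (R (Suc i) \<omega>) \<omega> \<partial>M)"
      by (rule nn_integral_cong) (auto simp: indicator_def onD bellman_def simp del: of_nat_Suc)
    finally have 1: "(\<integral>\<^sup>+\<omega>. indicator ?D \<omega> * ?B (R i \<omega>) \<omega> \<partial>M) \<le> (\<integral>\<^sup>+\<omega>. indicator ?D \<omega> * ?B (R (Suc i) \<omega>) \<omega> \<partial>M)" .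
    have 2: "(\<integral>\<^sup>+\<omega>. indicator (space M - ?D) \<omega> * ?B (R i \<omega>) \<omega> \<partial>M) =
        (\<integral>\<^sup>+\<omega>. indicator (space M - ?D) \<omega> * ?B (R (Suc i) \<omega>) \<omega> \<partial>M)"
    proof (rule nn_integral_cong)
      fix \<omega> assume \<omega>: "\<omega> \<in> space M"
      show "indicator (space M - ?D) \<omega> * ?B (R i \<omega>) \<omega> = indicator (space M - ?D) \<omega> * ?B (R (Suc i) \<omega>) \<omega>"
      proof (cases "\<omega> \<in> space M - ?D")
        case True then show ?thesis using offD[OF True] by simp
      next
        case False
        then have "indicator (space M - ?D) \<omega> = (0 :: ennreal)" by (rule indicator_simps(2))
        then show ?thesis by (simp only: mult_zero_left)
      qed
    qed
    show ?thesis unfolding nn_integral_split_set[OF DM BR[of i]] nn_integral_split_set[OF DM BR[of "Suc i"]] 2 by (rule add_right_mono[OF 1])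
  qed
  have "(\<integral>\<^sup>+\<omega>. ?B (R 0 \<omega>) \<omega> \<partial>M) \<le> (\<integral>\<^sup>+\<omega>. ?B (R l \<omega>) \<omega> \<partial>M)"
  proof (induction l)
    case (Suc l) show ?case by (rule order_trans[OF Suc step])
  qed simp
  moreover have "(\<integral>\<^sup>+\<omega>. ?B (R 0 \<omega>) \<omega> \<partial>M) = (\<integral>\<^sup>+\<omega>. ?B (a \<omega>) \<omega> \<partial>M)"
    by (rule nn_integral_cong) (use ab in \<open>simp add: R_def\<close>)
  moreover have "(\<integral>\<^sup>+\<omega>. ?B (R l \<omega>) \<omega> \<partial>M) = (\<integral>\<^sup>+\<omega>. ?B (b \<omega>) \<omega> \<partial>M)"
    by (rule nn_integral_cong) (use bm in \<open>simp add: R_def max.coboundedI2 min_absorb2\<close>)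
  ultimately show ?thesis by simp
qed

lemma run_tendsto_time:
  assumes \<omega>: "\<omega> \<in> space M" and f: "f \<longlonglongrightarrow> t" and t0: "0 \<le> t" and bnd: "\<And>i. f i \<le> l"
    and f0: "\<And>i. 0 \<le> f i" and fin: "run z \<omega> (ennreal l) < \<infinity>"
  shows "(\<lambda>i. run z \<omega> (ennreal (f i))) \<longlonglongrightarrow> run z \<omega> (ennreal t)"
  unfolding run_eq_path_run[OF \<omega>] path_run_def
proof (rule nn_integral_dominated_convergence)
  let ?G = "\<lambda>u. ennreal (exp (- lam * u)) * load (evo (\<lambda>k. \<sigma> k \<omega>) (\<lambda>k. r (Y k \<omega>)) z u)"
  let ?I = "\<lambda>s u. indicator {u. 0 \<le> u \<and> ennreal u < s} u * ?G u"
  show "?I (ennreal (f i)) \<in> borel_measurable lborel" "?I (ennreal t) \<in> borel_measurable lborel"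
    "?I (ennreal l) \<in> borel_measurable lborel" for i by (rule run_path_measurable)+
  show "(\<integral>\<^sup>+u. ?I (ennreal l) u \<partial>lborel) < \<infinity>"
    using fin unfolding run_eq_path_run[OF \<omega>] path_run_def .
  show "AE u in lborel. ?I (ennreal (f i)) u \<le> ?I (ennreal l) u" for i
    by (rule AE_I2) (use less_le_trans[OF _ ennreal_leI[OF bnd[of i]]] in \<open>auto simp: indicator_def\<close>)
  \<comment> \<open>The indicators may fail to converge at the end point only.\<close>
  have "AE u in lborel. u \<noteq> t" by (rule AE_lborel_singleton)
  then show "AE u in lborel. (\<lambda>i. ?I (ennreal (f i)) u) \<longlonglongrightarrow> ?I (ennreal t) u"
  proof (rule AE_mp, intro AE_I2 impI)
    fix u :: real assume u: "u \<noteq> t"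
    have "\<forall>\<^sub>F i in sequentially. (0 \<le> u \<and> ennreal u < ennreal (f i)) = (0 \<le> u \<and> ennreal u < ennreal t)"
    proof (cases "u < t")
      case True
      from order_tendstoD(1)[OF f True] show ?thesis
        by eventually_elim (use True in \<open>auto simp: ennreal_less_iff\<close>)
    next
      case False
      then have "t < u" using u by simp
      from order_tendstoD(2)[OF f this] show ?thesis
        by eventually_elim (use \<open>t < u\<close> in \<open>auto simp: ennreal_less_iff\<close>)
    qed
    then have "\<forall>\<^sub>F i in sequentially. ?I (ennreal (f i)) u = ?I (ennreal t) u"
      by eventually_elim (simp add: indicator_def)
    then show "(\<lambda>i. ?I (ennreal (f i)) u) \<longlonglongrightarrow> ?I (ennreal t) u" by (rule tendsto_eventually)
  qed
qed

lemma tendsto_disc: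
  assumes "f \<longlonglongrightarrow> t" "0 \<le> t" "\<And>i. 0 \<le> f i"
  shows "(\<lambda>i. disc (ennreal (f i))) \<longlonglongrightarrow> disc (ennreal t)"
  unfolding disc_ennreal[OF assms(2)] disc_ennreal[OF assms(3)] by (intro tendsto_ennrealI tendsto_intros assms(1))

text \<open>
  Right limits suffice because stopping times are approximated from above, and the paths are
  continuous from the right only.
\<close>

lemma bellman_tendsto_right:
  assumes \<omega>: "\<omega> \<in> space M" and f: "f \<longlonglongrightarrow> t" and t0: "0 \<le> t" and bnd: "\<And>i. f i \<le> l" "\<And>i. t \<le> f i"
    and fin: "run z \<omega> (ennreal l) < \<infinity>"
  shows "(\<lambda>i. bellman z (f i) \<omega>) \<longlonglongrightarrow> bellman z t \<omega>"
proof -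
  have f0: "0 \<le> f i" for i using t0 bnd(2)[of i] by linarith
  have \<Phi>: "(\<lambda>i. \<Phi> z (f i) \<omega>) \<longlonglongrightarrow> \<Phi> z t \<omega>" by (rule \<Phi>_tendsto_right[OF \<omega> t0 f]) (simp add: bnd)
  have "(\<lambda>i. w (\<Phi> z (f i) \<omega>)) \<longlonglongrightarrow> w (\<Phi> z t \<omega>)"
    by (rule continuous_on_tendsto_compose[OF w_continuous \<Phi>]) auto
  moreover have "disc (ennreal t) \<noteq> 0" using t0 by (simp add: disc_ennreal)
  moreover have "w (\<Phi> z t \<omega>) \<noteq> top" using le_less_trans[OF w_le_stop_cost stop_cost_finite, of "\<Phi> z t \<omega>"] by simp
  moreover have "disc (ennreal t) \<noteq> top" using disc_finite[of "ennreal t"] by simp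
  ultimately have "(\<lambda>i. disc (ennreal (f i)) * w (\<Phi> z (f i) \<omega>)) \<longlonglongrightarrow> disc (ennreal t) * w (\<Phi> z t \<omega>)"
    using tendsto_disc[OF f t0 f0] by (intro tendsto_mult_ennreal) auto
  then show ?thesis
    unfolding bellman_def by (intro tendsto_add run_tendsto_time[OF \<omega> f t0 bnd(1) f0 fin])
qed

text \<open>
  Finite stopping times with real values, for which rounding to a grid is elementary arithmetic.
\<close>

definition real_stopping :: "('a \<Rightarrow> real) \<Rightarrow> bool" where
  "real_stopping T \<longleftrightarrow> (\<forall>\<omega>\<in>space M. 0 \<le> T \<omega>) \<and>
     (\<forall>t\<ge>0. {\<omega>\<in>space M. T \<omega> \<le> t} \<in> sets (F (ennreal t)))"

lemma real_stopping_measurable: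
  assumes T: "real_stopping T"
  shows "T \<in> borel_measurable M"
proof (rule borel_measurableI_le)
  fix t
  show "{\<omega> \<in> space M. T \<omega> \<le> t} \<in> events"
  proof (cases "0 \<le> t")
    case True then show ?thesis using T sets_F_subset unfolding real_stopping_def by blast
  next
    case False
    then have "\<not> T \<omega> \<le> t" if "\<omega> \<in> space M" for \<omega> using T that unfolding real_stopping_def by fastforce
    then have "{\<omega> \<in> space M. T \<omega> \<le> t} = {}" by blast
    then show ?thesis by (simp only: sets.empty_sets)
  qed
qed

lemma grid_ceiling:
  fixes x :: real
  assumes "0 \<le> x"
  shows "x \<le> real (nat \<lceil>x * 2 ^ k\<rceil>) / 2 ^ k" "real (nat \<lceil>x * 2 ^ k\<rceil>) / 2 ^ k \<le> x + 1 / 2 ^ k"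
    "nat \<lceil>x * 2 ^ k\<rceil> \<le> i \<longleftrightarrow> x \<le> real i / 2 ^ k"
proof -
  have nn: "0 \<le> x * 2 ^ k" using assms by simp
  then have c: "real (nat \<lceil>x * 2 ^ k\<rceil>) = real_of_int \<lceil>x * 2 ^ k\<rceil>" by simp
  show "x \<le> real (nat \<lceil>x * 2 ^ k\<rceil>) / 2 ^ k" unfolding c
    using le_of_int_ceiling[of "x * 2 ^ k"] by (simp add: pos_le_divide_eq)
  have "real_of_int \<lceil>x * 2 ^ k\<rceil> \<le> x * 2 ^ k + 1" using ceiling_correct[of "x * 2 ^ k"] by linarith
  then show "real (nat \<lceil>x * 2 ^ k\<rceil>) / 2 ^ k \<le> x + 1 / 2 ^ k" unfolding c by (simp add: field_simps)
  have "nat \<lceil>x * 2 ^ k\<rceil> \<le> i \<longleftrightarrow> x * 2 ^ k \<le> real i" by (simp add: nat_le_iff ceiling_le_iff)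
  then show "nat \<lceil>x * 2 ^ k\<rceil> \<le> i \<longleftrightarrow> x \<le> real i / 2 ^ k" by (simp add: pos_le_divide_eq)
qed

lemma bellman_le:
  assumes "0 \<le> t" "t \<le> l"
  shows "bellman z t \<omega> \<le> run z \<omega> (ennreal l) + stop_cost"
  unfolding bellman_def
  by (intro add_mono run_mono ennreal_leI assms(2) disc_mult_le w_le_stop_cost)

text \<open>
  Both times are rounded up to the grid of mesh \<open>2 ^ (- k)\<close>, which preserves their order and the
  stopping property, and \<open>k\<close> tends to infinity with the accumulated load up to \<open>l + 1\<close> as majorant.
\<close>

lemma optional_stopping:
  assumes z: "0 \<le> fst z" "0 \<le> snd z" and S: "real_stopping S" and T: "real_stopping T"
    and ST: "\<And>\<omega>. \<omega> \<in> space M \<Longrightarrow> S \<omega> \<le> T \<omega>" and bnd: "\<And>\<omega>. \<omega> \<in> space M \<Longrightarrow> T \<omega> \<le> real l"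
  shows "(\<integral>\<^sup>+\<omega>. bellman z (S \<omega>) \<omega> \<partial>M) \<le> (\<integral>\<^sup>+\<omega>. bellman z (T \<omega>) \<omega> \<partial>M)"
proof -
  define G where "G k x = real (nat \<lceil>x * 2 ^ k\<rceil>) / 2 ^ k" for k and x :: real
  have G: "x \<le> G k x" "G k x \<le> x + 1 / 2 ^ k" if "0 \<le> x" for x k
    unfolding G_def using grid_ceiling[OF that] by blast+
  have Sb: "S \<omega> \<le> real l" if "\<omega> \<in> space M" for \<omega> using ST[OF that] bnd[OF that] by linarith
  have Spos: "0 \<le> S \<omega>" and Tpos: "0 \<le> T \<omega>" if "\<omega> \<in> space M" for \<omega>
    using S T that by (auto simp: real_stopping_def)
  have lim: "(\<lambda>k. \<integral>\<^sup>+\<omega>. bellman z (G k (X \<omega>)) \<omega> \<partial>M) \<longlonglongrightarrow> (\<integral>\<^sup>+\<omega>. bellman z (X \<omega>) \<omega> \<partial>M)"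
    if X: "real_stopping X" and Xb: "\<And>\<omega>. \<omega> \<in> space M \<Longrightarrow> X \<omega> \<le> real l" for X
  proof -
    have Xpos: "0 \<le> X \<omega>" if "\<omega> \<in> space M" for \<omega> using X that by (auto simp: real_stopping_def)
    have XM: "X \<in> borel_measurable M" by (rule real_stopping_measurable[OF X])
    have GX: "0 \<le> G k (X \<omega>)" "G k (X \<omega>) \<le> real l + 1" if "\<omega> \<in> space M" for k \<omega>
    proof -
      have "(1::real) / 2 ^ k \<le> 1" by simp
      then show "0 \<le> G k (X \<omega>)" "G k (X \<omega>) \<le> real l + 1"
        using G[OF Xpos[OF that], of k] Xpos[OF that] Xb[OF that] by linarith+
    qed
    have rM: "(\<lambda>\<omega>. run z \<omega> (ennreal (real l + 1))) \<in> borel_measurable M" by (rule run_measurable) simp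
    have fin: "(\<integral>\<^sup>+\<omega>. run z \<omega> (ennreal (real l + 1)) \<partial>M) < \<infinity>" by (rule expected_run_finite[OF _ z]) simp
    show ?thesis
    proof (rule nn_integral_dominated_convergence[where w="\<lambda>\<omega>. run z \<omega> (ennreal (real l + 1)) + stop_cost"])
      have "(\<lambda>\<omega>. G k (X \<omega>)) \<in> borel_measurable M" for k
        unfolding G_def using XM by measurable
      then show "(\<lambda>\<omega>. bellman z (G k (X \<omega>)) \<omega>) \<in> borel_measurable M" for k
        by (rule bellman_measurable) (rule GX)
      show "(\<lambda>\<omega>. bellman z (X \<omega>) \<omega>) \<in> borel_measurable M"
        by (rule bellman_measurable[OF XM Xpos])
      show "(\<lambda>\<omega>. run z \<omega> (ennreal (real l + 1)) + stop_cost) \<in> borel_measurable M"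
        by (rule borel_measurable_add[OF rM borel_measurable_const])
      show "AE \<omega> in M. bellman z (G k (X \<omega>)) \<omega> \<le> run z \<omega> (ennreal (real l + 1)) + stop_cost" for k
        by (rule AE_I2) (rule bellman_le[OF GX])
      show "(\<integral>\<^sup>+\<omega>. run z \<omega> (ennreal (real l + 1)) + stop_cost \<partial>M) < \<infinity>"
        using fin stop_cost_finite by (subst nn_integral_add[OF rM]) (simp_all add: emeasure_space_1)
      have "AE \<omega> in M. run z \<omega> (ennreal (real l + 1)) \<noteq> \<infinity>"
        using nn_integral_PInf_AE[OF rM] fin by simp
      then show "AE \<omega> in M. (\<lambda>k. bellman z (G k (X \<omega>)) \<omega>) \<longlonglongrightarrow> bellman z (X \<omega>) \<omega>"
      proof (rule AE_mp, intro AE_I2 impI)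
        fix \<omega> assume \<omega>: "\<omega> \<in> space M" and "run z \<omega> (ennreal (real l + 1)) \<noteq> \<infinity>"
        then have fin: "run z \<omega> (ennreal (real l + 1)) < \<infinity>" by (simp add: less_top)
        have "(\<lambda>k. G k (X \<omega>)) \<longlonglongrightarrow> X \<omega>"
        proof (rule tendsto_sandwich[OF always_eventually always_eventually tendsto_const])
          show "\<forall>k. X \<omega> \<le> G k (X \<omega>)" "\<forall>k. G k (X \<omega>) \<le> X \<omega> + 1 / 2 ^ k"
            using G[OF Xpos[OF \<omega>]] by blast+
          have "(\<lambda>k. X \<omega> + (1 / 2) ^ k) \<longlonglongrightarrow> X \<omega> + 0"
            by (intro tendsto_add tendsto_const LIMSEQ_realpow_zero) simp_all
          then show "(\<lambda>k. X \<omega> + 1 / 2 ^ k) \<longlonglongrightarrow> X \<omega>" by (simp add: power_divide)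
        qed
        then show "(\<lambda>k. bellman z (G k (X \<omega>)) \<omega>) \<longlonglongrightarrow> bellman z (X \<omega>) \<omega>"
          by (rule bellman_tendsto_right[OF \<omega> _ Xpos[OF \<omega>] GX(2)[OF \<omega>] G(1)[OF Xpos[OF \<omega>]] fin])
      qed
    qed
  qed
  show ?thesis
  proof (rule LIMSEQ_le[OF lim[OF S Sb] lim[OF T bnd]])
    show "\<exists>N. \<forall>k\<ge>N. (\<integral>\<^sup>+\<omega>. bellman z (G k (S \<omega>)) \<omega> \<partial>M) \<le> (\<integral>\<^sup>+\<omega>. bellman z (G k (T \<omega>)) \<omega> \<partial>M)"
    proof (intro exI allI impI)
      fix k
      have ev: "{\<omega>\<in>space M. nat \<lceil>X \<omega> * 2 ^ k\<rceil> \<le> i} \<in> sets (F (ennreal (real i / 2 ^ k)))"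
        if X: "real_stopping X" for X i
      proof -
        have "{\<omega>\<in>space M. nat \<lceil>X \<omega> * 2 ^ k\<rceil> \<le> i} = {\<omega>\<in>space M. X \<omega> \<le> real i / 2 ^ k}"
          using grid_ceiling(3) X unfolding real_stopping_def by blast
        moreover have "0 \<le> real i / 2 ^ k" by simp
        ultimately show ?thesis using X unfolding real_stopping_def by simp
      qed
      show "(\<integral>\<^sup>+\<omega>. bellman z (G k (S \<omega>)) \<omega> \<partial>M) \<le> (\<integral>\<^sup>+\<omega>. bellman z (G k (T \<omega>)) \<omega> \<partial>M)"
        unfolding G_def
      proof (rule discrete_submartingale[OF z])
        fix \<omega> assume \<omega>: "\<omega> \<in> space M"
        show "nat \<lceil>S \<omega> * 2 ^ k\<rceil> \<le> nat \<lceil>T \<omega> * 2 ^ k\<rceil>"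
          by (intro nat_mono ceiling_mono mult_right_mono ST[OF \<omega>]) simp
        have "T \<omega> \<le> real (l * 2 ^ k) / 2 ^ k" using bnd[OF \<omega>] by simp
        then show "nat \<lceil>T \<omega> * 2 ^ k\<rceil> \<le> l * 2 ^ k"
          unfolding grid_ceiling(3)[OF Tpos[OF \<omega>]] .
      qed (rule ev[OF S], rule ev[OF T])
    qed
  qed
qed

section \<open>The lower bound for extended stopping times\<close>

lemma stopping_measurable: "stopping_time F \<tau> \<Longrightarrow> \<tau> \<in> borel_measurable M"
  by (rule measurable_stopping_time[where F=F]) (simp_all add: sets_F_subset)

lemma stopping_le_F: "stopping_time F \<tau> \<Longrightarrow> {\<omega>\<in>space M. \<tau> \<omega> \<le> t} \<in> sets (F t)"
  using stopping_timeD[of F \<tau> t] by (simp add: pred_def)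

lemma real_stopping_enn2real:
  assumes \<tau>: "stopping_time F \<tau>" and fin: "\<And>\<omega>. \<omega> \<in> space M \<Longrightarrow> \<tau> \<omega> \<noteq> \<infinity>"
  shows "real_stopping (\<lambda>\<omega>. enn2real (\<tau> \<omega>))"
  unfolding real_stopping_def
proof (intro conjI ballI allI impI)
  fix t :: real assume t: "0 \<le> t"
  have "enn2real (\<tau> \<omega>) \<le> t \<longleftrightarrow> \<tau> \<omega> \<le> ennreal t" if "\<omega> \<in> space M" for \<omega>
    using fin[OF that] t by (cases "\<tau> \<omega>") (auto simp: ennreal_le_iff)
  then have "{\<omega>\<in>space M. enn2real (\<tau> \<omega>) \<le> t} = {\<omega>\<in>space M. \<tau> \<omega> \<le> ennreal t}" by blast
  then show "{\<omega>\<in>space M. enn2real (\<tau> \<omega>) \<le> t} \<in> sets (F (ennreal t))" using stopping_le_F[OF \<tau>] by simp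
qed (rule enn2real_nonneg)

text \<open>
  At an infinite time \<open>enn2real\<close> returns 0, but the discount factor vanishes there, so the product has the
  correct value 0.
\<close>

definition stopped_value :: "real \<times> real \<Rightarrow> ('a \<Rightarrow> ennreal) \<Rightarrow> 'a \<Rightarrow> ennreal" where
  "stopped_value z \<tau> \<omega> = disc (\<tau> \<omega>) * w (\<Phi> z (enn2real (\<tau> \<omega>)) \<omega>)"

lemma stopped_value_measurable:
  assumes \<tau>: "\<tau> \<in> borel_measurable M"
  shows "stopped_value z \<tau> \<in> borel_measurable M"
  unfolding stopped_value_def[abs_def]
  by (intro borel_measurable_times_ennreal measurable_compose[OF \<tau> disc_measurable]
      measurable_compose[OF \<Phi>_time_measurable w_measurable] measurable_compose[OF \<tau> borel_measurable_enn2real])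
    (simp_all add: enn2real_nonneg)

lemma stopped_value_le: "stopped_value z \<tau> \<omega> \<le> disc (\<tau> \<omega>) * stop_cost"
  unfolding stopped_value_def by (intro mult_left_mono w_le_stop_cost) simp

lemma optional_stopping_bounded:
  assumes z: "0 \<le> fst z" "0 \<le> snd z" and S: "stopping_time F S" and T: "stopping_time F T"
    and ST: "\<And>\<omega>. \<omega> \<in> space M \<Longrightarrow> S \<omega> \<le> T \<omega>" and bnd: "\<And>\<omega>. \<omega> \<in> space M \<Longrightarrow> T \<omega> \<le> ennreal (real l)"
  shows "(\<integral>\<^sup>+\<omega>. run z \<omega> (S \<omega>) + stopped_value z S \<omega> \<partial>M) \<le> (\<integral>\<^sup>+\<omega>. run z \<omega> (T \<omega>) + stopped_value z T \<omega> \<partial>M)"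
proof -
  have Tfin: "T \<omega> < \<infinity>" if "\<omega> \<in> space M" for \<omega> using bnd[OF that] by (rule le_less_trans) simp
  have Sfin: "S \<omega> < \<infinity>" if "\<omega> \<in> space M" for \<omega> using ST[OF that] Tfin[OF that] by (rule le_less_trans)
  have eq: "(\<integral>\<^sup>+\<omega>. run z \<omega> (\<tau> \<omega>) + stopped_value z \<tau> \<omega> \<partial>M) = (\<integral>\<^sup>+\<omega>. bellman z (enn2real (\<tau> \<omega>)) \<omega> \<partial>M)"
    if "\<And>\<omega>. \<omega> \<in> space M \<Longrightarrow> \<tau> \<omega> < \<infinity>" for \<tau>
    by (rule nn_integral_cong) (use that in \<open>simp add: bellman_def stopped_value_def\<close>)
  have "(\<integral>\<^sup>+\<omega>. bellman z (enn2real (S \<omega>)) \<omega> \<partial>M) \<le> (\<integral>\<^sup>+\<omega>. bellman z (enn2real (T \<omega>)) \<omega> \<partial>M)"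
  proof (rule optional_stopping[OF z])
    show "real_stopping (\<lambda>\<omega>. enn2real (S \<omega>))" by (rule real_stopping_enn2real[OF S]) (use Sfin in force)
    show "real_stopping (\<lambda>\<omega>. enn2real (T \<omega>))" by (rule real_stopping_enn2real[OF T]) (use Tfin in force)
    fix \<omega> assume \<omega>: "\<omega> \<in> space M"
    show "enn2real (S \<omega>) \<le> enn2real (T \<omega>)" by (rule enn2real_mono[OF ST[OF \<omega>]]) (use Tfin[OF \<omega>] in simp)
    have "enn2real (T \<omega>) \<le> enn2real (ennreal (real l))" by (rule enn2real_mono[OF bnd[OF \<omega>]]) simp
    then show "enn2real (T \<omega>) \<le> real l" by simp
  qed
  then show ?thesis using eq[of S, OF Sfin] eq[of T, OF Tfin] by (simp only:)
qed

text \<open>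
  For a stopping time truncated at \<open>l\<close> this is optional stopping between 0 and a bounded time.  As \<open>l\<close>
  grows, discounting makes the contribution of paths that have not stopped disappear.
\<close>

lemma w_le_run_plus_stopped:
  assumes z: "0 \<le> fst z" "0 \<le> snd z" and \<tau>: "stopping_time F \<tau>"
  shows "w z \<le> (\<integral>\<^sup>+\<omega>. run z \<omega> (\<tau> \<omega>) + stopped_value z \<tau> \<omega> \<partial>M)"
proof -
  have \<tau>M: "\<tau> \<in> borel_measurable M" by (rule stopping_measurable[OF \<tau>])
  have rM: "(\<lambda>\<omega>. run z \<omega> (\<tau> \<omega>)) \<in> borel_measurable M" by (rule run_measurable[OF \<tau>M])
  define T where "T l \<omega> = min (\<tau> \<omega>) (ennreal (real l))" for l \<omega>
  have T: "stopping_time F (T l)" for l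
    unfolding T_def by (rule stopping_time_min[OF \<tau> stopping_time_const])
  have TM: "T l \<in> borel_measurable M" for l by (rule stopping_measurable[OF T])
  have w0: "w z = (\<integral>\<^sup>+\<omega>. run z \<omega> 0 + stopped_value z (\<lambda>_. 0) \<omega> \<partial>M)"
  proof -
    have "(\<integral>\<^sup>+\<omega>. run z \<omega> 0 + stopped_value z (\<lambda>_. 0) \<omega> \<partial>M) = (\<integral>\<^sup>+\<omega>. w z \<partial>M)"
      by (rule nn_integral_cong) (simp add: stopped_value_def)
    then show ?thesis by (simp add: emeasure_space_1)
  qed
  have bound: "w z \<le> (\<integral>\<^sup>+\<omega>. run z \<omega> (\<tau> \<omega>) \<partial>M) + (\<integral>\<^sup>+\<omega>. stopped_value z (T l) \<omega> \<partial>M)" for l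
  proof -
    have "w z \<le> (\<integral>\<^sup>+\<omega>. run z \<omega> (T l \<omega>) + stopped_value z (T l) \<omega> \<partial>M)"
      unfolding w0 by (rule optional_stopping_bounded[where l=l, OF z stopping_time_const T]) (simp_all add: T_def)
    also have "\<dots> \<le> (\<integral>\<^sup>+\<omega>. run z \<omega> (\<tau> \<omega>) + stopped_value z (T l) \<omega> \<partial>M)"
      by (intro nn_integral_mono add_right_mono run_mono) (simp add: T_def)
    also have "\<dots> = (\<integral>\<^sup>+\<omega>. run z \<omega> (\<tau> \<omega>) \<partial>M) + (\<integral>\<^sup>+\<omega>. stopped_value z (T l) \<omega> \<partial>M)"
      by (rule nn_integral_add[OF rM stopped_value_measurable[OF TM]])
    finally show ?thesis .
  qed
  have lim: "(\<lambda>l. \<integral>\<^sup>+\<omega>. stopped_value z (T l) \<omega> \<partial>M) \<longlonglongrightarrow> (\<integral>\<^sup>+\<omega>. stopped_value z \<tau> \<omega> \<partial>M)"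
  proof (rule nn_integral_dominated_convergence[where w="\<lambda>_. stop_cost"])
    show "stopped_value z (T l) \<in> borel_measurable M" for l by (rule stopped_value_measurable[OF TM])
    show "stopped_value z \<tau> \<in> borel_measurable M" by (rule stopped_value_measurable[OF \<tau>M])
    show "AE \<omega> in M. stopped_value z (T l) \<omega> \<le> stop_cost" for l
      by (rule AE_I2) (unfold stopped_value_def, rule disc_mult_le[OF w_le_stop_cost])
    show "(\<integral>\<^sup>+\<omega>. stop_cost \<partial>M) < \<infinity>" using stop_cost_finite by (simp add: emeasure_space_1)
    show "AE \<omega> in M. (\<lambda>l. stopped_value z (T l) \<omega>) \<longlonglongrightarrow> stopped_value z \<tau> \<omega>"
    proof (rule AE_I2)
      fix \<omega>
      show "(\<lambda>l. stopped_value z (T l) \<omega>) \<longlonglongrightarrow> stopped_value z \<tau> \<omega>"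
      proof (cases "\<tau> \<omega>")
        case (real t)
        have "\<forall>\<^sub>F l in sequentially. t \<le> real l" using filterlim_real_sequentially unfolding filterlim_at_top by blast
        then have "\<forall>\<^sub>F l in sequentially. stopped_value z (T l) \<omega> = stopped_value z \<tau> \<omega>"
        proof eventually_elim
          case (elim l)
          have "T l \<omega> = \<tau> \<omega>" unfolding T_def by (rule min_absorb1) (use elim real in \<open>simp add: ennreal_leI\<close>)
          then show ?case by (simp only: stopped_value_def)
        qed
        then show ?thesis by (rule tendsto_eventually)
      next
        case top
        have "(\<lambda>l. ennreal (exp (- lam * real l)) * stop_cost) \<longlonglongrightarrow> ennreal 0 * stop_cost"
        proof (rule tendsto_mult_ennreal)
          show "(\<lambda>l. ennreal (exp (- lam * real l))) \<longlonglongrightarrow> ennreal 0"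
          proof (rule tendsto_ennrealI)
            have "exp (- lam * real l) = exp (- lam) ^ l" for l
              by (simp add: exp_of_nat_mult[symmetric] mult.commute)
            moreover have "(\<lambda>l. exp (- lam) ^ l) \<longlonglongrightarrow> 0" using lam_pos by (intro LIMSEQ_realpow_zero) auto
            ultimately show "(\<lambda>l. exp (- lam * real l)) \<longlonglongrightarrow> 0" by (simp only:)
          qed
        qed (use stop_cost_finite in auto)
        then have up: "(\<lambda>l. ennreal (exp (- lam * real l)) * stop_cost) \<longlonglongrightarrow> 0" by simp
        have "(\<lambda>l. stopped_value z (T l) \<omega>) \<longlonglongrightarrow> 0"
        proof (rule tendsto_sandwich[OF _ _ tendsto_const up])
          show "\<forall>\<^sub>F l in sequentially. stopped_value z (T l) \<omega> \<le> ennreal (exp (- lam * real l)) * stop_cost"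
          proof (rule always_eventually, rule allI)
            fix l
            have "T l \<omega> = ennreal (real l)" using top by (simp add: T_def)
            with stopped_value_le[of z "T l" \<omega>]
            show "stopped_value z (T l) \<omega> \<le> ennreal (exp (- lam * real l)) * stop_cost"
              by (simp only: disc_ennreal[OF of_nat_0_le_iff])
          qed
        qed simp
        then show ?thesis using top by (simp add: stopped_value_def disc_def)
      qed
    qed
  qed simp
  have "w z \<le> (\<integral>\<^sup>+\<omega>. run z \<omega> (\<tau> \<omega>) \<partial>M) + (\<integral>\<^sup>+\<omega>. stopped_value z \<tau> \<omega> \<partial>M)"
    by (rule LIMSEQ_le_const[OF tendsto_add[OF tendsto_const lim]], rule exI[of _ 0]) (simp add: bound)
  also have "\<dots> = (\<integral>\<^sup>+\<omega>. run z \<omega> (\<tau> \<omega>) + stopped_value z \<tau> \<omega> \<partial>M)"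
    by (rule nn_integral_add[symmetric, OF rM stopped_value_measurable[OF \<tau>M]])
  finally show ?thesis .
qed

section \<open>Near-optimal stopping on dyadic grids\<close>

text \<open>
  The shifted cost; \<open>expected_cost_eq_J\<close> relates it to the original one.
\<close>

definition J :: "('a \<Rightarrow> ennreal) \<Rightarrow> real \<times> real \<Rightarrow> ennreal" where
  "J \<tau> z = (\<integral>\<^sup>+\<omega>. run z \<omega> (\<tau> \<omega>) + disc (\<tau> \<omega>) * stop_cost \<partial>M)"

text \<open>
  The optimal rule for \<open>bermudan k n\<close> from grid point \<open>i\<close> on, by backward recursion: continue as long as
  the value is strictly below the cost of stopping.
\<close>

primrec grid_stop :: "nat \<Rightarrow> real \<times> real \<Rightarrow> nat \<Rightarrow> nat \<Rightarrow> 'a \<Rightarrow> nat" where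
  "grid_stop k z 0 = (\<lambda>i \<omega>. i)"
| "grid_stop k z (Suc n) = (\<lambda>i \<omega>.
     if bermudan k (Suc n) (\<Phi> z (real i / 2 ^ k) \<omega>) < stop_cost then grid_stop k z n (Suc i) \<omega> else i)"

lemma grid_stop_Suc: "grid_stop k z (Suc n) i \<omega> =
    (if bermudan k (Suc n) (\<Phi> z (real i / 2 ^ k) \<omega>) < stop_cost then grid_stop k z n (Suc i) \<omega> else i)"
  by (simp only: grid_stop.simps(2))

lemma grid_stop_bounds: "i \<le> grid_stop k z n i \<omega>" "grid_stop k z n i \<omega> \<le> i + n"
proof -
  have "i \<le> grid_stop k z n i \<omega> \<and> grid_stop k z n i \<omega> \<le> i + n"
  proof (induction n arbitrary: i)
    case (Suc n)
    show ?case unfolding grid_stop_Suc using Suc[of "Suc i"] by auto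
  qed simp
  then show "i \<le> grid_stop k z n i \<omega>" "grid_stop k z n i \<omega> \<le> i + n" by auto
qed

lemma grid_F_mono: "i \<le> j \<Longrightarrow> sets (F (ennreal (real i / 2 ^ k))) \<subseteq> sets (F (ennreal (real j / 2 ^ k)))"
  by (intro sets_F_mono ennreal_leI divide_right_mono) simp_all

lemma continue_event:
  "{\<omega>\<in>space M. bermudan k n (\<Phi> z (real i / 2 ^ k) \<omega>) < stop_cost} \<in> sets (F (ennreal (real i / 2 ^ k)))"
proof -
  have "(\<lambda>\<omega>. bermudan k n (\<Phi> z (real i / 2 ^ k) \<omega>)) \<in> borel_measurable (F (ennreal (real i / 2 ^ k)))"
    by (rule measurable_compose[OF \<Phi>_measurable_F value_likeD(2)[OF value_like_bermudan]]) simp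
  from measurable_sets[OF this, of "{..<stop_cost}"] show ?thesis
    by (simp add: vimage_def Int_def conj_commute)
qed

lemma grid_stop_event: "{\<omega>\<in>space M. grid_stop k z n i \<omega> \<le> j} \<in> sets (F (ennreal (real j / 2 ^ k)))"
proof (induction n arbitrary: i)
  case 0
  show ?case using sets.top[of "F (ennreal (real j / 2 ^ k))"] by (cases "i \<le> j") simp_all
next
  case (Suc n)
  show ?case
  proof (cases "i \<le> j")
    case True
    let ?B = "{\<omega>\<in>space M. bermudan k (Suc n) (\<Phi> z (real i / 2 ^ k) \<omega>) < stop_cost}"
    have B: "?B \<in> sets (F (ennreal (real j / 2 ^ k)))" using continue_event grid_F_mono[OF True] by blast
    have "{\<omega>\<in>space M. grid_stop k z (Suc n) i \<omega> \<le> j} =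
        (?B \<inter> {\<omega>\<in>space M. grid_stop k z n (Suc i) \<omega> \<le> j}) \<union> (space (F (ennreal (real j / 2 ^ k))) - ?B)"
      unfolding grid_stop_Suc space_F using True by auto
    then show ?thesis using B Suc[of "Suc i"] by (simp only: sets.Un sets.Int sets.compl_sets)
  next
    case False
    then have "{\<omega>\<in>space M. grid_stop k z (Suc n) i \<omega> \<le> j} = {}"
      using order_trans[OF grid_stop_bounds(1)] by blast
    then show ?thesis by (simp only: sets.empty_sets)
  qed
qed

lemma cost_at_measurable:
  assumes \<tau>: "\<tau> \<in> borel_measurable M"
  shows "(\<lambda>\<omega>. run z \<omega> (\<tau> \<omega>) + disc (\<tau> \<omega>) * stop_cost) \<in> borel_measurable M"
  by (rule borel_measurable_add[OF run_measurable[OF \<tau>]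
      borel_measurable_times_ennreal[OF measurable_compose[OF \<tau> disc_measurable] borel_measurable_const]])

lemma grid_stop_measurable: "(\<lambda>\<omega>. ennreal (real (grid_stop k z n i \<omega>) / 2 ^ k)) \<in> borel_measurable M"
  by (rule measurable_compose[OF grid_time_measurable[OF grid_stop_event]]) simp

text \<open>
  Backward induction.  The event \<open>A\<close> is needed in the induction because the decision at the current grid
  point restricts the paths on which the induction hypothesis is applied.
\<close>

lemma grid_stop_cost:
  assumes z: "0 \<le> fst z" "0 \<le> snd z" and A: "A \<in> sets (F (ennreal (real i / 2 ^ k)))"
  shows "(\<integral>\<^sup>+\<omega>. indicator A \<omega> * (run z \<omega> (ennreal (real (grid_stop k z n i \<omega>) / 2 ^ k)) +
      disc (ennreal (real (grid_stop k z n i \<omega>) / 2 ^ k)) * stop_cost) \<partial>M) =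
    (\<integral>\<^sup>+\<omega>. indicator A \<omega> * (run z \<omega> (ennreal (real i / 2 ^ k)) +
      disc (ennreal (real i / 2 ^ k)) * bermudan k n (\<Phi> z (real i / 2 ^ k) \<omega>)) \<partial>M)"
  using A
proof (induction n arbitrary: i A)
  case 0 show ?case by simp
next
  case (Suc n)
  let ?s = "real i / 2 ^ k"
  let ?s' = "real (Suc i) / 2 ^ k"
  define C where "C n i \<omega> = run z \<omega> (ennreal (real (grid_stop k z n i \<omega>) / 2 ^ k)) +
      disc (ennreal (real (grid_stop k z n i \<omega>) / 2 ^ k)) * stop_cost" for n i \<omega>
  define D where "D n i \<omega> = run z \<omega> (ennreal (real i / 2 ^ k)) +
      disc (ennreal (real i / 2 ^ k)) * bermudan k n (\<Phi> z (real i / 2 ^ k) \<omega>)" for n i \<omega>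
  let ?B = "{\<omega>\<in>space M. bermudan k (Suc n) (\<Phi> z ?s \<omega>) < stop_cost}"
  have B: "?B \<in> sets (F (ennreal ?s))" by (rule continue_event)
  have AB: "A \<inter> ?B \<in> sets (F (ennreal ?s))" using Suc.prems B by (rule sets.Int)
  have BM: "?B \<in> events" using B sets_F_subset by blast
  have AM: "A \<in> events" using Suc.prems sets_F_subset by blast
  have iA: "indicator A \<in> borel_measurable M" by (rule borel_measurable_indicator[OF AM])
  have CM: "(\<lambda>\<omega>. indicator A \<omega> * C (Suc n) i \<omega>) \<in> borel_measurable M"
    unfolding C_def by (intro borel_measurable_times_ennreal iA cost_at_measurable grid_stop_measurable)
  have DM: "(\<lambda>\<omega>. indicator A \<omega> * D (Suc n) i \<omega>) \<in> borel_measurable M"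
    unfolding D_def by (intro borel_measurable_times_ennreal iA cost_measurable value_likeD(2)[OF value_like_bermudan]) simp
  have "(\<integral>\<^sup>+\<omega>. indicator ?B \<omega> * (indicator A \<omega> * C (Suc n) i \<omega>) \<partial>M) = (\<integral>\<^sup>+\<omega>. indicator (A \<inter> ?B) \<omega> * C n (Suc i) \<omega> \<partial>M)"
    unfolding C_def grid_stop_Suc by (rule nn_integral_cong) (auto simp: indicator_def)
  also have "\<dots> = (\<integral>\<^sup>+\<omega>. indicator (A \<inter> ?B) \<omega> * D n (Suc i) \<omega> \<partial>M)"
    unfolding C_def D_def by (rule Suc.IH) (use AB grid_F_mono[of i "Suc i" k] in auto)
  also have "\<dots> = (\<integral>\<^sup>+\<omega>. indicator (A \<inter> ?B) \<omega> * (run z \<omega> (ennreal ?s) + disc (ennreal ?s) * Q (1 / 2 ^ k) (bermudan k n) (\<Phi> z ?s \<omega>)) \<partial>M)"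
  proof -
    have s: "?s + 1 / 2 ^ k = ?s'" by (simp add: add_divide_distrib)
    show ?thesis
      unfolding D_def
      using markov_step[of ?s "1 / 2 ^ k" "A \<inter> ?B" "bermudan k n" z, OF _ _ AB value_likeD(2)[OF value_like_bermudan] z]
      unfolding s by simp
  qed
  also have "\<dots> = (\<integral>\<^sup>+\<omega>. indicator ?B \<omega> * (indicator A \<omega> * D (Suc n) i \<omega>) \<partial>M)"
  proof (rule nn_integral_cong)
    fix \<omega>
    show "indicator (A \<inter> ?B) \<omega> * (run z \<omega> (ennreal ?s) + disc (ennreal ?s) * Q (1 / 2 ^ k) (bermudan k n) (\<Phi> z ?s \<omega>)) =
        indicator ?B \<omega> * (indicator A \<omega> * D (Suc n) i \<omega>)"
    proof (cases "\<omega> \<in> ?B")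
      case True
      then have "bermudan k (Suc n) (\<Phi> z ?s \<omega>) = Q (1 / 2 ^ k) (bermudan k n) (\<Phi> z ?s \<omega>)"
        unfolding bermudan_Suc by (auto simp: min_def split: if_splits)
      then show ?thesis using True unfolding D_def by (simp add: indicator_inter_arith mult_ac del: bermudan.simps)
    qed (simp add: indicator_inter_arith)
  qed
  finally have 1: "(\<integral>\<^sup>+\<omega>. indicator ?B \<omega> * (indicator A \<omega> * C (Suc n) i \<omega>) \<partial>M) =
      (\<integral>\<^sup>+\<omega>. indicator ?B \<omega> * (indicator A \<omega> * D (Suc n) i \<omega>) \<partial>M)" .
  have 2: "(\<integral>\<^sup>+\<omega>. indicator (space M - ?B) \<omega> * (indicator A \<omega> * C (Suc n) i \<omega>) \<partial>M) =
      (\<integral>\<^sup>+\<omega>. indicator (space M - ?B) \<omega> * (indicator A \<omega> * D (Suc n) i \<omega>) \<partial>M)"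
  proof (rule nn_integral_cong)
    fix \<omega>
    show "indicator (space M - ?B) \<omega> * (indicator A \<omega> * C (Suc n) i \<omega>) =
      indicator (space M - ?B) \<omega> * (indicator A \<omega> * D (Suc n) i \<omega>)"
    proof (cases "\<omega> \<in> space M - ?B")
      case True
      then have nl: "\<not> bermudan k (Suc n) (\<Phi> z ?s \<omega>) < stop_cost" by blast
      then have "bermudan k (Suc n) (\<Phi> z ?s \<omega>) = stop_cost"
        using value_likeD(3)[OF value_like_bermudan, of k "Suc n" "\<Phi> z ?s \<omega>"] by (simp only: not_less antisym)
      then have "C (Suc n) i \<omega> = D (Suc n) i \<omega>"
        unfolding C_def D_def grid_stop_Suc by (simp del: bermudan.simps)
      then show ?thesis by (simp only:)
    next
      case False
      then have "indicator (space M - ?B) \<omega> = (0 :: ennreal)" by (rule indicator_simps(2))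
      then show ?thesis by (simp only: mult_zero_left)
    qed
  qed
  have "(\<integral>\<^sup>+\<omega>. indicator A \<omega> * C (Suc n) i \<omega> \<partial>M) = (\<integral>\<^sup>+\<omega>. indicator A \<omega> * D (Suc n) i \<omega> \<partial>M)"
    unfolding nn_integral_split_set[OF BM CM] nn_integral_split_set[OF BM DM] 1 2 ..
  then show ?case unfolding C_def D_def .
qed

lemma stopping_time_grid_stop: "stopping_time F (\<lambda>\<omega>. ennreal (real (grid_stop k z n i \<omega>) / 2 ^ k))"
proof
  fix s :: ennreal
  show "Measurable.pred (F s) (\<lambda>\<omega>. ennreal (real (grid_stop k z n i \<omega>) / 2 ^ k) \<le> s)"
  proof (cases s)
    case top
    then have "(\<lambda>\<omega>. ennreal (real (grid_stop k z n i \<omega>) / 2 ^ k) \<le> s) = (\<lambda>\<omega>. True)" by simp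
    then show ?thesis by (simp only: measurable_const UNIV_I space_count_space)
  next
    case (real u)
    define j where "j = nat \<lfloor>u * 2 ^ k\<rfloor>"
    have u0: "0 \<le> u * 2 ^ k" using real by simp
    have le_iff: "ennreal (real q / 2 ^ k) \<le> s \<longleftrightarrow> q \<le> j" for q :: nat
    proof -
      have "ennreal (real q / 2 ^ k) \<le> s \<longleftrightarrow> real q / 2 ^ k \<le> u"
        unfolding real(2) by (rule ennreal_le_iff[OF real(1)])
      also have "\<dots> \<longleftrightarrow> real q \<le> u * 2 ^ k" by (simp add: pos_divide_le_eq)
      also have "\<dots> \<longleftrightarrow> q \<le> j" unfolding j_def using u0 by (simp add: le_nat_iff le_floor_iff)
      finally show ?thesis .
    qed
    have js: "ennreal (real j / 2 ^ k) \<le> s" unfolding le_iff by simp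
    have "{\<omega>\<in>space M. grid_stop k z n i \<omega> \<le> j} \<in> sets (F s)"
      using grid_stop_event sets_F_mono[OF js] by blast
    then show ?thesis unfolding le_iff pred_def space_F .
  qed
qed

lemma J_grid_stop:
  assumes z: "0 \<le> fst z" "0 \<le> snd z"
  shows "J (\<lambda>\<omega>. ennreal (real (grid_stop k z n 0 \<omega>) / 2 ^ k)) z = bermudan k n z"
proof -
  have sp: "space M \<in> sets (F (ennreal (real 0 / 2 ^ k)))" using sets.top[of "F (ennreal (real 0 / 2 ^ k))"] by simp
  have "J (\<lambda>\<omega>. ennreal (real (grid_stop k z n 0 \<omega>) / 2 ^ k)) z =
      (\<integral>\<^sup>+\<omega>. indicator (space M) \<omega> * (run z \<omega> (ennreal (real (grid_stop k z n 0 \<omega>) / 2 ^ k)) +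
      disc (ennreal (real (grid_stop k z n 0 \<omega>) / 2 ^ k)) * stop_cost) \<partial>M)"
    unfolding J_def by (rule nn_integral_cong) simp
  also have "\<dots> = (\<integral>\<^sup>+\<omega>. indicator (space M) \<omega> * (run z \<omega> (ennreal (real 0 / 2 ^ k)) +
      disc (ennreal (real 0 / 2 ^ k)) * bermudan k n (\<Phi> z (real 0 / 2 ^ k) \<omega>)) \<partial>M)"
    by (rule grid_stop_cost[OF z sp])
  also have "\<dots> = (\<integral>\<^sup>+\<omega>. bermudan k n z \<partial>M)"
    by (rule nn_integral_cong) simp
  finally show ?thesis by (simp add: emeasure_space_1)
qed

text \<open>
  The values on the grids are attained and their infimum is \<open>w\<close>.
\<close>

lemma near_optimal:
  assumes z: "0 \<le> fst z" "0 \<le> snd z" and e: "0 < e"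
  shows "\<exists>\<tau>. stopping_time F \<tau> \<and> (\<exists>l::nat. \<forall>\<omega>. \<tau> \<omega> \<le> ennreal (real l)) \<and> J \<tau> z \<le> w z + ennreal e"
proof -
  have "w z < top" using w_le_stop_cost[of z] stop_cost_finite by (rule le_less_trans)
  then have "w z < w z + ennreal e" using e by (cases "w z") (simp_all add: ennreal_plus[symmetric] ennreal_less_iff del: ennreal_plus)
  then obtain j where j: "approx j z < w z + ennreal e" unfolding w_def[of z] INF_less_iff by blast
  let ?n = "j * 2 ^ j"
  let ?\<tau> = "\<lambda>\<omega>. ennreal (real (grid_stop j z ?n 0 \<omega>) / 2 ^ j)"
  have "?\<tau> \<omega> \<le> ennreal (real j)" for \<omega>
  proof (rule ennreal_leI)
    have "real (grid_stop j z ?n 0 \<omega>) \<le> real ?n" using grid_stop_bounds(2)[of j z ?n 0 \<omega>] by (simp only: of_nat_le_iff add_0)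
    then have "real (grid_stop j z ?n 0 \<omega>) \<le> real j * 2 ^ j" by simp
    then show "real (grid_stop j z ?n 0 \<omega>) / 2 ^ j \<le> real j" by (simp add: pos_divide_le_eq)
  qed
  moreover have "J ?\<tau> z \<le> w z + ennreal e" unfolding J_grid_stop[OF z] using j unfolding approx_def by (rule less_imp_le)
  ultimately show ?thesis using stopping_time_grid_stop[of j z ?n 0] by blast
qed

section \<open>Contact sets and the optimal stopping time\<close>

text \<open>
  What is lost by stopping at \<open>\<tau>\<close> compared with continuing optimally from there.
\<close>

definition gap :: "real \<times> real \<Rightarrow> ('a \<Rightarrow> ennreal) \<Rightarrow> 'a \<Rightarrow> ennreal" where
  "gap z \<tau> \<omega> = disc (\<tau> \<omega>) * (stop_cost - w (\<Phi> z (enn2real (\<tau> \<omega>)) \<omega>))"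

lemma gap_measurable:
  assumes \<tau>: "\<tau> \<in> borel_measurable M"
  shows "gap z \<tau> \<in> borel_measurable M"
proof -
  have "(\<lambda>\<omega>. enn2real (\<tau> \<omega>)) \<in> borel_measurable M" using \<tau> by simp
  from measurable_compose[OF \<Phi>_time_measurable[OF this] w_measurable]
  have 1: "(\<lambda>\<omega>. w (\<Phi> z (enn2real (\<tau> \<omega>)) \<omega>)) \<in> borel_measurable M" by simp
  have 2: "(\<lambda>\<omega>. stop_cost - w (\<Phi> z (enn2real (\<tau> \<omega>)) \<omega>)) \<in> borel_measurable M"
    using 1 by measurable
  show ?thesis unfolding gap_def[abs_def]
    by (rule borel_measurable_times_ennreal[OF measurable_compose[OF \<tau> disc_measurable] 2])
qed

lemma stopped_value_add_gap: "stopped_value z \<tau> \<omega> + gap z \<tau> \<omega> = disc (\<tau> \<omega>) * stop_cost"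
proof -
  have "w x + (stop_cost - w x) = stop_cost" for x
    using diff_add_cancel_ennreal[OF w_le_stop_cost, of x] by (simp add: add.commute)
  then show ?thesis unfolding stopped_value_def gap_def distrib_left[symmetric] by (simp only:)
qed

text \<open>
  The expected excess of \<open>J \<tau>\<close> over \<open>w\<close> has two nonnegative sources: the submartingale may have
  increased, and \<open>\<tau>\<close> may stop outside the contact set.
\<close>

lemma J_split:
  assumes \<tau>: "\<tau> \<in> borel_measurable M"
  shows "J \<tau> z = (\<integral>\<^sup>+\<omega>. run z \<omega> (\<tau> \<omega>) + stopped_value z \<tau> \<omega> \<partial>M) + (\<integral>\<^sup>+\<omega>. gap z \<tau> \<omega> \<partial>M)"
proof -
  have "J \<tau> z = (\<integral>\<^sup>+\<omega>. (run z \<omega> (\<tau> \<omega>) + stopped_value z \<tau> \<omega>) + gap z \<tau> \<omega> \<partial>M)"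
    unfolding J_def by (rule nn_integral_cong) (simp add: add.assoc stopped_value_add_gap)
  also have "\<dots> = (\<integral>\<^sup>+\<omega>. run z \<omega> (\<tau> \<omega>) + stopped_value z \<tau> \<omega> \<partial>M) + (\<integral>\<^sup>+\<omega>. gap z \<tau> \<omega> \<partial>M)"
    by (rule nn_integral_add[OF borel_measurable_add[OF run_measurable[OF \<tau>] stopped_value_measurable[OF \<tau>]] gap_measurable[OF \<tau>]])
  finally show ?thesis .
qed

text \<open>
  The states at which stopping is optimal up to an error \<open>e\<close>.  For \<open>e = 0\<close> this is where \<open>V\<close> vanishes.
\<close>

definition contact :: "real \<Rightarrow> (real \<times> real) set" where
  "contact e = {x. stop_cost \<le> w x + ennreal e}"

lemma closed_contact: "closed (contact e)"
proof -
  have "continuous_on UNIV (\<lambda>x. w x + ennreal e)"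
    by (intro continuous_on_add_ennreal w_continuous continuous_on_const)
  then show ?thesis unfolding contact_def by (intro closed_Collect_le continuous_on_const)
qed

lemma contact_mono: "e \<le> e' \<Longrightarrow> contact e \<subseteq> contact e'"
  unfolding contact_def by (auto intro: order_trans[OF _ add_left_mono[OF ennreal_leI]])

context
  fixes z :: "real \<times> real"
  assumes z: "0 \<le> fst z" "0 \<le> snd z"
begin

lemma w_le_J:
  assumes \<tau>: "stopping_time F \<tau>"
  shows "w z \<le> J \<tau> z"
  unfolding J_split[OF stopping_measurable[OF \<tau>]]
  by (rule add_increasing2[OF zero_le w_le_run_plus_stopped[OF z \<tau>]])

text \<open>
  The submartingale part of \<open>J \<tau>\<close> already uses up \<open>w z\<close>.
\<close>

lemma gap_bound:
  assumes \<tau>: "stopping_time F \<tau>" and le: "J \<tau> z \<le> w z + d" and d: "d < top"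
  shows "(\<integral>\<^sup>+\<omega>. gap z \<tau> \<omega> \<partial>M) \<le> d"
proof -
  let ?A = "\<integral>\<^sup>+\<omega>. run z \<omega> (\<tau> \<omega>) + stopped_value z \<tau> \<omega> \<partial>M"
  let ?G = "\<integral>\<^sup>+\<omega>. gap z \<tau> \<omega> \<partial>M"
  have J: "J \<tau> z = ?A + ?G" by (rule J_split[OF stopping_measurable[OF \<tau>]])
  have wf: "w z < top" using w_le_stop_cost[of z] stop_cost_finite by (rule le_less_trans)
  have "?A + ?G \<le> w z + d" using le unfolding J .
  moreover have "w z + d \<le> ?A + d" by (intro add_right_mono w_le_run_plus_stopped[OF z \<tau>])
  ultimately have 1: "?A + ?G \<le> ?A + d" by (rule order_trans)
  have "?A + ?G < top" by (rule le_less_trans[OF \<open>?A + ?G \<le> w z + d\<close>]) (use wf d in simp)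
  then have "?A \<noteq> \<infinity>" by auto
  with 1 show ?thesis unfolding ennreal_add_left_cancel_le by blast
qed

lemma hit_antimono: "C \<subseteq> C' \<Longrightarrow> hit C' z \<omega> \<le> hit C z \<omega>"
  unfolding hit_def by (rule Inf_superset_mono) auto

lemma hit_in:
  assumes \<omega>: "\<omega> \<in> space M" and C: "closed C" and fin: "hit C z \<omega> < top"
  shows "\<Phi> z (enn2real (hit C z \<omega>)) \<omega> \<in> C"
proof -
  have "hit C z \<omega> \<le> ennreal (enn2real (hit C z \<omega>))" using fin by simp
  then obtain u where u: "0 \<le> u" "\<Phi> z u \<omega> \<in> C" using hit_le_iff[OF \<omega> C enn2real_nonneg] by blast
  from hit_attained[OF \<omega> C this] obtain v where "0 \<le> v" "\<Phi> z v \<omega> \<in> C" "hit C z \<omega> = ennreal v" by blast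
  then show ?thesis by simp
qed

lemma hit_le:
  assumes "0 \<le> t" "\<Phi> z t \<omega> \<in> C"
  shows "hit C z \<omega> \<le> ennreal t"
  unfolding hit_def by (rule Inf_lower) (use assms in blast)

text \<open>
  Stopping earlier lowers the submartingale part, and at the contact set the gap is at most \<open>e\<close>.
\<close>

lemma J_stop_at_contact:
  assumes \<tau>: "stopping_time F \<tau>" and bnd: "\<And>\<omega>. \<tau> \<omega> \<le> ennreal (real l)" and e: "0 \<le> e"
  shows "J (\<lambda>\<omega>. min (\<tau> \<omega>) (hit (contact e) z \<omega>)) z \<le> J \<tau> z + ennreal e"
proof -
  let ?S = "hit (contact e) z" and ?\<rho> = "\<lambda>\<omega>. min (\<tau> \<omega>) (hit (contact e) z \<omega>)"
  have S: "stopping_time F ?S" by (rule stopping_time_hit[OF closed_contact])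
  have \<rho>: "stopping_time F ?\<rho>" by (rule stopping_time_min[OF \<tau> S])
  note \<tau>M = stopping_measurable[OF \<tau>] and \<rho>M = stopping_measurable[OF \<rho>]
  have 1: "(\<integral>\<^sup>+\<omega>. run z \<omega> (?\<rho> \<omega>) + stopped_value z ?\<rho> \<omega> \<partial>M) \<le> (\<integral>\<^sup>+\<omega>. run z \<omega> (\<tau> \<omega>) + stopped_value z \<tau> \<omega> \<partial>M)"
    by (rule optional_stopping_bounded[where l=l, OF z \<rho> \<tau>]) (simp_all add: bnd)
  have "(\<integral>\<^sup>+\<omega>. gap z ?\<rho> \<omega> \<partial>M) \<le> (\<integral>\<^sup>+\<omega>. gap z \<tau> \<omega> + ennreal e \<partial>M)"
  proof (rule nn_integral_mono)
    fix \<omega> assume \<omega>: "\<omega> \<in> space M"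
    show "gap z ?\<rho> \<omega> \<le> gap z \<tau> \<omega> + ennreal e"
    proof (cases "\<tau> \<omega> \<le> ?S \<omega>")
      case True
      then have "?\<rho> \<omega> = \<tau> \<omega>" by (rule min_absorb1)
      then show ?thesis unfolding gap_def by simp
    next
      case False
      then have \<rho>S: "?\<rho> \<omega> = ?S \<omega>" and lt: "?S \<omega> < \<tau> \<omega>" by (simp_all add: min_def)
      have "?S \<omega> < top" using less_le_trans[OF lt bnd[of \<omega>]] by (rule less_trans) simp
      from hit_in[OF \<omega> closed_contact this]
      have "stop_cost \<le> ennreal e + w (\<Phi> z (enn2real (?S \<omega>)) \<omega>)" unfolding contact_def by (simp add: add.commute)
      then have "stop_cost - w (\<Phi> z (enn2real (?S \<omega>)) \<omega>) \<le> ennreal e"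
        using stop_cost_finite by (subst ennreal_minus_le_iff) (auto simp: add.commute)
      then have "gap z ?\<rho> \<omega> \<le> ennreal e" unfolding gap_def \<rho>S by (rule disc_mult_le)
      then show ?thesis by (rule add_increasing[OF zero_le])
    qed
  qed
  also have "\<dots> = (\<integral>\<^sup>+\<omega>. gap z \<tau> \<omega> \<partial>M) + ennreal e"
    by (subst nn_integral_add[OF gap_measurable[OF \<tau>M]]) (simp_all add: emeasure_space_1)
  finally have 2: "(\<integral>\<^sup>+\<omega>. gap z ?\<rho> \<omega> \<partial>M) \<le> (\<integral>\<^sup>+\<omega>. gap z \<tau> \<omega> \<partial>M) + ennreal e" .
  show ?thesis
    unfolding J_split[OF \<tau>M] J_split[OF \<rho>M] add.assoc by (rule add_mono[OF 1 2])
qed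

lemma run_SUP:
  assumes \<omega>: "\<omega> \<in> space M" and y: "incseq y"
  shows "run z \<omega> (SUP i. y i) = (SUP i. run z \<omega> (y i))"
proof -
  let ?G = "\<lambda>u. ennreal (exp (- lam * u)) * load (evo (\<lambda>k. \<sigma> k \<omega>) (\<lambda>k. r (Y k \<omega>)) z u)"
  let ?I = "\<lambda>s u. indicator {u. 0 \<le> u \<and> ennreal u < s} u * ?G u"
  have mono: "?I s u \<le> ?I s' u" if "s \<le> s'" for s s' u
    using less_le_trans[OF _ that] by (auto simp: indicator_def)
  have "(\<integral>\<^sup>+u. (SUP i. ?I (y i) u) \<partial>lborel) = (SUP i. \<integral>\<^sup>+u. ?I (y i) u \<partial>lborel)"
  proof (rule nn_integral_monotone_convergence_SUP)
    show "incseq (\<lambda>i. ?I (y i))"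
      using y by (intro incseq_SucI le_funI mono) (simp add: incseq_SucD)
    show "?I (y i) \<in> borel_measurable lborel" for i by (rule run_path_measurable)
  qed
  moreover have "(SUP i. ?I (y i) u) = ?I (SUP i. y i) u" for u
  proof (rule antisym)
    show "(SUP i. ?I (y i) u) \<le> ?I (SUP i. y i) u"
      by (rule SUP_least) (rule mono[OF SUP_upper], simp)
    show "?I (SUP i. y i) u \<le> (SUP i. ?I (y i) u)"
    proof (cases "0 \<le> u \<and> ennreal u < (SUP i. y i)")
      case True
      then obtain i where "ennreal u < y i" by (auto simp: less_SUP_iff)
      then have "?I (SUP i. y i) u \<le> ?I (y i) u" using True by simp
      also have "\<dots> \<le> (SUP i. ?I (y i) u)" by (rule SUP_upper) simp
      finally show ?thesis .
    next
      case False
      then have eq: "?I (SUP i. y i) u = 0" by (auto simp: indicator_def)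
      show ?thesis unfolding eq by (rule zero_le)
    qed
  qed
  ultimately show ?thesis unfolding run_eq_path_run[OF \<omega>] path_run_def by simp
qed

text \<open>
  The hypothesis says that \<open>x j\<close> converges to \<open>s\<close> from below in a form that also covers an infinite \<open>s\<close>.
  The load before \<open>s\<close> is lower semicontinuous along such times, and stopping earlier only increases the
  discounted cost of stopping.
\<close>

lemma cost_liminf:
  assumes \<omega>: "\<omega> \<in> space M" and y: "incseq y" "(SUP i. y i) = s"
    and x: "\<And>j. x j \<le> s" and ev: "\<And>i. \<forall>\<^sub>F j in sequentially. y i \<le> x j"
  shows "run z \<omega> s + disc s * stop_cost \<le> liminf (\<lambda>j. run z \<omega> (x j) + disc (x j) * stop_cost)"
proof -
  have "run z \<omega> (y i) + disc s * stop_cost \<le> liminf (\<lambda>j. run z \<omega> (x j) + disc (x j) * stop_cost)" for i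
  proof (rule Liminf_bounded)
    show "\<forall>\<^sub>F j in sequentially. run z \<omega> (y i) + disc s * stop_cost \<le> run z \<omega> (x j) + disc (x j) * stop_cost"
      using ev[of i]
    proof eventually_elim
      case (elim j)
      show ?case
        by (intro add_mono run_mono elim mult_right_mono disc_antimono x) simp
    qed
  qed
  moreover have "(\<lambda>i. run z \<omega> (y i) + disc s * stop_cost) \<longlonglongrightarrow> run z \<omega> s + disc s * stop_cost"
  proof (intro tendsto_add tendsto_const)
    have "incseq (\<lambda>i. run z \<omega> (y i))" using y(1) by (intro incseq_SucI run_mono) (simp add: incseq_SucD)
    from LIMSEQ_SUP[OF this] show "(\<lambda>i. run z \<omega> (y i)) \<longlonglongrightarrow> run z \<omega> s"
      unfolding run_SUP[OF \<omega> y(1), symmetric] y(2) .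
  qed
  ultimately show ?thesis by (intro LIMSEQ_le_const2) auto
qed

text \<open>
  Almost surely the gaps are summable, hence tend to 0.  Stopping before time \<open>l\<close> outside the
  \<open>e\<close>-contact set leaves a gap of at least \<open>exp (- lam * l) * e\<close>, so this can happen for finitely
  many \<open>j\<close> only.
\<close>

lemma ae_reach_contact:
  assumes \<tau>: "\<And>j. stopping_time F (\<tau> j)" and J: "\<And>j. J (\<tau> j) z \<le> w z + ennreal ((1 / 2) ^ j)" and e: "0 < e"
  shows "AE \<omega> in M. \<forall>l::nat. \<forall>\<^sub>F j in sequentially. min (hit (contact e) z \<omega>) (ennreal (real l)) \<le> \<tau> j \<omega>"
proof -
  note \<tau>M = stopping_measurable[OF \<tau>]
  have G: "(\<integral>\<^sup>+\<omega>. gap z (\<tau> j) \<omega> \<partial>M) \<le> ennreal ((1 / 2) ^ j)" for j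
    by (rule gap_bound[OF \<tau> J]) simp
  have "(\<integral>\<^sup>+\<omega>. (\<Sum>j. gap z (\<tau> j) \<omega>) \<partial>M) = (\<Sum>j. \<integral>\<^sup>+\<omega>. gap z (\<tau> j) \<omega> \<partial>M)"
    by (rule nn_integral_suminf[OF gap_measurable[OF \<tau>M]])
  also have "\<dots> \<le> (\<Sum>j. ennreal ((1 / 2) ^ j))" by (intro suminf_le G summableI)
  also have "\<dots> = ennreal (\<Sum>j. (1 / 2) ^ j)" by (rule suminf_ennreal2) (simp_all add: summable_geometric)
  also have "\<dots> < \<infinity>" by simp
  finally have fin: "(\<integral>\<^sup>+\<omega>. (\<Sum>j. gap z (\<tau> j) \<omega>) \<partial>M) \<noteq> \<infinity>" by simp
  have "(\<lambda>\<omega>. \<Sum>j. gap z (\<tau> j) \<omega>) \<in> borel_measurable M"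
    by (intro borel_measurable_suminf_order gap_measurable \<tau>M)
  from nn_integral_PInf_AE[OF this fin] show ?thesis
  proof (rule AE_mp, intro AE_I2 impI allI)
    fix \<omega> and l :: nat assume \<omega>: "\<omega> \<in> space M" and sum: "(\<Sum>j. gap z (\<tau> j) \<omega>) \<noteq> \<infinity>"
    \<comment> \<open>Lower bound for the gap of a time that stops before \<open>l\<close> and outside the contact set.\<close>
    define d where "d = exp (- lam * real l) * e"
    have d: "0 < d" using e by (simp add: d_def)
    have gf: "gap z (\<tau> j) \<omega> < top" for j
    proof (rule le_less_trans[OF _ stop_cost_finite])
      show "gap z (\<tau> j) \<omega> \<le> stop_cost" unfolding gap_def by (rule disc_mult_le) (rule diff_le_self_ennreal)
    qed
    then have ge: "gap z (\<tau> j) \<omega> = ennreal (enn2real (gap z (\<tau> j) \<omega>))" for j by simp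
    have "(\<Sum>j. ennreal (enn2real (gap z (\<tau> j) \<omega>))) \<noteq> top" unfolding ge[symmetric] using sum by simp
    from summable_LIMSEQ_zero[OF summable_suminf_not_top[OF enn2real_nonneg this]]
    have "\<forall>\<^sub>F j in sequentially. enn2real (gap z (\<tau> j) \<omega>) < d" using d by (rule order_tendstoD(2))
    then show "\<forall>\<^sub>F j in sequentially. min (hit (contact e) z \<omega>) (ennreal (real l)) \<le> \<tau> j \<omega>"
    proof eventually_elim
      case (elim j)
      show ?case
      proof (rule ccontr)
        assume "\<not> min (hit (contact e) z \<omega>) (ennreal (real l)) \<le> \<tau> j \<omega>"
        then have lt: "\<tau> j \<omega> < hit (contact e) z \<omega>" "\<tau> j \<omega> < ennreal (real l)" by (auto simp: not_le)
        obtain t where t: "\<tau> j \<omega> = ennreal t" "0 \<le> t" using lt(2) by (cases "\<tau> j \<omega>") auto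
        have tl: "t \<le> real l" using lt(2) t by (simp add: ennreal_less_iff)
        have "\<Phi> z t \<omega> \<notin> contact e" using hit_le[OF t(2), of \<omega> "contact e"] lt(1) t(1) by (auto simp: not_less[symmetric])
        then have "w (\<Phi> z t \<omega>) + ennreal e < stop_cost" by (simp add: contact_def not_le)
        then have "ennreal e \<le> stop_cost - w (\<Phi> z t \<omega>)"
          using ennreal_minus_mono[OF less_imp_le order_refl, of "w (\<Phi> z t \<omega>) + ennreal e" stop_cost "w (\<Phi> z t \<omega>)"]
            le_less_trans[OF w_le_stop_cost stop_cost_finite, of "\<Phi> z t \<omega>"]
          by (simp add: ennreal_add_diff_cancel_left)
        moreover have "ennreal (exp (- lam * real l)) \<le> disc (\<tau> j \<omega>)"
          unfolding t(1) disc_ennreal[OF t(2)] using tl lam_pos by (intro ennreal_leI) simp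
        ultimately have "ennreal (exp (- lam * real l)) * ennreal e \<le> gap z (\<tau> j) \<omega>"
          unfolding gap_def t(1) enn2real_ennreal[OF t(2)] by (intro mult_mono) simp_all
        then have "ennreal d \<le> ennreal (enn2real (gap z (\<tau> j) \<omega>))"
          unfolding d_def ge[of j, symmetric] using e by (simp add: ennreal_mult)
        then have "d \<le> enn2real (gap z (\<tau> j) \<omega>)" by (simp add: ennreal_le_iff)
        then show False using elim by simp
      qed
    qed
  qed
qed

text \<open>
  Near-optimal times, cut off at the first visit to the \<open>e\<close>-contact set, are near-optimal up to \<open>e\<close> and
  converge almost surely to that visit; Fatou's lemma passes the bound to the limit.
\<close>

lemma J_hit_contact:
  assumes e: "0 < e"
  shows "J (hit (contact e) z) z \<le> w z + ennreal e"
proof -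
  let ?S = "hit (contact e) z"
  have "\<exists>\<tau>. stopping_time F \<tau> \<and> (\<exists>l::nat. \<forall>\<omega>. \<tau> \<omega> \<le> ennreal (real l)) \<and> J \<tau> z \<le> w z + ennreal ((1 / 2) ^ j)" for j :: nat
    by (rule near_optimal[OF z]) simp
  then obtain \<tau> where \<tau>: "\<And>j. stopping_time F (\<tau> j)" "\<And>j. \<exists>l::nat. \<forall>\<omega>. \<tau> j \<omega> \<le> ennreal (real l)"
    "\<And>j. J (\<tau> j) z \<le> w z + ennreal ((1 / 2) ^ j)" by metis
  let ?x = "\<lambda>j \<omega>. min (\<tau> j \<omega>) (?S \<omega>)"
  have S: "stopping_time F ?S" by (rule stopping_time_hit[OF closed_contact])
  have xM: "?x j \<in> borel_measurable M" for j by (rule stopping_measurable[OF stopping_time_min[OF \<tau>(1) S]])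
  have "J ?S z \<le> (\<integral>\<^sup>+\<omega>. liminf (\<lambda>j. run z \<omega> (?x j \<omega>) + disc (?x j \<omega>) * stop_cost) \<partial>M)"
    unfolding J_def
  proof (rule nn_integral_mono_AE)
    from ae_reach_contact[OF \<tau>(1,3) e]
    show "AE \<omega> in M. run z \<omega> (?S \<omega>) + disc (?S \<omega>) * stop_cost \<le>
        liminf (\<lambda>j. run z \<omega> (?x j \<omega>) + disc (?x j \<omega>) * stop_cost)"
    proof (rule AE_mp, intro AE_I2 impI)
      fix \<omega> assume \<omega>: "\<omega> \<in> space M"
        and ev: "\<forall>l::nat. \<forall>\<^sub>F j in sequentially. min (?S \<omega>) (ennreal (real l)) \<le> \<tau> j \<omega>"
      show "run z \<omega> (?S \<omega>) + disc (?S \<omega>) * stop_cost \<le>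
        liminf (\<lambda>j. run z \<omega> (?x j \<omega>) + disc (?x j \<omega>) * stop_cost)"
      proof (rule cost_liminf[OF \<omega>])
        show "incseq (\<lambda>l. min (?S \<omega>) (ennreal (real l)))"
          by (intro incseq_SucI min.mono order_refl ennreal_leI) simp
        show "(SUP l. min (?S \<omega>) (ennreal (real l))) = ?S \<omega>"
        proof (rule antisym)
          show "(SUP l. min (?S \<omega>) (ennreal (real l))) \<le> ?S \<omega>" by (rule SUP_least) simp
          show "?S \<omega> \<le> (SUP l. min (?S \<omega>) (ennreal (real l)))"
          proof (cases "?S \<omega>")
            case (real s)
            obtain l :: nat where "s \<le> real l" using real_arch_simple by blast
            then have "?S \<omega> = min (?S \<omega>) (ennreal (real l))" unfolding real by (simp add: min_absorb1 ennreal_leI)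
            also have "\<dots> \<le> (SUP l. min (?S \<omega>) (ennreal (real l)))" by (rule SUP_upper) simp
            finally show ?thesis .
          next
            case top
            then have "(SUP l. min (?S \<omega>) (ennreal (real l))) = (SUP l. of_nat l :: ennreal)"
              by (simp add: ennreal_of_nat_eq_real_of_nat)
            then show ?thesis by (simp only: ennreal_SUP_of_nat_eq_top top_greatest)
          qed
        qed
        show "?x j \<omega> \<le> ?S \<omega>" for j by simp
        show "\<forall>\<^sub>F j in sequentially. min (?S \<omega>) (ennreal (real l)) \<le> ?x j \<omega>" for l
          using ev[THEN spec, of l] by eventually_elim simp
      qed
    qed
  qed
  also have "\<dots> \<le> liminf (\<lambda>j. \<integral>\<^sup>+\<omega>. run z \<omega> (?x j \<omega>) + disc (?x j \<omega>) * stop_cost \<partial>M)"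
    by (rule nn_integral_liminf[OF cost_at_measurable[OF xM]])
  also have "\<dots> \<le> liminf (\<lambda>j. w z + ennreal ((1 / 2) ^ j) + ennreal e)"
  proof (intro Liminf_mono always_eventually allI)
    fix j
    obtain l :: nat where l: "\<And>\<omega>. \<tau> j \<omega> \<le> ennreal (real l)" using \<tau>(2) by blast
    have "J (?x j) z \<le> J (\<tau> j) z + ennreal e" by (rule J_stop_at_contact[OF \<tau>(1) l less_imp_le[OF e]])
    also have "\<dots> \<le> w z + ennreal ((1 / 2) ^ j) + ennreal e" by (intro add_right_mono \<tau>(3))
    finally show "(\<integral>\<^sup>+\<omega>. run z \<omega> (?x j \<omega>) + disc (?x j \<omega>) * stop_cost \<partial>M) \<le> w z + ennreal ((1 / 2) ^ j) + ennreal e"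
      unfolding J_def .
  qed
  also have "\<dots> = w z + ennreal 0 + ennreal e"
  proof (rule lim_imp_Liminf[OF sequentially_bot])
    have "(\<lambda>j. (1 / 2 :: real) ^ j) \<longlonglongrightarrow> 0" by (rule LIMSEQ_realpow_zero) simp_all
    then show "(\<lambda>j. w z + ennreal ((1 / 2) ^ j) + ennreal e) \<longlonglongrightarrow> w z + ennreal 0 + ennreal e"
      by (intro tendsto_add tendsto_const tendsto_ennrealI)
  qed
  finally show ?thesis by simp
qed

text \<open>
  The expected gap vanishes, so almost surely the state at a finite \<open>\<tau>\<close> lies in the contact set.
\<close>

lemma optimal_after_contact:
  assumes \<tau>: "stopping_time F \<tau>" and J: "J \<tau> z \<le> w z"
  shows "AE \<omega> in M. hit (contact 0) z \<omega> \<le> \<tau> \<omega>"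
proof -
  have "(\<integral>\<^sup>+\<omega>. gap z \<tau> \<omega> \<partial>M) \<le> 0" by (rule gap_bound[OF \<tau>]) (use J in simp_all)
  then have "AE \<omega> in M. gap z \<tau> \<omega> = 0"
    using nn_integral_0_iff_AE[OF gap_measurable[OF stopping_measurable[OF \<tau>]]] by simp
  then show ?thesis
  proof (rule AE_mp, intro AE_I2 impI)
    fix \<omega> assume gap: "gap z \<tau> \<omega> = 0"
    show "hit (contact 0) z \<omega> \<le> \<tau> \<omega>"
    proof (cases "\<tau> \<omega>")
      case (real t)
      have "stop_cost - w (\<Phi> z t \<omega>) = 0"
        using gap real unfolding gap_def by (simp add: disc_ennreal)
      then have "stop_cost \<le> w (\<Phi> z t \<omega>)"
        using diff_add_cancel_ennreal[OF w_le_stop_cost, of "\<Phi> z t \<omega>"] by simp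
      then have "\<Phi> z t \<omega> \<in> contact 0" by (simp add: contact_def)
      from hit_le[OF real(1) this] show ?thesis unfolding real(2) .
    qed simp
  qed
qed

text \<open>
  The first visits to the \<open>e\<close>-contact sets increase, as \<open>e\<close> decreases to 0, to an optimal time that is at
  most the first visit to the contact set.  The reverse inequality is \<open>optimal_after_contact\<close>, applied
  to that limit.
\<close>

theorem hit_contact_optimal: "J (hit (contact 0) z) z = w z"
proof (rule antisym)
  let ?S = "\<lambda>i::nat. hit (contact (1 / real (Suc i))) z"
  let ?T = "\<lambda>\<omega>. SUP i. ?S i \<omega>"
  have S: "stopping_time F (?S i)" for i by (rule stopping_time_hit[OF closed_contact])
  have SM: "?S i \<in> borel_measurable M" for i by (rule stopping_measurable[OF S])
  have T: "stopping_time F ?T"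
  proof
    fix t
    have "Measurable.pred (F t) (\<lambda>\<omega>. \<forall>i. ?S i \<omega> \<le> t)"
      by (intro pred_intros_countable stopping_timeD[OF S])
    moreover have "(\<lambda>\<omega>. ?T \<omega> \<le> t) = (\<lambda>\<omega>. \<forall>i. ?S i \<omega> \<le> t)" by (simp add: SUP_le_iff)
    ultimately show "Measurable.pred (F t) (\<lambda>\<omega>. ?T \<omega> \<le> t)" by (simp only:)
  qed
  have inc: "incseq (\<lambda>i. ?S i \<omega>)" for \<omega>
    by (intro incseq_SucI hit_antimono contact_mono) (simp add: field_simps)
  have "J ?T z \<le> (\<integral>\<^sup>+\<omega>. liminf (\<lambda>i. run z \<omega> (?S i \<omega>) + disc (?S i \<omega>) * stop_cost) \<partial>M)"
    unfolding J_def
  proof (rule nn_integral_mono)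
    fix \<omega> assume \<omega>: "\<omega> \<in> space M"
    show "run z \<omega> (?T \<omega>) + disc (?T \<omega>) * stop_cost \<le> liminf (\<lambda>i. run z \<omega> (?S i \<omega>) + disc (?S i \<omega>) * stop_cost)"
    proof (rule cost_liminf[OF \<omega> inc refl])
      show "?S j \<omega> \<le> ?T \<omega>" for j by (rule SUP_upper) simp
      show "\<forall>\<^sub>F j in sequentially. ?S i \<omega> \<le> ?S j \<omega>" for i
        using eventually_ge_at_top[of i] by eventually_elim (rule incseqD[OF inc])
    qed
  qed
  also have "\<dots> \<le> liminf (\<lambda>i. \<integral>\<^sup>+\<omega>. run z \<omega> (?S i \<omega>) + disc (?S i \<omega>) * stop_cost \<partial>M)"
    by (rule nn_integral_liminf[OF cost_at_measurable[OF SM]])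
  also have "\<dots> \<le> liminf (\<lambda>i. w z + ennreal (1 / real (Suc i)))"
  proof (intro Liminf_mono always_eventually allI)
    fix i
    show "(\<integral>\<^sup>+\<omega>. run z \<omega> (?S i \<omega>) + disc (?S i \<omega>) * stop_cost \<partial>M) \<le> w z + ennreal (1 / real (Suc i))"
      using J_hit_contact[of "1 / real (Suc i)"] unfolding J_def by simp
  qed
  also have "\<dots> = w z + ennreal 0"
  proof (rule lim_imp_Liminf[OF sequentially_bot])
    have "(\<lambda>i. 1 / real (Suc i)) \<longlonglongrightarrow> 0" using LIMSEQ_inverse_real_of_nat by (simp add: inverse_eq_divide)
    then show "(\<lambda>i. w z + ennreal (1 / real (Suc i))) \<longlonglongrightarrow> w z + ennreal 0"
      by (intro tendsto_add tendsto_const tendsto_ennrealI)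
  qed
  finally have JT: "J ?T z \<le> w z" by simp
  have "J (hit (contact 0) z) z = J ?T z"
    unfolding J_def
  proof (rule nn_integral_cong_AE)
    from optimal_after_contact[OF T JT]
    show "AE \<omega> in M. run z \<omega> (hit (contact 0) z \<omega>) + disc (hit (contact 0) z \<omega>) * stop_cost =
        run z \<omega> (?T \<omega>) + disc (?T \<omega>) * stop_cost"
    proof (rule AE_mp, intro AE_I2 impI)
      fix \<omega> assume le: "hit (contact 0) z \<omega> \<le> ?T \<omega>"
      have "?T \<omega> \<le> hit (contact 0) z \<omega>"
        by (rule SUP_least) (intro hit_antimono contact_mono, simp)
      with le have "hit (contact 0) z \<omega> = ?T \<omega>" by (rule antisym)
      then show "run z \<omega> (hit (contact 0) z \<omega>) + disc (hit (contact 0) z \<omega>) * stop_cost =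
        run z \<omega> (?T \<omega>) + disc (?T \<omega>) * stop_cost" by (simp only:)
    qed
  qed
  then show "J (hit (contact 0) z) z \<le> w z" using JT by simp
  show "w z \<le> J (hit (contact 0) z) z" by (rule w_le_J[OF stopping_time_hit[OF closed_contact]])
qed

end

end

section \<open>Extended integrals of differences\<close>

lemma e2ennreal_diff:
  assumes "b < top"
  shows "e2ennreal (enn2ereal a - enn2ereal b) = a - b"
proof -
  obtain y where y: "b = ennreal y" "0 \<le> y" using assms by (cases b) auto
  show ?thesis
  proof (cases a)
    case (real x)
    then show ?thesis using y by (simp add: enn2ereal_ennreal ennreal_minus ennreal.abs_eq[symmetric] flip: ennreal_def)
  next
    case top
    then show ?thesis using y by (simp add: enn2ereal_ennreal enn2ereal_top)
  qed
qed

lemma ext_integral_cong: "(\<And>x. x \<in> space N \<Longrightarrow> f x = g x) \<Longrightarrow> ext_integral N f = ext_integral N g"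
  unfolding ext_integral_def by (simp cong: nn_integral_cong)

text \<open>
  The splitting into \<open>a\<close> and \<open>b\<close> need not be the one into positive and negative parts; the two differ
  by the finite common part that cancels.
\<close>

lemma ext_integral_diff:
  assumes a: "a \<in> borel_measurable N" and b: "b \<in> borel_measurable N"
    and bf: "\<And>x. x \<in> space N \<Longrightarrow> b x < top" and fin: "(\<integral>\<^sup>+x. b x \<partial>N) < top"
  shows "ext_integral N (\<lambda>x. enn2ereal (a x) - enn2ereal (b x)) =
    enn2ereal (\<integral>\<^sup>+x. a x \<partial>N) - enn2ereal (\<integral>\<^sup>+x. b x \<partial>N)"
proof -
  let ?P = "\<integral>\<^sup>+x. a x - b x \<partial>N" and ?N = "\<integral>\<^sup>+x. b x - a x \<partial>N"
  have P: "(\<integral>\<^sup>+x. e2ennreal (enn2ereal (a x) - enn2ereal (b x)) \<partial>N) = ?P"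
    by (rule nn_integral_cong) (rule e2ennreal_diff[OF bf])
  have Nn: "(\<integral>\<^sup>+x. e2ennreal (- (enn2ereal (a x) - enn2ereal (b x))) \<partial>N) = ?N"
  proof (rule nn_integral_cong)
    fix x assume x: "x \<in> space N"
    obtain y where y: "b x = ennreal y" "0 \<le> y" using bf[OF x] by (cases "b x") auto
    show "e2ennreal (- (enn2ereal (a x) - enn2ereal (b x))) = b x - a x"
    proof (cases "a x")
      case (real u)
      then have "- (enn2ereal (a x) - enn2ereal (b x)) = enn2ereal (b x) - enn2ereal (a x)"
        using y by simp
      then show ?thesis using e2ennreal_diff[of "a x" "b x"] real by simp
    next
      case top
      then show ?thesis using y by (simp add: e2ennreal_neg)
    qed
  qed
  have Nle: "?N \<le> (\<integral>\<^sup>+x. b x \<partial>N)" by (intro nn_integral_mono diff_le_self_ennreal)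
  have m: "(\<lambda>x. a x - b x) \<in> borel_measurable N" "(\<lambda>x. b x - a x) \<in> borel_measurable N" using a b by measurable
  have "?P + (\<integral>\<^sup>+x. b x \<partial>N) = (\<integral>\<^sup>+x. (a x - b x) + b x \<partial>N)" by (rule nn_integral_add[symmetric, OF m(1) b])
  also have "\<dots> = (\<integral>\<^sup>+x. a x + (b x - a x) \<partial>N)"
  proof (rule nn_integral_cong)
    fix x assume x: "x \<in> space N"
    show "(a x - b x) + b x = a x + (b x - a x)"
    proof (cases "b x \<le> a x")
      case True
      have "b x - a x = 0" using True bf[OF x] by (simp add: diff_eq_0_iff_ennreal)
      then show ?thesis using diff_add_cancel_ennreal[OF True] by simp
    next
      case False
      then have le: "a x \<le> b x" by simp
      have "a x - b x = 0" using le le_less_trans[OF le bf[OF x]] by (simp add: diff_eq_0_iff_ennreal)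
      moreover have "a x + (b x - a x) = b x"
        unfolding add.commute[of "a x"] by (rule diff_add_cancel_ennreal[OF le])
      ultimately show ?thesis by (simp only: add_0)
    qed
  qed
  also have "\<dots> = (\<integral>\<^sup>+x. a x \<partial>N) + ?N" by (rule nn_integral_add[OF a m(2)])
  finally have eq: "?P + (\<integral>\<^sup>+x. b x \<partial>N) = (\<integral>\<^sup>+x. a x \<partial>N) + ?N" .
  obtain \<beta> where \<beta>: "(\<integral>\<^sup>+x. b x \<partial>N) = ennreal \<beta>" "0 \<le> \<beta>" using fin by (cases "\<integral>\<^sup>+x. b x \<partial>N") auto
  obtain \<nu> where \<nu>: "?N = ennreal \<nu>" "0 \<le> \<nu>" using le_less_trans[OF Nle fin] by (cases ?N) auto
  have "enn2ereal ?P - enn2ereal ?N = enn2ereal (\<integral>\<^sup>+x. a x \<partial>N) - enn2ereal (\<integral>\<^sup>+x. b x \<partial>N)"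
  proof (cases "\<integral>\<^sup>+x. a x \<partial>N")
    case (real \<alpha>)
    then have "?P + ennreal \<beta> < top" using eq \<beta> \<nu> by (simp add: ennreal_plus[symmetric] del: ennreal_plus)
    then obtain \<pi> where \<pi>: "?P = ennreal \<pi>" "0 \<le> \<pi>" by (cases ?P) auto
    have "ennreal (\<pi> + \<beta>) = ennreal (\<alpha> + \<nu>)" using eq \<pi> \<beta> \<nu> real by (simp add: ennreal_plus)
    then have "\<pi> + \<beta> = \<alpha> + \<nu>" using \<pi> \<beta> \<nu> real by (subst (asm) ennreal_inj) simp_all
    then show ?thesis using \<pi> \<beta> \<nu> real by (simp add: enn2ereal_ennreal)
  next
    case top
    then have "?P = top" using eq \<beta> by (cases ?P) (simp_all add: ennreal_plus[symmetric] del: ennreal_plus)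
    then show ?thesis using top \<beta> \<nu> by (simp add: enn2ereal_ennreal)
  qed
  then show ?thesis unfolding ext_integral_def P Nn .
qed

context poisson_disorder
begin

section \<open>The original problem\<close>

text \<open>
  The discounted constant part \<open>lam / c\<close> of the running cost.
\<close>

definition holding :: "ennreal \<Rightarrow> ennreal" where
  "holding \<tau> = (\<integral>\<^sup>+t. indicator {t. 0 \<le> t \<and> ennreal t \<le> \<tau>} t * ennreal (lam / c * exp (- lam * t)) \<partial>lborel)"

text \<open>
  This identity explains the shift: up to the constant \<open>1 / c\<close>, saving the rate \<open>lam / c\<close> while waiting is
  the same as having the cost of stopping discounted.
\<close>

lemma holding_add_disc: "holding \<tau> + disc \<tau> * stop_cost = stop_cost"
proof (cases \<tau>)
  case (real s)
  have "holding \<tau> = (\<integral>\<^sup>+t. ennreal (lam / c * exp (- lam * t)) * indicator {0..s} t \<partial>lborel)"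
    unfolding holding_def by (rule nn_integral_cong) (use real in \<open>auto simp: indicator_def ennreal_le_iff\<close>)
  also have "\<dots> = ennreal (- exp (- lam * s) / c - (- exp (- lam * 0) / c))"
  proof (rule nn_integral_FTC_Icc)
    show "((\<lambda>t. - exp (- lam * t) / c) has_real_derivative lam / c * exp (- lam * t)) (at t)" for t
      using c_pos by (auto intro!: derivative_eq_intros)
    show "0 \<le> lam / c * exp (- lam * t)" for t using lam_pos c_pos by simp
  qed (use real in simp_all)
  also have "- exp (- lam * s) / c - (- exp (- lam * 0) / c) = 1 / c - exp (- lam * s) / c" by simp
  finally have h: "holding \<tau> = ennreal (1 / c - exp (- lam * s) / c)" .
  have le: "exp (- lam * s) / c \<le> 1 / c" using c_pos lam_pos real by (intro divide_right_mono) auto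
  have d: "disc \<tau> * stop_cost = ennreal (exp (- lam * s) / c)"
    unfolding real(2) disc_ennreal[OF real(1)] stop_cost_def using c_pos by (simp add: ennreal_mult[symmetric])
  show ?thesis unfolding h d using le c_pos
    by (simp add: stop_cost_def ennreal_plus[symmetric] del: ennreal_plus)
next
  case top
  have "holding \<tau> = (\<integral>\<^sup>+t. ennreal (lam / c * exp (- lam * t)) * indicator {0..} t \<partial>lborel)"
    unfolding holding_def by (rule nn_integral_cong) (use top in \<open>auto simp: indicator_def\<close>)
  also have "\<dots> = ennreal (0 - (- exp (- lam * 0) / c))"
  proof (rule nn_integral_FTC_atLeast)
    show "((\<lambda>t. - exp (- lam * t) / c) has_real_derivative lam / c * exp (- lam * t)) (at t)" for t
      using c_pos by (auto intro!: derivative_eq_intros)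
    show "0 \<le> lam / c * exp (- lam * t)" for t using lam_pos c_pos by simp
    have "filterlim (\<lambda>t. - lam * t) at_bot at_top"
      by (rule filterlim_tendsto_neg_mult_at_bot[OF tendsto_const _ filterlim_ident]) (use lam_pos in simp)
    then have "((\<lambda>t. exp (- lam * t)) \<longlongrightarrow> 0) at_top" by (rule filterlim_compose[OF exp_at_bot])
    from tendsto_divide[OF tendsto_minus[OF this] tendsto_const, of c]
    show "((\<lambda>t. - exp (- lam * t) / c) \<longlongrightarrow> 0) at_top" using c_pos by simp
  qed simp
  finally show ?thesis using top by (simp add: stop_cost_def disc_def)
qed

lemma holding_finite: "holding \<tau> < top"
proof (rule le_less_trans[OF _ stop_cost_finite])
  show "holding \<tau> \<le> stop_cost" using holding_add_disc[of \<tau>] by (metis le_iff_add)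
qed

lemma holding_eq: "holding \<tau> = stop_cost - disc \<tau> * stop_cost"
  using holding_add_disc[of \<tau>] le_less_trans[OF disc_mult_le[OF order_refl] stop_cost_finite, of \<tau>]
  by (metis ennreal_add_diff_cancel_right less_irrefl infinity_ennreal_def)

text \<open>
  The load is nonnegative and the constant part integrable, so the positive and negative contributions
  may be integrated separately even if the former is infinite.
\<close>

lemma inner_cost:
  assumes \<omega>: "\<omega> \<in> space M" and x: "0 \<le> x0" "0 \<le> x1"
  shows "ext_integral lborel (\<lambda>t. ereal (indicator {t. 0 \<le> t \<and> ennreal t \<le> s} t
      * (exp (- lam * t) * g (\<Phi>0 x0 t \<omega>) (\<Phi>1 x1 t \<omega>)))) = enn2ereal (run (x0, x1) \<omega> s) - enn2ereal (holding s)"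
proof -
  let ?z = "(x0, x1)"
  let ?e = "\<lambda>t. evo (\<lambda>k. \<sigma> k \<omega>) (\<lambda>k. r (Y k \<omega>)) ?z t"
  define a where "a t = indicator {t. 0 \<le> t \<and> ennreal t \<le> s} t * (ennreal (exp (- lam * t)) * load (?e t))" for t
  define b where "b t = indicator {t. 0 \<le> t \<and> ennreal t \<le> s} t * ennreal (lam / c * exp (- lam * t))" for t
  have ind: "(\<lambda>t. indicator {t. 0 \<le> t \<and> ennreal t \<le> s} t :: ennreal) \<in> borel_measurable borel"
  proof -
    have "(\<lambda>t. if 0 \<le> t \<and> ennreal t \<le> s then 1 else 0 :: ennreal) \<in> borel_measurable borel" by measurable
    then show ?thesis by (simp add: indicator_def[abs_def])
  qed
  have am: "a \<in> borel_measurable lborel"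
  proof -
    have "(\<lambda>t. load (?e t)) \<in> borel_measurable borel" by (rule measurable_load[OF evo_path_measurable])
    then have "a \<in> borel_measurable borel" unfolding a_def[abs_def]
      by (intro borel_measurable_times_ennreal ind) simp_all
    then show ?thesis by simp
  qed
  have bm: "b \<in> borel_measurable lborel"
  proof -
    have "b \<in> borel_measurable borel" unfolding b_def[abs_def]
      by (intro borel_measurable_times_ennreal ind) simp
    then show ?thesis by simp
  qed
  have pt: "ereal (indicator {t. 0 \<le> t \<and> ennreal t \<le> s} t * (exp (- lam * t) * g (\<Phi>0 x0 t \<omega>) (\<Phi>1 x1 t \<omega>))) =
      enn2ereal (a t) - enn2ereal (b t)" for t
  proof (cases "0 \<le> t \<and> ennreal t \<le> s")
    case True
    then have t: "0 \<le> t" by simp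
    have p: "0 \<le> \<Phi>0 x0 t \<omega> + \<Phi>1 x1 t \<omega>"
      using \<Phi>_nonneg[OF \<omega> t, of ?z] x by (simp add: \<Phi>_def)
    have a: "a t = ennreal (exp (- lam * t) * (\<Phi>0 x0 t \<omega> + \<Phi>1 x1 t \<omega>))"
      unfolding a_def \<Phi>_eq_evo[OF \<omega> t, symmetric] using True p by (simp add: load_def \<Phi>_def ennreal_mult)
    have b: "b t = ennreal (lam / c * exp (- lam * t))" unfolding b_def using True by simp
    have q: "0 \<le> exp (- lam * t) * (\<Phi>0 x0 t \<omega> + \<Phi>1 x1 t \<omega>)" "0 \<le> lam / c * exp (- lam * t)"
      using p lam_pos c_pos by simp_all
    show ?thesis
      unfolding a b enn2ereal_ennreal[OF q(1)] enn2ereal_ennreal[OF q(2)]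
      using True by (simp add: g_def algebra_simps)
  qed (simp add: a_def b_def)
  have ib: "(\<integral>\<^sup>+t. b t \<partial>lborel) = holding s" unfolding b_def holding_def ..
  have ia: "(\<integral>\<^sup>+t. a t \<partial>lborel) = run ?z \<omega> s"
    unfolding run_eq_path_run[OF \<omega>] path_run_def
  proof (rule nn_integral_cong_AE)
    \<comment> \<open>The strict and the weak inequality in the time range differ at one point.\<close>
    have "AE t in lborel. t \<noteq> enn2real s" by (rule AE_lborel_singleton)
    then show "AE t in lborel. a t = indicator {t. 0 \<le> t \<and> ennreal t < s} t * (ennreal (exp (- lam * t)) * load (?e t))"
    proof (rule AE_mp, intro AE_I2 impI)
      fix t assume "t \<noteq> enn2real s"
      then have "(0 \<le> t \<and> ennreal t \<le> s) = (0 \<le> t \<and> ennreal t < s)"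
        by (cases s) (auto simp: ennreal_le_iff ennreal_less_iff)
      then show "a t = indicator {t. 0 \<le> t \<and> ennreal t < s} t * (ennreal (exp (- lam * t)) * load (?e t))"
        unfolding a_def by (simp add: indicator_def)
    qed
  qed
  show ?thesis
    unfolding pt ia[symmetric] ib[symmetric]
  proof (rule ext_integral_diff[OF am bm])
    show "b t < top" for t unfolding b_def by (simp add: indicator_def)
    show "(\<integral>\<^sup>+t. b t \<partial>lborel) < top" unfolding ib by (rule holding_finite)
  qed
qed

lemma expected_cost_eq_J:
  assumes x: "0 \<le> x0" "0 \<le> x1" and \<tau>: "\<tau> \<in> borel_measurable M"
  shows "expected_cost \<tau> x0 x1 = enn2ereal (J \<tau> (x0, x1)) - ereal (1 / c)"
proof -
  let ?z = "(x0, x1)"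
  have rM: "(\<lambda>\<omega>. run ?z \<omega> (\<tau> \<omega>)) \<in> borel_measurable M" by (rule run_measurable[OF \<tau>])
  have dM: "(\<lambda>\<omega>. disc (\<tau> \<omega>) * stop_cost) \<in> borel_measurable M"
    by (rule borel_measurable_times_ennreal[OF measurable_compose[OF \<tau> disc_measurable] borel_measurable_const])
  have hM: "(\<lambda>\<omega>. holding (\<tau> \<omega>)) \<in> borel_measurable M"
    unfolding holding_eq by (rule borel_measurable_minus_ennreal[OF borel_measurable_const dM])
  let ?R = "\<integral>\<^sup>+\<omega>. run ?z \<omega> (\<tau> \<omega>) \<partial>M" and ?D = "\<integral>\<^sup>+\<omega>. disc (\<tau> \<omega>) * stop_cost \<partial>M"
    and ?H = "\<integral>\<^sup>+\<omega>. holding (\<tau> \<omega>) \<partial>M"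
  have HD: "?H + ?D = stop_cost"
    unfolding nn_integral_add[OF hM dM, symmetric] holding_add_disc by (simp add: emeasure_space_1)
  have Hf: "?H < top" using HD stop_cost_finite by (cases ?H) auto
  have Df: "?D < top" using HD stop_cost_finite by (cases ?D) auto
  have J: "J \<tau> ?z = ?R + ?D" unfolding J_def by (rule nn_integral_add[OF rM dM])
  have "expected_cost \<tau> x0 x1 = ext_integral M (\<lambda>\<omega>. enn2ereal (run ?z \<omega> (\<tau> \<omega>)) - enn2ereal (holding (\<tau> \<omega>)))"
    unfolding expected_cost_def by (rule ext_integral_cong) (rule inner_cost[OF _ x])
  also have "\<dots> = enn2ereal ?R - enn2ereal ?H"
    by (rule ext_integral_diff[OF rM hM holding_finite Hf])
  also have "\<dots> = enn2ereal (J \<tau> ?z) - ereal (1 / c)"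
  proof -
    obtain h where h: "?H = ennreal h" "0 \<le> h" using Hf by (cases ?H) auto
    obtain d where d: "?D = ennreal d" "0 \<le> d" using Df by (cases ?D) auto
    have "ennreal (h + d) = ennreal (1 / c)" using HD h d by (simp add: ennreal_plus stop_cost_def)
    then have hd: "h + d = 1 / c" using h d c_pos by (subst (asm) ennreal_inj) auto
    show ?thesis
    proof (cases ?R)
      case (real \<rho>)
      have J': "J \<tau> ?z = ennreal (\<rho> + d)" unfolding J using real d by (simp add: ennreal_plus)
      have "0 \<le> \<rho> + d" using real d by simp
      then show ?thesis unfolding h(1) real(2) J' using real h(2) hd by (simp add: enn2ereal_ennreal del: ennreal_plus)
    next
      case top
      then have "J \<tau> ?z = top" unfolding J by simp
      then show ?thesis unfolding h(1) top using h by (simp add: enn2ereal_ennreal)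
    qed
  qed
  finally show ?thesis .
qed

lemma ereal_shift_le: "enn2ereal a - ereal k \<le> enn2ereal b - ereal k \<longleftrightarrow> a \<le> b"
  by (cases a; cases b) (auto simp: enn2ereal_ennreal ennreal_le_iff top_unique)

lemma V_eq_w:
  assumes x: "0 \<le> x0" "0 \<le> x1"
  shows "V x0 x1 = enn2ereal (w (x0, x1)) - ereal (1 / c)"
proof -
  have z: "0 \<le> fst (x0, x1)" "0 \<le> snd (x0, x1)" using x by auto
  have S: "stopping_time F (hit (contact 0) (x0, x1))" by (rule stopping_time_hit[OF closed_contact])
  show ?thesis
    unfolding V_def
  proof (rule antisym)
    show "(INF \<tau>\<in>{\<tau>. stopping_time F \<tau>}. expected_cost \<tau> x0 x1) \<le> enn2ereal (w (x0, x1)) - ereal (1 / c)"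
      using expected_cost_eq_J[OF x stopping_measurable[OF S]] S unfolding hit_contact_optimal[OF z]
      by (intro INF_lower2[of "hit (contact 0) (x0, x1)"]) simp_all
    show "enn2ereal (w (x0, x1)) - ereal (1 / c) \<le> (INF \<tau>\<in>{\<tau>. stopping_time F \<tau>}. expected_cost \<tau> x0 x1)"
    proof (rule INF_greatest)
      fix \<tau> assume "\<tau> \<in> {\<tau>. stopping_time F \<tau>}"
      then have \<tau>: "stopping_time F \<tau>" by simp
      show "enn2ereal (w (x0, x1)) - ereal (1 / c) \<le> expected_cost \<tau> x0 x1"
        unfolding expected_cost_eq_J[OF x stopping_measurable[OF \<tau>]] ereal_shift_le by (rule w_le_J[OF z \<tau>])
    qed
  qed
qed

lemma V_eq_0_iff:
  assumes x: "0 \<le> x0" "0 \<le> x1"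
  shows "V x0 x1 = 0 \<longleftrightarrow> (x0, x1) \<in> contact 0"
proof -
  obtain v where v: "w (x0, x1) = ennreal v" "0 \<le> v"
    using le_less_trans[OF w_le_stop_cost stop_cost_finite, of "(x0, x1)"] by (cases "w (x0, x1)") auto
  have "v \<le> 1 / c" using w_le_stop_cost[of "(x0, x1)"] c_pos unfolding v(1) stop_cost_def by (simp add: ennreal_le_iff)
  then show ?thesis
    unfolding V_eq_w[OF x] contact_def mem_Collect_eq v(1) stop_cost_def
    using v(2) c_pos by (auto simp: enn2ereal_ennreal ennreal_le_iff zero_ereal_def)
qed

text \<open>
  The process stays in the quadrant, where \<open>V = 0\<close> describes the contact set.
\<close>

lemma tau_star_eq_hit:
  assumes \<omega>: "\<omega> \<in> space M" and x: "0 \<le> x0" "0 \<le> x1"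
  shows "tau_star x0 x1 \<omega> = hit (contact 0) (x0, x1) \<omega>"
proof -
  have "V (\<Phi>0 x0 t \<omega>) (\<Phi>1 x1 t \<omega>) = 0 \<longleftrightarrow> \<Phi> (x0, x1) t \<omega> \<in> contact 0" if t: "0 \<le> t" for t
    using \<Phi>_nonneg[OF \<omega> t, of "(x0, x1)"] x by (simp add: \<Phi>_def V_eq_0_iff)
  then have "{ennreal t |t. 0 \<le> t \<and> V (\<Phi>0 x0 t \<omega>) (\<Phi>1 x1 t \<omega>) = 0} = {ennreal t |t. 0 \<le> t \<and> \<Phi> (x0, x1) t \<omega> \<in> contact 0}"
    by blast
  then show ?thesis unfolding tau_star_def hit_def by (simp only:)
qed

lemma tau_star_smallest_optimal:
  assumes x: "0 \<le> x0" "0 \<le> x1"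
  shows "optimal (tau_star x0 x1) x0 x1 \<and>
    (\<forall>\<tau>. optimal \<tau> x0 x1 \<longrightarrow> (AE \<omega> in M. tau_star x0 x1 \<omega> \<le> \<tau> \<omega>))"
proof (intro conjI allI impI)
  have z: "0 \<le> fst (x0, x1)" "0 \<le> snd (x0, x1)" using x by auto
  let ?S = "hit (contact 0) (x0, x1)"
  have S: "stopping_time F ?S" by (rule stopping_time_hit[OF closed_contact])
  have "stopping_time F (tau_star x0 x1) = stopping_time F ?S"
    by (rule stopping_time_cong) (simp add: tau_star_eq_hit x)
  moreover have "expected_cost (tau_star x0 x1) x0 x1 = expected_cost ?S x0 x1"
    unfolding expected_cost_def by (rule ext_integral_cong) (simp only: tau_star_eq_hit[OF _ x])
  moreover have "expected_cost ?S x0 x1 = V x0 x1"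
    unfolding expected_cost_eq_J[OF x stopping_measurable[OF S]] V_eq_w[OF x] hit_contact_optimal[OF z] ..
  ultimately show "optimal (tau_star x0 x1) x0 x1" using S unfolding optimal_def by simp
  fix \<tau> assume "optimal \<tau> x0 x1"
  then have \<tau>: "stopping_time F \<tau>" and V: "expected_cost \<tau> x0 x1 = V x0 x1" by (auto simp: optimal_def)
  have "enn2ereal (J \<tau> (x0, x1)) - ereal (1 / c) \<le> enn2ereal (w (x0, x1)) - ereal (1 / c)"
    using V unfolding expected_cost_eq_J[OF x stopping_measurable[OF \<tau>]] V_eq_w[OF x] by simp
  then have "J \<tau> (x0, x1) \<le> w (x0, x1)" unfolding ereal_shift_le .
  from optimal_after_contact[OF z \<tau> this]
  show "AE \<omega> in M. tau_star x0 x1 \<omega> \<le> \<tau> \<omega>"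
    by (rule AE_mp) (intro AE_I2 impI, simp add: tau_star_eq_hit x)
qed

end

theorem proposition6p3:
  fixes M :: "'a measure"
    and lam mu c m :: real
    and N :: "real \<Rightarrow> 'a \<Rightarrow> nat" and \<sigma> :: "nat \<Rightarrow> 'a \<Rightarrow> real"
    and Y :: "nat \<Rightarrow> 'a \<Rightarrow> real ^ 'd" and X0 :: "'a \<Rightarrow> real ^ 'd"
    and \<beta>0 \<beta>1 :: "(real ^ 'd) measure" and r :: "real ^ 'd \<Rightarrow> real"
    and \<phi>0 \<phi>1 :: real
  assumes "poisson_disorder M lam mu c m N \<sigma> Y X0 \<beta>0 \<beta>1 r"
    and "0 \<le> \<phi>0" and "0 \<le> \<phi>1"
  shows "poisson_disorder.optimal M lam mu c m N \<sigma> Y X0 r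
           (poisson_disorder.tau_star M lam mu c m N \<sigma> Y X0 r \<phi>0 \<phi>1) \<phi>0 \<phi>1 \<and>
         (\<forall>\<tau>. poisson_disorder.optimal M lam mu c m N \<sigma> Y X0 r \<tau> \<phi>0 \<phi>1 \<longrightarrow>
           (AE \<omega> in M. poisson_disorder.tau_star M lam mu c m N \<sigma> Y X0 r \<phi>0 \<phi>1 \<omega> \<le> \<tau> \<omega>))"
  by (rule poisson_disorder.tau_star_smallest_optimal[OF assms])

end
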